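(* Let $X=\mathbb{C}^n/\Lambda$ be a Cousin group. If $H^1(U,\mathcal{O})$ is finite dimensional over $\mathbb{C}$ for every open subset $U$ of $X$ such that its inverse image $\tilde U$ in $\mathbb{C}^n$ is convex, then $\Lambda$ is strongly dispersive.
   Context: A Cousin group is a connected complex Lie group admitting no non-constant global holomorphic functions. Every Cousin group of dimension $n$ is of the form $\mathbb{C}^n/\Lambda$ with $\Lambda\subset\mathbb{C}^n$ a discrete subgroup of rank $n+m$, $1\le m\le n$. Normal form: after a $\mathbb{C}$-linear change of coordinates of $\mathbb{C}^n$ one may assume that $\Lambda$ is in normal form, i.e. generated over $\mathbb{Z}$ by the columns of a matrix $$P=\begin{pmatrix} O_{m,n-m} & I_m & M+\mathrm{i}N\\ I_{n-m} & R_1 & R_2\end{pmatrix},$$ where $M,N$ are real $m\times m$ matrices with $N$ invertible and $R_1,R_2$ are real $(n-m)\times m$ matrices. Put $R=(R_1\ R_2)$, a real $(n-m)\times 2m$ matrix. Strong dispersiveness: $\Lambda$ (put in normal form; the notion does not depend on the choice of normal form) is strongly dispersive if for every $a\in(0,1)$ there is $C(a)>0$ such that for all $\sigma\in\mathbb{Z}^{n-m}\setminus\{0\}$ and all $\tau\in\mathbb{Z}^{2m}$ one has $\|{}^t\sigma R+{}^t\tau\|\ge C(a)\,a^{|\sigma|}$, where $|\sigma|=\sum_i|\sigma_i|$ and $\|\cdot\|$ is the Euclidean norm. $\mathcal{O}$ is the sheaf of germs of holomorphic functions. *)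

theory Defs
  imports "HOL-Analysis.Analysis" "Jordan_Normal_Form.VS_Connect"
begin

section \<open>First cohomology of a sheaf of functions\<close>

text \<open>
  A sheaf of complex-valued functions on a topological space is given by the map \<open>F\<close> sending an
  open set \<open>V\<close> to the set \<open>F V\<close> of its sections over \<open>V\<close>. Sections are total functions of which
  only the values on \<open>V\<close> matter; accordingly cochains are only ever compared pointwise on the
  relevant open sets.

  \<open>H\<^sup>1(U, F)\<close> is Cech cohomology, the direct limit of \<open>H\<^sup>1(\<U>, F)\<close> over the open coverings \<open>\<U>\<close> of
  \<open>U\<close> (in degree one this is sheaf cohomology on every space). Following Godement, the
  coverings are indexed by the points of \<open>U\<close>, with \<open>x \<in> \<U> x\<close>. Every open covering is refined by
  one of these, so the limit is the usual one; any two have the common refinement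
  \<open>\<lambda>x. \<U> x \<inter> \<V> x\<close>, and the transition maps are plain restriction of cochains.
\<close>

definition pointed_cover :: "'a topology \<Rightarrow> 'a set \<Rightarrow> ('a \<Rightarrow> 'a set) \<Rightarrow> bool" where
  "pointed_cover T U \<U> \<longleftrightarrow> (\<forall>x\<in>U. openin T (\<U> x) \<and> x \<in> \<U> x \<and> \<U> x \<subseteq> U)"

type_synonym 'a cech_cochain = "('a \<Rightarrow> 'a set) \<times> ('a \<Rightarrow> 'a \<Rightarrow> 'a \<Rightarrow> complex)"

definition cech_cocycles ::
    "'a topology \<Rightarrow> ('a set \<Rightarrow> ('a \<Rightarrow> complex) set) \<Rightarrow> 'a set \<Rightarrow> 'a cech_cochain set" where
  "cech_cocycles T F U = {(\<U>, c). pointed_cover T U \<U> \<and>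
     (\<forall>x\<in>U. \<forall>y\<in>U. c x y \<in> F (\<U> x \<inter> \<U> y)) \<and>
     (\<forall>x\<in>U. \<forall>y\<in>U. \<forall>z\<in>U. \<forall>p \<in> \<U> x \<inter> \<U> y \<inter> \<U> z. c y z p - c x z p + c x y p = 0)}"

text \<open>Two cocycles define the same class iff they differ by a coboundary on a common refinement.\<close>

definition cech_rel ::
    "'a topology \<Rightarrow> ('a set \<Rightarrow> ('a \<Rightarrow> complex) set) \<Rightarrow> 'a set \<Rightarrow>
     ('a cech_cochain \<times> 'a cech_cochain) set" where
  "cech_rel T F U = {((\<U>, c), (\<V>, d)).
     (\<U>, c) \<in> cech_cocycles T F U \<and> (\<V>, d) \<in> cech_cocycles T F U \<and>
     (\<exists>\<W> g. pointed_cover T U \<W> \<and> (\<forall>x\<in>U. \<W> x \<subseteq> \<U> x \<inter> \<V> x) \<and> (\<forall>x\<in>U. g x \<in> F (\<W> x)) \<and>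
        (\<forall>x\<in>U. \<forall>y\<in>U. \<forall>p \<in> \<W> x \<inter> \<W> y. c x y p - d x y p = g y p - g x p))}"

definition cech_H1 ::
    "'a topology \<Rightarrow> ('a set \<Rightarrow> ('a \<Rightarrow> complex) set) \<Rightarrow> 'a set \<Rightarrow>
     (complex, 'a cech_cochain set) module" where
  "cech_H1 T F U = \<lparr>
     carrier = cech_cocycles T F U // cech_rel T F U,
     monoid.mult = undefined,
     one = undefined,
     zero = cech_rel T F U `` {(\<lambda>x. U, \<lambda>x y p. 0)},
     add = (\<lambda>h k. \<Union>(\<U>, c)\<in>h. \<Union>(\<V>, d)\<in>k.
              cech_rel T F U `` {(\<lambda>x. \<U> x \<inter> \<V> x, \<lambda>x y p. c x y p + d x y p)}),
     module.smult = (\<lambda>a h. \<Union>(\<U>, c)\<in>h. cech_rel T F U `` {(\<U>, \<lambda>x y p. a * c x y p)})\<rparr>"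

text \<open>For a presheaf of complex vector spaces, \<open>cech_H1\<close> is a complex vector space (so that its
  dimension makes sense).\<close>

locale linear_presheaf =
  fixes T :: "'a topology" and F :: "'a set \<Rightarrow> ('a \<Rightarrow> complex) set"
  assumes zero_section: "(\<lambda>p. 0) \<in> F V"
    and add_section: "f \<in> F V \<Longrightarrow> g \<in> F V \<Longrightarrow> (\<lambda>p. f p + g p) \<in> F V"
    and scale_section: "f \<in> F V \<Longrightarrow> (\<lambda>p. a * f p) \<in> F V"
    and restrict_section: "f \<in> F V \<Longrightarrow> W \<subseteq> V \<Longrightarrow> f \<in> F W"
begin

definition cadd :: "'a cech_cochain \<Rightarrow> 'a cech_cochain \<Rightarrow> 'a cech_cochain" where
  "cadd = (\<lambda>(\<U>, c) (\<V>, d). (\<lambda>x. \<U> x \<inter> \<V> x, \<lambda>x y p. c x y p + d x y p))"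

definition cscale :: "complex \<Rightarrow> 'a cech_cochain \<Rightarrow> 'a cech_cochain" where
  "cscale a = (\<lambda>(\<U>, c). (\<U>, \<lambda>x y p. a * c x y p))"

lemma pointed_cover_Int:
  "pointed_cover T U \<U> \<Longrightarrow> pointed_cover T U \<V> \<Longrightarrow> pointed_cover T U (\<lambda>x. \<U> x \<inter> \<V> x)"
  unfolding pointed_cover_def by auto

lemma cadd_cocycles:
  assumes "P \<in> cech_cocycles T F U" "Q \<in> cech_cocycles T F U"
  shows "cadd P Q \<in> cech_cocycles T F U"
proof -
  obtain \<U> c \<V> d where PQ: "P = (\<U>, c)" "Q = (\<V>, d)" by (metis surj_pair)
  have 1: "(\<lambda>p. c x y p + d x y p) \<in> F (\<U> x \<inter> \<V> x \<inter> (\<U> y \<inter> \<V> y))" if "x \<in> U" "y \<in> U" for x y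
  proof (rule add_section)
    show "c x y \<in> F (\<U> x \<inter> \<V> x \<inter> (\<U> y \<inter> \<V> y))"
      by (rule restrict_section[of _ "\<U> x \<inter> \<U> y"])
        (use assms that in \<open>auto simp: PQ cech_cocycles_def\<close>)
    show "d x y \<in> F (\<U> x \<inter> \<V> x \<inter> (\<U> y \<inter> \<V> y))"
      by (rule restrict_section[of _ "\<V> x \<inter> \<V> y"])
        (use assms that in \<open>auto simp: PQ cech_cocycles_def\<close>)
  qed
  have 2: "c y z p + d y z p - (c x z p + d x z p) + (c x y p + d x y p) = 0"
    if "x \<in> U" "y \<in> U" "z \<in> U" "p \<in> \<U> x \<inter> \<U> y \<inter> \<U> z" "p \<in> \<V> x \<inter> \<V> y \<inter> \<V> z" for x y z p
  proof -
    have "c y z p - c x z p + c x y p = 0" "d y z p - d x z p + d x y p = 0"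
      using assms that unfolding PQ cech_cocycles_def by blast+
    then have "(c y z p - c x z p + c x y p) + (d y z p - d x z p + d x y p) = 0" by simp
    then show ?thesis by (simp add: algebra_simps)
  qed
  have 3: "pointed_cover T U (\<lambda>x. \<U> x \<inter> \<V> x)"
    using assms by (intro pointed_cover_Int) (auto simp: PQ cech_cocycles_def)
  show ?thesis
    unfolding PQ cadd_def cech_cocycles_def using 1 2 3 by simp
qed

lemma cscale_cocycles:
  assumes "P \<in> cech_cocycles T F U"
  shows "cscale a P \<in> cech_cocycles T F U"
proof -
  obtain \<U> c where P: "P = (\<U>, c)" by (metis surj_pair)
  have "a * c y z p - a * c x z p + a * c x y p = 0"
    if "x \<in> U" "y \<in> U" "z \<in> U" "p \<in> \<U> x \<inter> \<U> y \<inter> \<U> z" for x y z p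
  proof -
    have "c y z p - c x z p + c x y p = 0"
      using assms that unfolding P cech_cocycles_def by blast
    then have "a * (c y z p - c x z p + c x y p) = 0" by simp
    then show ?thesis by (simp add: algebra_simps)
  qed
  then show ?thesis
    using assms scale_section unfolding P cscale_def cech_cocycles_def by simp
qed

lemma zero_cocycles:
  "openin T U \<Longrightarrow> (\<lambda>x. U, \<lambda>x y p. 0) \<in> cech_cocycles T F U"
  unfolding cech_cocycles_def pointed_cover_def by (simp add: zero_section)

lemma cech_relI:
  assumes "(\<U>, c) \<in> cech_cocycles T F U" "(\<V>, d) \<in> cech_cocycles T F U"
    and "pointed_cover T U \<W>" "\<And>x. x \<in> U \<Longrightarrow> \<W> x \<subseteq> \<U> x" "\<And>x. x \<in> U \<Longrightarrow> \<W> x \<subseteq> \<V> x"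
    and "\<And>x. x \<in> U \<Longrightarrow> g x \<in> F (\<W> x)"
    and "\<And>x y p. x \<in> U \<Longrightarrow> y \<in> U \<Longrightarrow> p \<in> \<W> x \<Longrightarrow> p \<in> \<W> y \<Longrightarrow> c x y p - d x y p = g y p - g x p"
  shows "((\<U>, c), (\<V>, d)) \<in> cech_rel T F U"
  unfolding cech_rel_def using assms by (auto intro!: exI[of _ \<W>] exI[of _ g])

lemma cech_relE:
  assumes "((\<U>, c), (\<V>, d)) \<in> cech_rel T F U"
  obtains \<W> g where "(\<U>, c) \<in> cech_cocycles T F U" "(\<V>, d) \<in> cech_cocycles T F U"
    "pointed_cover T U \<W>" "\<And>x. x \<in> U \<Longrightarrow> \<W> x \<subseteq> \<U> x" "\<And>x. x \<in> U \<Longrightarrow> \<W> x \<subseteq> \<V> x"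
    "\<And>x. x \<in> U \<Longrightarrow> g x \<in> F (\<W> x)"
    "\<And>x y p. x \<in> U \<Longrightarrow> y \<in> U \<Longrightarrow> p \<in> \<W> x \<Longrightarrow> p \<in> \<W> y \<Longrightarrow> c x y p - d x y p = g y p - g x p"
proof -
  obtain \<W> g where "(\<U>, c) \<in> cech_cocycles T F U" "(\<V>, d) \<in> cech_cocycles T F U"
    "pointed_cover T U \<W>" "\<forall>x\<in>U. \<W> x \<subseteq> \<U> x \<inter> \<V> x"
    "\<forall>x\<in>U. g x \<in> F (\<W> x)"
    "\<forall>x\<in>U. \<forall>y\<in>U. \<forall>p\<in>\<W> x \<inter> \<W> y. c x y p - d x y p = g y p - g x p"
    using assms unfolding cech_rel_def by auto
  then show ?thesis by (intro that[of \<W> g]) auto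
qed

lemma cech_rel_same:
  assumes "(\<U>, c) \<in> cech_cocycles T F U" "(\<V>, d) \<in> cech_cocycles T F U"
    and "\<And>x y p. c x y p = d x y p"
  shows "((\<U>, c), (\<V>, d)) \<in> cech_rel T F U"
  by (rule cech_relI[where \<W> = "\<lambda>x. \<U> x \<inter> \<V> x" and g = "\<lambda>x p. 0"])
    (use assms in \<open>auto simp: zero_section cech_cocycles_def intro!: pointed_cover_Int\<close>)

lemma equiv_cech_rel: "equiv (cech_cocycles T F U) (cech_rel T F U)"
proof (rule equivI)
  show "cech_rel T F U \<subseteq> cech_cocycles T F U \<times> cech_cocycles T F U"
    unfolding cech_rel_def by auto
  show "refl_on (cech_cocycles T F U) (cech_rel T F U)"
    by (rule refl_onI) (auto intro!: cech_rel_same)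
  show "sym (cech_rel T F U)"
  proof (rule symI)
    fix P Q assume *: "(P, Q) \<in> cech_rel T F U"
    obtain \<U> c \<V> d where PQ: "P = (\<U>, c)" "Q = (\<V>, d)" by (metis surj_pair)
    from * obtain \<W> g where *: "(\<U>, c) \<in> cech_cocycles T F U" "(\<V>, d) \<in> cech_cocycles T F U"
      "pointed_cover T U \<W>" "\<And>x. x \<in> U \<Longrightarrow> \<W> x \<subseteq> \<U> x" "\<And>x. x \<in> U \<Longrightarrow> \<W> x \<subseteq> \<V> x"
      "\<And>x. x \<in> U \<Longrightarrow> g x \<in> F (\<W> x)"
      "\<And>x y p. x \<in> U \<Longrightarrow> y \<in> U \<Longrightarrow> p \<in> \<W> x \<Longrightarrow> p \<in> \<W> y \<Longrightarrow> c x y p - d x y p = g y p - g x p"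
      unfolding PQ by (rule cech_relE) (rule that)
    have g: "(\<lambda>p. - 1 * g x p) \<in> F (\<W> x)" if "x \<in> U" for x
      using *(6)[OF that] by (rule scale_section)
    show "(Q, P) \<in> cech_rel T F U"
      unfolding PQ
    proof (rule cech_relI[where \<W> = \<W> and g = "\<lambda>x p. - 1 * g x p"])
      fix x y p assume "x \<in> U" "y \<in> U" "p \<in> \<W> x" "p \<in> \<W> y"
      then have "c x y p = d x y p + (g y p - g x p)"
        using *(7)[of x y p] by (simp add: diff_eq_eq add.commute)
      then show "d x y p - c x y p = - 1 * g y p - - 1 * g x p" by simp
    qed (use * g in auto)
  qed
  show "trans (cech_rel T F U)"
  proof (rule transI)
    fix P Q S assume PQ: "(P, Q) \<in> cech_rel T F U" and QS: "(Q, S) \<in> cech_rel T F U"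
    obtain \<U> c \<V> d \<X> e where eq: "P = (\<U>, c)" "Q = (\<V>, d)" "S = (\<X>, e)" by (metis surj_pair)
    from PQ obtain \<W> g where *: "(\<U>, c) \<in> cech_cocycles T F U" "(\<V>, d) \<in> cech_cocycles T F U"
      "pointed_cover T U \<W>" "\<And>x. x \<in> U \<Longrightarrow> \<W> x \<subseteq> \<U> x" "\<And>x. x \<in> U \<Longrightarrow> \<W> x \<subseteq> \<V> x"
      "\<And>x. x \<in> U \<Longrightarrow> g x \<in> F (\<W> x)"
      "\<And>x y p. x \<in> U \<Longrightarrow> y \<in> U \<Longrightarrow> p \<in> \<W> x \<Longrightarrow> p \<in> \<W> y \<Longrightarrow> c x y p - d x y p = g y p - g x p"
      unfolding eq by (rule cech_relE) (rule that)
    from QS obtain \<W>' g' where **: "(\<V>, d) \<in> cech_cocycles T F U" "(\<X>, e) \<in> cech_cocycles T F U"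
      "pointed_cover T U \<W>'" "\<And>x. x \<in> U \<Longrightarrow> \<W>' x \<subseteq> \<V> x" "\<And>x. x \<in> U \<Longrightarrow> \<W>' x \<subseteq> \<X> x"
      "\<And>x. x \<in> U \<Longrightarrow> g' x \<in> F (\<W>' x)"
      "\<And>x y p. x \<in> U \<Longrightarrow> y \<in> U \<Longrightarrow> p \<in> \<W>' x \<Longrightarrow> p \<in> \<W>' y \<Longrightarrow> d x y p - e x y p = g' y p - g' x p"
      unfolding eq by (rule cech_relE) (rule that)
    have g: "(\<lambda>p. g x p + g' x p) \<in> F (\<W> x \<inter> \<W>' x)" if "x \<in> U" for x
      using *(6)[OF that] **(6)[OF that] by (intro add_section) (auto intro: restrict_section)
    show "(P, S) \<in> cech_rel T F U"
      unfolding eq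
    proof (rule cech_relI[where \<W> = "\<lambda>x. \<W> x \<inter> \<W>' x" and g = "\<lambda>x p. g x p + g' x p"])
      fix x y p assume "x \<in> U" "y \<in> U" "p \<in> \<W> x \<inter> \<W>' x" "p \<in> \<W> y \<inter> \<W>' y"
      then have "c x y p - d x y p = g y p - g x p" "d x y p - e x y p = g' y p - g' x p"
        using *(7)[of x y p] **(7)[of x y p] by auto
      note h = this
      have "c x y p - e x y p = (c x y p - d x y p) + (d x y p - e x y p)" by simp
      also have "\<dots> = (g y p - g x p) + (g' y p - g' x p)" by (simp only: h)
      also have "\<dots> = g y p + g' y p - (g x p + g' x p)" by (rule add_diff_add[symmetric])
      finally show "c x y p - e x y p = g y p + g' y p - (g x p + g' x p)" .
    next
      fix x assume "x \<in> U"
      then show "\<W> x \<inter> \<W>' x \<subseteq> \<U> x" "\<W> x \<inter> \<W>' x \<subseteq> \<X> x"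
        using *(4)[of x] **(5)[of x] by auto
    qed (use * ** g in \<open>auto intro: pointed_cover_Int\<close>)
  qed
qed

lemma cadd_cong:
  assumes "(P, P') \<in> cech_rel T F U" "(Q, Q') \<in> cech_rel T F U"
  shows "(cadd P Q, cadd P' Q') \<in> cech_rel T F U"
proof -
  obtain \<U> c \<V> d \<U>' c' \<V>' d' where eq: "P = (\<U>, c)" "Q = (\<V>, d)" "P' = (\<U>', c')" "Q' = (\<V>', d')"
    by (metis surj_pair)
  from assms(1) obtain \<W> g where *:
      "(\<U>, c) \<in> cech_cocycles T F U" "(\<U>', c') \<in> cech_cocycles T F U"
      "pointed_cover T U \<W>" "\<And>x. x \<in> U \<Longrightarrow> \<W> x \<subseteq> \<U> x" "\<And>x. x \<in> U \<Longrightarrow> \<W> x \<subseteq> \<U>' x"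
      "\<And>x. x \<in> U \<Longrightarrow> g x \<in> F (\<W> x)"
      "\<And>x y p. x \<in> U \<Longrightarrow> y \<in> U \<Longrightarrow> p \<in> \<W> x \<Longrightarrow> p \<in> \<W> y \<Longrightarrow> c x y p - c' x y p = g y p - g x p"
    unfolding eq by (rule cech_relE) (rule that)
  from assms(2) obtain \<W>' g' where **:
      "(\<V>, d) \<in> cech_cocycles T F U" "(\<V>', d') \<in> cech_cocycles T F U"
      "pointed_cover T U \<W>'" "\<And>x. x \<in> U \<Longrightarrow> \<W>' x \<subseteq> \<V> x" "\<And>x. x \<in> U \<Longrightarrow> \<W>' x \<subseteq> \<V>' x"
      "\<And>x. x \<in> U \<Longrightarrow> g' x \<in> F (\<W>' x)"
      "\<And>x y p. x \<in> U \<Longrightarrow> y \<in> U \<Longrightarrow> p \<in> \<W>' x \<Longrightarrow> p \<in> \<W>' y \<Longrightarrow> d x y p - d' x y p = g' y p - g' x p"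
    unfolding eq by (rule cech_relE) (rule that)
  have Z: "cadd P Q \<in> cech_cocycles T F U" "cadd P' Q' \<in> cech_cocycles T F U"
    using assms by (auto intro!: cadd_cocycles simp: cech_rel_def)
  have g: "(\<lambda>p. g x p + g' x p) \<in> F (\<W> x \<inter> \<W>' x)" if "x \<in> U" for x
    using *(6)[OF that] **(6)[OF that] by (intro add_section) (auto intro: restrict_section)
  show ?thesis
    unfolding eq cadd_def prod.case
  proof (rule cech_relI[where \<W> = "\<lambda>x. \<W> x \<inter> \<W>' x" and g = "\<lambda>x p. g x p + g' x p"])
    fix x y p assume "x \<in> U" "y \<in> U" "p \<in> \<W> x \<inter> \<W>' x" "p \<in> \<W> y \<inter> \<W>' y"
    then have "c x y p - c' x y p = g y p - g x p" "d x y p - d' x y p = g' y p - g' x p"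
      using *(7)[of x y p] **(7)[of x y p] by auto
    then show "c x y p + d x y p - (c' x y p + d' x y p) = g y p + g' y p - (g x p + g' x p)"
      by (simp add: add_diff_add)
  next
    fix x assume "x \<in> U"
    then show "\<W> x \<inter> \<W>' x \<subseteq> \<U> x \<inter> \<V> x" "\<W> x \<inter> \<W>' x \<subseteq> \<U>' x \<inter> \<V>' x"
      using *(4,5)[of x] **(4,5)[of x] by auto
  qed (use Z * ** g in \<open>auto intro: pointed_cover_Int simp: eq cadd_def\<close>)
qed

lemma cscale_cong:
  assumes "(P, P') \<in> cech_rel T F U"
  shows "(cscale a P, cscale a P') \<in> cech_rel T F U"
proof -
  obtain \<U> c \<U>' c' where eq: "P = (\<U>, c)" "P' = (\<U>', c')"
    by (metis surj_pair)
  from assms(1) obtain \<W> g where *: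
      "(\<U>, c) \<in> cech_cocycles T F U" "(\<U>', c') \<in> cech_cocycles T F U"
      "pointed_cover T U \<W>" "\<And>x. x \<in> U \<Longrightarrow> \<W> x \<subseteq> \<U> x" "\<And>x. x \<in> U \<Longrightarrow> \<W> x \<subseteq> \<U>' x"
      "\<And>x. x \<in> U \<Longrightarrow> g x \<in> F (\<W> x)"
      "\<And>x y p. x \<in> U \<Longrightarrow> y \<in> U \<Longrightarrow> p \<in> \<W> x \<Longrightarrow> p \<in> \<W> y \<Longrightarrow> c x y p - c' x y p = g y p - g x p"
    unfolding eq by (rule cech_relE) (rule that)
  have Z: "cscale a P \<in> cech_cocycles T F U" "cscale a P' \<in> cech_cocycles T F U"
    using assms by (auto intro!: cscale_cocycles simp: cech_rel_def)
  show ?thesis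
    unfolding eq cscale_def prod.case
  proof (rule cech_relI[where \<W> = \<W> and g = "\<lambda>x p. a * g x p"])
    fix x y p assume "x \<in> U" "y \<in> U" "p \<in> \<W> x" "p \<in> \<W> y"
    then have "c x y p - c' x y p = g y p - g x p"
      using *(7)[of x y p] by auto
    then show "a * c x y p - a * c' x y p = a * g y p - a * g x p"
      by (simp flip: right_diff_distrib)
  qed (use Z * in \<open>auto intro: scale_section simp: eq cscale_def\<close>)
qed

abbreviation cls :: "'a set \<Rightarrow> 'a cech_cochain \<Rightarrow> 'a cech_cochain set" where
  "cls U P \<equiv> cech_rel T F U `` {P}"

lemma cls_eq:
  "P \<in> cech_cocycles T F U \<Longrightarrow> Q \<in> cech_cocycles T F U \<Longrightarrow>
     cls U P = cls U Q \<longleftrightarrow> (P, Q) \<in> cech_rel T F U"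
  using eq_equiv_class_iff[OF equiv_cech_rel] by blast

lemma carrier_cech_H1: "carrier (cech_H1 T F U) = cls U ` cech_cocycles T F U"
  by (auto simp: cech_H1_def quotient_def)

lemma add_cech_H1:
  assumes "P \<in> cech_cocycles T F U" "Q \<in> cech_cocycles T F U"
  shows "cls U P \<oplus>\<^bsub>cech_H1 T F U\<^esub> cls U Q = cls U (cadd P Q)"
proof -
  have "cls U P \<oplus>\<^bsub>cech_H1 T F U\<^esub> cls U Q = (\<Union>P'\<in>cls U P. \<Union>Q'\<in>cls U Q. cls U (cadd P' Q'))"
    by (simp add: cech_H1_def cadd_def case_prod_unfold)
  also have "\<dots> = cls U (cadd P Q)"
    by (rule UN_equiv_class2[OF equiv_cech_rel equiv_cech_rel _ assms])
      (auto intro!: congruent2I' equiv_class_eq[OF equiv_cech_rel] cadd_cong)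
  finally show ?thesis .
qed

lemma smult_cech_H1:
  assumes "P \<in> cech_cocycles T F U"
  shows "a \<odot>\<^bsub>cech_H1 T F U\<^esub> cls U P = cls U (cscale a P)"
proof -
  have "a \<odot>\<^bsub>cech_H1 T F U\<^esub> cls U P = (\<Union>P'\<in>cls U P. cls U (cscale a P'))"
    by (simp add: cech_H1_def cscale_def case_prod_unfold)
  also have "\<dots> = cls U (cscale a P)"
    by (rule UN_equiv_class[OF equiv_cech_rel _ assms])
      (auto intro!: congruentI equiv_class_eq[OF equiv_cech_rel] cscale_cong)
  finally show ?thesis .
qed

lemma zero_cech_H1: "\<zero>\<^bsub>cech_H1 T F U\<^esub> = cls U (\<lambda>x. U, \<lambda>x y p. 0)"
  by (simp add: cech_H1_def)

lemma cls_eqI: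
  assumes "P \<in> cech_cocycles T F U" "Q \<in> cech_cocycles T F U" "snd P = snd Q"
  shows "cls U P = cls U Q"
proof -
  obtain \<U> c \<V> where "P = (\<U>, c)" "Q = (\<V>, c)"
    using assms(3) by (metis prod.collapse)
  then show ?thesis
    using cech_rel_same[of \<U> c U \<V> c] assms cls_eq[of P U Q] by simp
qed

lemmas cech_simps = carrier_cech_H1 add_cech_H1 smult_cech_H1 zero_cech_H1
  cadd_cocycles cscale_cocycles zero_cocycles

lemma snd_cadd: "snd (cadd P Q) = (\<lambda>x y p. snd P x y p + snd Q x y p)"
  by (simp add: cadd_def case_prod_unfold)

lemma snd_cscale: "snd (cscale a P) = (\<lambda>x y p. a * snd P x y p)"
  by (simp add: cscale_def case_prod_unfold)

lemma vectorspace_cech_H1: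
  assumes "openin T U"
  shows "vectorspace class_ring (cech_H1 T F U)"
proof -
  have "abelian_group (cech_H1 T F U)"
  proof (rule abelian_groupI)
    fix h assume "h \<in> carrier (cech_H1 T F U)"
    then obtain P where P: "P \<in> cech_cocycles T F U" "h = cls U P"
      by (auto simp: carrier_cech_H1)
    have "cls U (cscale (- 1) P) \<oplus>\<^bsub>cech_H1 T F U\<^esub> h = \<zero>\<^bsub>cech_H1 T F U\<^esub>"
      unfolding P(2) using P(1) assms
      by (simp add: cech_simps) (rule cls_eqI, auto simp: cech_simps snd_cadd snd_cscale)
    then show "\<exists>k\<in>carrier (cech_H1 T F U). k \<oplus>\<^bsub>cech_H1 T F U\<^esub> h = \<zero>\<^bsub>cech_H1 T F U\<^esub>"
      using P(1) by (auto simp: carrier_cech_H1 intro: cscale_cocycles)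
  next
    show "\<zero>\<^bsub>cech_H1 T F U\<^esub> \<in> carrier (cech_H1 T F U)"
      using assms by (auto simp: cech_simps)
  next
    fix h k assume "h \<in> carrier (cech_H1 T F U)" "k \<in> carrier (cech_H1 T F U)"
    then obtain P Q where PQ: "P \<in> cech_cocycles T F U" "Q \<in> cech_cocycles T F U"
        and hk: "h = cls U P" "k = cls U Q"
      by (auto simp: carrier_cech_H1)
    show "h \<oplus>\<^bsub>cech_H1 T F U\<^esub> k \<in> carrier (cech_H1 T F U)"
      using PQ unfolding hk by (simp add: cech_simps)
    show "h \<oplus>\<^bsub>cech_H1 T F U\<^esub> k = k \<oplus>\<^bsub>cech_H1 T F U\<^esub> h"
      unfolding hk add_cech_H1[OF PQ] add_cech_H1[OF PQ(2,1)]
      by (rule cls_eqI) (use PQ in \<open>simp_all add: cadd_cocycles snd_cadd add.commute\<close>)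
    have zero: "(\<lambda>x. U, \<lambda>x y p. 0) \<in> cech_cocycles T F U"
      by (rule zero_cocycles[OF assms])
    show "\<zero>\<^bsub>cech_H1 T F U\<^esub> \<oplus>\<^bsub>cech_H1 T F U\<^esub> h = h"
      unfolding hk zero_cech_H1 add_cech_H1[OF zero PQ(1)]
      by (rule cls_eqI) (use PQ zero in \<open>simp_all add: cadd_cocycles snd_cadd\<close>)
    fix l assume "l \<in> carrier (cech_H1 T F U)"
    then obtain S where S: "S \<in> cech_cocycles T F U" and l: "l = cls U S"
      by (auto simp: carrier_cech_H1)
    show "h \<oplus>\<^bsub>cech_H1 T F U\<^esub> k \<oplus>\<^bsub>cech_H1 T F U\<^esub> l = h \<oplus>\<^bsub>cech_H1 T F U\<^esub> (k \<oplus>\<^bsub>cech_H1 T F U\<^esub> l)"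
      unfolding hk l add_cech_H1[OF PQ] add_cech_H1[OF PQ(2) S]
        add_cech_H1[OF cadd_cocycles[OF PQ] S] add_cech_H1[OF PQ(1) cadd_cocycles[OF PQ(2) S]]
      by (rule cls_eqI) (use PQ S in \<open>simp_all add: cadd_cocycles snd_cadd add.assoc\<close>)
  qed
  then have "Module.module class_ring (cech_H1 T F U)"
    using class_field.field_axioms
    by (intro module.intro Module.module_axioms.intro)
      (simp add: field_def domain_def,
       (clarsimp simp: cech_simps; (rule imageI cls_eqI)?;
        simp add: cech_simps snd_cadd snd_cscale algebra_simps)+)
  then show ?thesis
    using class_field.field_axioms by (simp add: vectorspace_def)
qed

end


section \<open>The complex manifold \<open>\<complex>\<^sup>n/\<Lambda>\<close>\<close>

definition holomorphic_Cn :: "(complex^'n \<Rightarrow> complex) \<Rightarrow> (complex^'n) set \<Rightarrow> bool" where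
  "holomorphic_Cn f S \<longleftrightarrow>
     (\<forall>z\<in>S. \<exists>f'. (f has_derivative f') (at z) \<and> (\<forall>c v. f' (c *s v) = c * f' v))"

definition qproj :: "(complex^'n) set \<Rightarrow> complex^'n \<Rightarrow> (complex^'n) set" where
  "qproj \<Lambda> z = (\<lambda>l. z + l) ` \<Lambda>"

definition quot_topology :: "(complex^'n) set \<Rightarrow> (complex^'n) set topology" where
  "quot_topology \<Lambda> = topology (\<lambda>V. V \<subseteq> range (qproj \<Lambda>) \<and> open (qproj \<Lambda> -` V))"

lemma openin_quot_topology:
  "openin (quot_topology \<Lambda>) V \<longleftrightarrow> V \<subseteq> range (qproj \<Lambda>) \<and> open (qproj \<Lambda> -` V)"
proof -
  have "istopology (\<lambda>V. V \<subseteq> range (qproj \<Lambda>) \<and> open (qproj \<Lambda> -` V))"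
    unfolding istopology_def by (auto simp: vimage_Union)
  then show ?thesis
    by (simp add: quot_topology_def topology_inverse')
qed

text \<open>The projection is a local biholomorphism onto \<open>\<complex>\<^sup>n/\<Lambda>\<close> (for \<open>\<Lambda>\<close> a discrete subgroup), so
  holomorphy downstairs is holomorphy of the pullback.\<close>

definition quot_sheaf_O :: "(complex^'n) set \<Rightarrow> (complex^'n) set set \<Rightarrow>
    ((complex^'n) set \<Rightarrow> complex) set" where
  "quot_sheaf_O \<Lambda> V = {f. holomorphic_Cn (f \<circ> qproj \<Lambda>) (qproj \<Lambda> -` V)}"

lemma linear_presheaf_quot_sheaf_O:
  fixes \<Lambda> :: "(complex^'n) set"
  shows "linear_presheaf (quot_sheaf_O \<Lambda>)"
proof
  fix V W :: "(complex^'n) set set" and f g :: "(complex^'n) set \<Rightarrow> complex" and a :: complex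
  show "(\<lambda>p. 0) \<in> quot_sheaf_O \<Lambda> V"
    unfolding quot_sheaf_O_def holomorphic_Cn_def o_def
    by (auto intro!: exI[of _ "\<lambda>v. 0"])
  show "f \<in> quot_sheaf_O \<Lambda> V \<Longrightarrow> W \<subseteq> V \<Longrightarrow> f \<in> quot_sheaf_O \<Lambda> W"
    unfolding quot_sheaf_O_def holomorphic_Cn_def by blast
  assume f: "f \<in> quot_sheaf_O \<Lambda> V"
  show "(\<lambda>p. a * f p) \<in> quot_sheaf_O \<Lambda> V"
    unfolding quot_sheaf_O_def holomorphic_Cn_def mem_Collect_eq
  proof
    fix z assume "z \<in> qproj \<Lambda> -` V"
    then obtain f' where "(f \<circ> qproj \<Lambda> has_derivative f') (at z)" "\<forall>c v. f' (c *s v) = c * f' v"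
      using f unfolding quot_sheaf_O_def holomorphic_Cn_def by blast
    then show "\<exists>f'. ((\<lambda>p. a * f p) \<circ> qproj \<Lambda> has_derivative f') (at z) \<and>
        (\<forall>c v. f' (c *s v) = c * f' v)"
      by (intro exI[of _ "\<lambda>v. a * f' v"]) (auto intro!: has_derivative_mult_right simp: o_def)
  qed
  assume g: "g \<in> quot_sheaf_O \<Lambda> V"
  show "(\<lambda>p. f p + g p) \<in> quot_sheaf_O \<Lambda> V"
    unfolding quot_sheaf_O_def holomorphic_Cn_def mem_Collect_eq
  proof
    fix z assume "z \<in> qproj \<Lambda> -` V"
    then obtain f' g' where "(f \<circ> qproj \<Lambda> has_derivative f') (at z)" "\<forall>c v. f' (c *s v) = c * f' v"
        "(g \<circ> qproj \<Lambda> has_derivative g') (at z)" "\<forall>c v. g' (c *s v) = c * g' v"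
      using f g unfolding quot_sheaf_O_def holomorphic_Cn_def by blast
    then show "\<exists>f'. ((\<lambda>p. f p + g p) \<circ> qproj \<Lambda> has_derivative f') (at z) \<and>
        (\<forall>c v. f' (c *s v) = c * f' v)"
      by (intro exI[of _ "\<lambda>v. f' v + g' v"])
        (auto intro!: has_derivative_add simp: o_def algebra_simps)
  qed
qed

corollary vectorspace_H1_quot_sheaf_O:
  "openin (quot_topology \<Lambda>) U \<Longrightarrow>
     vectorspace class_ring (cech_H1 (quot_topology \<Lambda>) (quot_sheaf_O \<Lambda>) U)"
  by (rule linear_presheaf.vectorspace_cech_H1[OF linear_presheaf_quot_sheaf_O])

definition discrete_subgroup :: "(complex^'n) set \<Rightarrow> bool" where
  "discrete_subgroup \<Lambda> \<longleftrightarrow> 0 \<in> \<Lambda> \<and> (\<forall>x\<in>\<Lambda>. \<forall>y\<in>\<Lambda>. x - y \<in> \<Lambda>) \<and> discrete \<Lambda>"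

text \<open>\<open>\<complex>\<^sup>n/\<Lambda>\<close> is a Cousin group; it is automatically connected.\<close>

definition cousin :: "(complex^'n) set \<Rightarrow> bool" where
  "cousin \<Lambda> \<longleftrightarrow> discrete_subgroup \<Lambda> \<and>
     (\<forall>f \<in> quot_sheaf_O \<Lambda> (range (qproj \<Lambda>)). f constant_on range (qproj \<Lambda>))"


section \<open>Normal forms and strong dispersiveness\<close>

definition hcat :: "'a::zero mat \<Rightarrow> 'a mat \<Rightarrow> 'a mat" where
  "hcat A B = four_block_mat A B (0\<^sub>m 0 (dim_col A)) (0\<^sub>m 0 (dim_col B))"

definition normal_form_mat ::
    "nat \<Rightarrow> nat \<Rightarrow> real mat \<Rightarrow> real mat \<Rightarrow> real mat \<Rightarrow> real mat \<Rightarrow> complex mat" where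
  "normal_form_mat n m M N R\<^sub>1 R\<^sub>2 = four_block_mat
     (0\<^sub>m m (n - m)) (hcat (1\<^sub>m m) (map_mat complex_of_real M + \<i> \<cdot>\<^sub>m map_mat complex_of_real N))
     (1\<^sub>m (n - m)) (map_mat complex_of_real (hcat R\<^sub>1 R\<^sub>2))"

text \<open>The \<open>\<complex>\<close>-linear coordinate change is the invertible matrix \<open>A\<close>; the bijection \<open>e\<close> merely
  numbers the coordinates of \<open>\<complex>\<^sup>n\<close>, as the index type \<open>'n\<close> carries no order. Matrices whose size
  depends on \<open>m\<close> have explicit dimensions since \<open>n - m\<close> may be \<open>0\<close>.\<close>

definition normal_form ::
    "(complex^'n) set \<Rightarrow> nat \<Rightarrow> real mat \<Rightarrow> real mat \<Rightarrow> real mat \<Rightarrow> real mat \<Rightarrow> bool" where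
  "normal_form \<Lambda> m M N R\<^sub>1 R\<^sub>2 \<longleftrightarrow> (let n = CARD('n) in
     1 \<le> m \<and> m \<le> n \<and>
     M \<in> carrier_mat m m \<and> N \<in> carrier_mat m m \<and> invertible_mat N \<and>
     R\<^sub>1 \<in> carrier_mat (n - m) m \<and> R\<^sub>2 \<in> carrier_mat (n - m) m \<and>
     (\<exists>(A :: complex^'n^'n) e. invertible A \<and> bij_betw e {..<n} UNIV \<and>
        (\<forall>z. z \<in> \<Lambda> \<longleftrightarrow> (\<exists>k \<in> carrier_vec (n + m).
           Matrix.vec n (\<lambda>i. vec_nth (A *v z) (e i)) =
             normal_form_mat n m M N R\<^sub>1 R\<^sub>2 *\<^sub>v map_vec of_int k))))"

definition strongly_dispersive :: "(complex^'n) set \<Rightarrow> bool" where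
  "strongly_dispersive \<Lambda> \<longleftrightarrow> (\<exists>m M N R\<^sub>1 R\<^sub>2. normal_form \<Lambda> m M N R\<^sub>1 R\<^sub>2 \<and>
     (\<forall>a::real. 0 < a \<and> a < 1 \<longrightarrow>
       (\<exists>C>0. \<forall>\<sigma> \<in> carrier_vec (CARD('n) - m). \<forall>\<tau> \<in> carrier_vec (2 * m).
          \<sigma> \<noteq> 0\<^sub>v (CARD('n) - m) \<longrightarrow>
          L2_set (vec_index (transpose_mat (hcat R\<^sub>1 R\<^sub>2) *\<^sub>v map_vec real_of_int \<sigma>
                             + map_vec real_of_int \<tau>)) {..<2 * m}
            \<ge> C * a ^ nat (\<Sum>i<CARD('n) - m. \<bar>vec_index \<sigma> i\<bar>))))"

end

theory Submission
  imports Defs "HOL-Complex_Analysis.Cauchy_Integral_Formula"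
begin

text \<open>
  Suppose that \<open>\<Lambda>\<close> is in normal form and fails the estimate of strong dispersiveness for some
  \<open>a = exp (- 2 \<pi> \<rho>)\<close>. Take \<open>U\<close> to be the image of the tube \<open>\<Omega>\<close> on which the last \<open>n - m\<close> coordinates
  \<open>w\<close> satisfy \<open>\<bar>Im w\<^sub>i\<bar> < \<rho>\<close>. Choose \<open>\<sigma>\<^sub>j\<close> for which \<open>\<parallel>\<^sup>t\<sigma>\<^sub>j R + \<^sup>t\<tau>\<^sub>j\<parallel>\<close> is below \<open>a\<close> to the power \<open>\<bar>\<sigma>\<^sub>j\<bar>\<close> and
  decreases rapidly in \<open>j\<close>, and consider the formal series \<open>g = \<Sum>\<^sub>j c\<^sub>j exp (2 \<pi> i \<sigma>\<^sub>j \<cdot> w)\<close> with \<open>c\<^sub>j\<close> of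
  size \<open>10\<^sup>j\<close>. It diverges, but the small factors
  \<open>exp (2 \<pi> i \<sigma>\<^sub>j \<cdot> \<lambda>) - 1\<close> make its differences \<open>g (z + \<lambda>) - g z\<close> converge on \<open>\<Omega>\<close>; they form a
  cocycle of \<open>\<Lambda>\<close> with values in the holomorphic functions on \<open>\<Omega>\<close>, that is, a class in \<open>H\<^sup>1(U, \<O>)\<close>.

  If the class vanishes, there is a holomorphic \<open>f\<close> on \<open>\<Omega>\<close> with the same differences. As the real
  span of \<open>\<Lambda>\<close> modulo \<open>\<Lambda>\<close> is compact, \<open>f\<close> grows at most linearly there, so it is affine
  in the first \<open>m\<close> coordinates by Liouville's theorem. This bounds its second differences
  along multiples of lattice vectors uniformly, whereas at the scale inverse to the \<open>j\<close>-th small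
  factor the \<open>j\<close>-th term contributes about \<open>\<bar>c\<^sub>j\<bar>\<close> and dominates the others. Giving the \<open>c\<^sub>j\<close>
  supports in infinitely many disjoint infinite sets of indices, no nontrivial linear
  combination of the resulting classes vanishes.
\<close>

section \<open>Discrete subgroups and linear forms integral on them\<close>

definition int_span :: "'a::real_vector set \<Rightarrow> 'a set" where
  "int_span B = range (\<lambda>k. \<Sum>b\<in>B. of_int (k b) *\<^sub>R b)"

definition additive_subgroup :: "'a::ab_group_add set \<Rightarrow> bool" where
  "additive_subgroup \<Lambda> \<longleftrightarrow> 0 \<in> \<Lambda> \<and> (\<forall>x\<in>\<Lambda>. \<forall>y\<in>\<Lambda>. x - y \<in> \<Lambda>)"

lemma additive_subgroup_add:
  assumes "additive_subgroup \<Lambda>" "x \<in> \<Lambda>" "y \<in> \<Lambda>"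
  shows "x + y \<in> \<Lambda>"
proof -
  have "0 - y \<in> \<Lambda>" using assms unfolding additive_subgroup_def by blast
  then have "x - (0 - y) \<in> \<Lambda>" using assms unfolding additive_subgroup_def by blast
  then show ?thesis by simp
qed

lemma additive_subgroup_of_int:
  fixes \<Lambda> :: "'a::real_vector set"
  assumes "additive_subgroup \<Lambda>" "x \<in> \<Lambda>"
  shows "of_int k *\<^sub>R x \<in> \<Lambda>"
proof -
  have nat: "of_nat n *\<^sub>R x \<in> \<Lambda>" for n
    by (induction n) (use assms in \<open>auto simp: additive_subgroup_def scaleR_add_left intro: additive_subgroup_add\<close>)
  have "0 - of_nat n *\<^sub>R x \<in> \<Lambda>" for n
    using nat[of n] assms(1) unfolding additive_subgroup_def by blast
  with nat show ?thesis by (cases k rule: int_cases2) simp_all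
qed

lemma additive_subgroup_sum:
  fixes \<Lambda> :: "'a::real_vector set"
  assumes "additive_subgroup \<Lambda>" "B \<subseteq> \<Lambda>"
  shows "(\<Sum>b\<in>B. of_int (k b) *\<^sub>R b) \<in> \<Lambda>"
  using assms(2)
proof (induction B rule: infinite_finite_induct)
  case (insert b B)
  then show ?case
    using assms(1) by (simp add: additive_subgroup_add additive_subgroup_of_int)
qed (use assms in \<open>auto simp: additive_subgroup_def\<close>)

lemma additive_subgroup_int_span: "additive_subgroup (int_span B)"
  unfolding additive_subgroup_def int_span_def
proof (intro conjI ballI)
  show "0 \<in> range (\<lambda>k. \<Sum>b\<in>B. of_int (k b) *\<^sub>R b)"
    by (rule range_eqI[of _ _ "\<lambda>b. 0"]) simp
next
  fix x y :: 'a assume "x \<in> range (\<lambda>k. \<Sum>b\<in>B. of_int (k b) *\<^sub>R b)" "y \<in> range (\<lambda>k. \<Sum>b\<in>B. of_int (k b) *\<^sub>R b)"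
  then obtain k l where "x = (\<Sum>b\<in>B. of_int (k b) *\<^sub>R b)" "y = (\<Sum>b\<in>B. of_int (l b) *\<^sub>R b)" by blast
  then show "x - y \<in> range (\<lambda>k. \<Sum>b\<in>B. of_int (k b) *\<^sub>R b)"
    by (intro range_eqI[of _ _ "\<lambda>b. k b - l b"]) (simp add: sum_subtractf scaleR_left_diff_distrib)
qed

lemma int_span_base: "finite B \<Longrightarrow> b \<in> B \<Longrightarrow> b \<in> int_span B"
  unfolding int_span_def
  by (rule range_eqI[of _ _ "\<lambda>c. if c = b then 1 else 0"]) (simp add: if_distrib[of "\<lambda>r. r *\<^sub>R _"] if_distrib[of of_int] cong: if_cong)

lemma int_span_minimal:
  "additive_subgroup \<Lambda> \<Longrightarrow> B \<subseteq> \<Lambda> \<Longrightarrow> int_span B \<subseteq> \<Lambda>"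
  unfolding int_span_def by (auto intro: additive_subgroup_sum)

section \<open>Bases of lattices in Euclidean space\<close>

lemma discrete_subgroup_finite_ball:
  fixes \<Lambda> :: "'a::euclidean_space set"
  assumes "uniform_discrete \<Lambda>"
  shows "finite (\<Lambda> \<inter> cball 0 r)"
  using uniform_discrete_finite_iff[of "\<Lambda> \<inter> cball 0 r"] assms
  by (auto intro: bounded_subset[OF bounded_cball])

text \<open>The induction step: given a basis of the lattice points in \<open>span C\<close>, a basis of those in
  \<open>span (insert c C)\<close> is obtained by adding a lattice point of least positive height above \<open>span C\<close>.\<close>

lemma lattice_basis_in_span:
  fixes \<Lambda> :: "'a::euclidean_space set"
  assumes \<Lambda>: "additive_subgroup \<Lambda>" "uniform_discrete \<Lambda>"
    and C: "finite C" "independent C" "C \<subseteq> \<Lambda>"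
  shows "\<exists>B. finite B \<and> independent B \<and> span B = span C \<and> int_span B = \<Lambda> \<inter> span C"
  using C
proof (induction C rule: finite_induct)
  case empty
  then show ?case
    using \<Lambda>(1) by (intro exI[of _ "{}"]) (auto simp: int_span_def additive_subgroup_def)
next
  case (insert c C)
  then have "c \<notin> span C" "c \<in> \<Lambda>" "independent C"
    by (auto simp: independent_insert)
  then obtain B where B: "finite B" "independent B" "span B = span C" "int_span B = \<Lambda> \<inter> span C"
    using insert by auto
  \<comment> \<open>The coefficient of \<open>c\<close> modulo \<open>span C\<close> is the height
    of a point; it is well defined because \<open>c\<close> lies outside
    \<open>span C\<close>.\<close>
  have height_unique: "s = t" if "z - s *\<^sub>R c \<in> span C" "z - t *\<^sub>R c \<in> span C" for z s t
  proof (rule ccontr)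
    assume "s \<noteq> t"
    have "(z - s *\<^sub>R c) - (z - t *\<^sub>R c) \<in> span C"
      using that by (rule span_diff)
    then have "(t - s) *\<^sub>R c \<in> span C"
      by (simp add: algebra_simps)
    then have "inverse (t - s) *\<^sub>R (t - s) *\<^sub>R c \<in> span C" by (rule span_scale)
    then show False using \<open>c \<notin> span C\<close> \<open>s \<noteq> t\<close> by simp
  qed
  \<comment> \<open>Reducing the \<open>B\<close>-coordinates modulo one moves a lattice point of
    height between 0 and 1 into the ball of radius \<open>r\<close> without changing its
    height.\<close>
  define r where "r = norm c + (\<Sum>b\<in>B. norm b)"
  have reduce: "\<exists>z'\<in>\<Lambda> \<inter> cball 0 r. z' - t *\<^sub>R c \<in> span C"
    if z: "z \<in> \<Lambda>" "z - t *\<^sub>R c \<in> span C" and t: "0 \<le> t" "t \<le> 1" for z t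
  proof -
    define u where "u = representation B (z - t *\<^sub>R c)"
    have u: "z - t *\<^sub>R c = (\<Sum>b\<in>B. u b *\<^sub>R b)"
      unfolding u_def using z(2) B by (subst sum_representation_eq) auto
    define l where "l = (\<Sum>b\<in>B. of_int \<lfloor>u b\<rfloor> *\<^sub>R b)"
    have l: "l \<in> \<Lambda> \<inter> span C" unfolding B(4)[symmetric] l_def int_span_def by (rule range_eqI) (rule refl)
    have "z - l - t *\<^sub>R c = (z - t *\<^sub>R c) - l" by simp
    also have "\<dots> = (\<Sum>b\<in>B. frac (u b) *\<^sub>R b)"
      unfolding u l_def by (simp add: frac_def scaleR_left_diff_distrib sum_subtractf)
    finally have eq: "z - l - t *\<^sub>R c = (\<Sum>b\<in>B. frac (u b) *\<^sub>R b)" .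
    have "norm (\<Sum>b\<in>B. frac (u b) *\<^sub>R b) \<le> (\<Sum>b\<in>B. norm b)"
      by (rule order_trans[OF norm_sum sum_mono]) (auto intro!: mult_left_le_one_le simp: frac_lt_1 less_imp_le)
    moreover have "norm (t *\<^sub>R c) \<le> norm c" using t by (simp add: mult_left_le_one_le)
    moreover have "norm (z - l) \<le> norm (z - l - t *\<^sub>R c) + norm (t *\<^sub>R c)"
      using norm_triangle_ineq[of "z - l - t *\<^sub>R c" "t *\<^sub>R c"] by simp
    ultimately have "norm (z - l) \<le> r" unfolding eq r_def by linarith
    moreover have "z - l \<in> \<Lambda>" using z l \<Lambda>(1) by (auto simp: additive_subgroup_def)
    moreover have "z - l - t *\<^sub>R c \<in> span C"
      using span_diff[OF z(2), of l] l by (simp add: algebra_simps)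
    ultimately show ?thesis by (intro bexI[of _ "z - l"]) auto
  qed
  \<comment> \<open>Only the finitely many points of \<open>\<Lambda> \<inter> cball 0 r\<close>
    enter, so a least positive height exists; \<open>c\<close>, after reduction, provides the height
    1.\<close>
  define S where "S = {t. 0 < t \<and> t \<le> 1 \<and> (\<exists>z\<in>\<Lambda> \<inter> cball 0 r. z - t *\<^sub>R c \<in> span C)}"
  have "S \<subseteq> (\<lambda>z. THE t. z - t *\<^sub>R c \<in> span C) ` (\<Lambda> \<inter> cball 0 r)"
  proof
    fix t assume "t \<in> S"
    then obtain z where z: "z \<in> \<Lambda> \<inter> cball 0 r" "z - t *\<^sub>R c \<in> span C" by (auto simp: S_def)
    have "(THE t. z - t *\<^sub>R c \<in> span C) = t"
      using z(2) height_unique by blast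
    with z(1) show "t \<in> (\<lambda>z. THE t. z - t *\<^sub>R c \<in> span C) ` (\<Lambda> \<inter> cball 0 r)" by force
  qed
  then have "finite S"
    using discrete_subgroup_finite_ball[OF \<Lambda>(2)] by (meson finite_imageI finite_subset)
  moreover have "1 \<in> S"
    using reduce[of c 1] \<open>c \<in> \<Lambda>\<close> by (simp add: S_def span_zero)
  ultimately have "Min S \<in> S" and Min: "\<And>t. t \<in> S \<Longrightarrow> Min S \<le> t" by (auto intro: Min_in)
  define s where "s = Min S"
  obtain b where b: "b \<in> \<Lambda>" "b - s *\<^sub>R c \<in> span C" and s: "0 < s" "s \<le> 1"
    using \<open>Min S \<in> S\<close> by (auto simp: S_def s_def)
  have "b \<notin> span C"
    using height_unique[of b 0 s] b s by auto
  have "b \<in> span (insert c C)"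
    using b(2) by (auto simp: span_insert)
  have "c \<in> span (insert b B)"
  proof -
    have "b - s *\<^sub>R c \<in> span (insert b B)" using b(2) B(3) span_mono[of B "insert b B"] by auto
    moreover have "b \<in> span (insert b B)" by (rule span_base) simp
    ultimately have "b - (b - s *\<^sub>R c) \<in> span (insert b B)" using span_diff by blast
    then have "s *\<^sub>R c \<in> span (insert b B)" by simp
    then have "inverse s *\<^sub>R s *\<^sub>R c \<in> span (insert b B)" by (rule span_scale)
    moreover have "inverse s *\<^sub>R s *\<^sub>R c = c" using s by (simp only: scaleR_scaleR) simp
    ultimately show ?thesis by (simp only:)
  qed
  have span: "span (insert b B) = span (insert c C)"
  proof
    have "B \<subseteq> span (insert c C)"
      using B(3) span_superset[of B] span_mono[of C "insert c C"] by auto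
    then show "span (insert b B) \<subseteq> span (insert c C)"
      using \<open>b \<in> span (insert c C)\<close> by (intro span_minimal) auto
    have "C \<subseteq> span (insert b B)"
      using B(3) span_superset[of C] span_mono[of B "insert b B"] by auto
    then show "span (insert c C) \<subseteq> span (insert b B)"
      using \<open>c \<in> span (insert b B)\<close> by (intro span_minimal) auto
  qed
  have "int_span (insert b B) = \<Lambda> \<inter> span (insert c C)"
  proof
    have "B \<subseteq> \<Lambda>" using B(1,4) int_span_base by blast
    then have "int_span (insert b B) \<subseteq> \<Lambda>"
      using b(1) by (intro int_span_minimal \<Lambda>(1)) auto
    moreover have "int_span (insert b B) \<subseteq> span (insert b B)"
      unfolding int_span_def by (auto intro!: span_sum span_scale intro: span_base)
    ultimately show "int_span (insert b B) \<subseteq> \<Lambda> \<inter> span (insert c C)"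
      using span by auto
    show "\<Lambda> \<inter> span (insert c C) \<subseteq> int_span (insert b B)"
    proof
      fix z assume z: "z \<in> \<Lambda> \<inter> span (insert c C)"
      then obtain t where t: "z - t *\<^sub>R c \<in> span C" by (auto simp: span_insert)
      \<comment> \<open>Division with remainder by the least height \<open>s\<close>: the remainder
        \<open>h\<close> is the height of a lattice point and smaller than \<open>s\<close>, so it
        can only be 0.\<close>
      define q where "q = \<lfloor>t / s\<rfloor>"
      define y where "y = z - of_int q *\<^sub>R b"
      have y: "y \<in> \<Lambda>"
        using z \<Lambda>(1) additive_subgroup_of_int[OF \<Lambda>(1) b(1)] by (auto simp: y_def additive_subgroup_def)
      define h where "h = t - of_int q * s"
      have "(z - t *\<^sub>R c) - of_int q *\<^sub>R (b - s *\<^sub>R c) \<in> span C"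
        using t span_scale[OF b(2)] by (rule span_diff)
      then have h: "y - h *\<^sub>R c \<in> span C"
        by (simp add: y_def h_def algebra_simps)
      have "of_int q * s \<le> t" "t < (of_int q + 1) * s"
        using s floor_correct[of "t / s"] unfolding q_def[symmetric]
        by (simp_all add: field_simps)
      then have h01: "0 \<le> h" "h < s"
        by (simp_all add: h_def algebra_simps)
      have "h = 0"
      proof (rule ccontr)
        assume "h \<noteq> 0"
        then have "h \<in> S" using h01 s reduce[OF y h] by (auto simp: S_def)
        then show False using Min h01 by (fastforce simp: s_def)
      qed
      then have "y \<in> int_span B" using h y B(4) by simp
      moreover have "int_span B \<subseteq> int_span (insert b B)"
        using B(1) by (intro int_span_minimal additive_subgroup_int_span) (auto intro: int_span_base)
      moreover have "b \<in> int_span (insert b B)" using B(1) by (simp add: int_span_base)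
      ultimately have "y + of_int q *\<^sub>R b \<in> int_span (insert b B)"
        by (intro additive_subgroup_add additive_subgroup_of_int additive_subgroup_int_span) auto
      then show "z \<in> int_span (insert b B)" by (simp add: y_def)
    qed
  qed
  moreover have "independent (insert b B)"
    using B \<open>b \<notin> span C\<close> by (simp add: independent_insert)
  ultimately show ?case
    using B(1) span by (intro exI[of _ "insert b B"]) simp
qed

text \<open>A maximal real-independent subset \<open>C\<close> of \<open>\<Lambda>\<close> spans it,
  so the intersection in \<open>lattice_basis_in_span\<close> is all of
  \<open>\<Lambda>\<close>.\<close>

lemma lattice_basis:
  fixes \<Lambda> :: "'a::euclidean_space set"
  assumes \<Lambda>: "additive_subgroup \<Lambda>" "uniform_discrete \<Lambda>"
  obtains B where "finite B" "independent B" "int_span B = \<Lambda>"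
proof -
  obtain C where C: "C \<subseteq> \<Lambda>" "independent C" "\<Lambda> \<subseteq> span C"
    by (rule maximal_independent_subset)
  then obtain B where "finite B" "independent B" "int_span B = \<Lambda> \<inter> span C"
    using lattice_basis_in_span[OF \<Lambda>, of C] finiteI_independent by blast
  then show ?thesis using C by (intro that) auto
qed

section \<open>Discrete subgroups and complex linear forms\<close>

lemma discrete_subgroup_separated:
  assumes "discrete_subgroup \<Lambda>"
  obtains \<epsilon> where "0 < \<epsilon>" "\<And>l. l \<in> \<Lambda> \<Longrightarrow> norm l < \<epsilon> \<Longrightarrow> l = 0"
proof -
  have "0 \<in> \<Lambda>" "discrete \<Lambda>"
    using assms by (auto simp: discrete_subgroup_def)
  then obtain T where T: "open T" "T \<inter> \<Lambda> = {0}"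
    unfolding discrete_def isolated_in_def by blast
  then obtain e where "e > 0" "ball 0 e \<subseteq> T"
    using open_contains_ball[of T] by blast
  with T show ?thesis
    by (intro that[of e]) (auto simp: subset_iff)
qed

lemma discrete_subgroup_additive: "discrete_subgroup \<Lambda> \<Longrightarrow> additive_subgroup \<Lambda>"
  by (simp add: discrete_subgroup_def additive_subgroup_def)

text \<open>Isolation of 0 carries over to every other point with the same radius, since differences
  of lattice points are lattice points.\<close>

lemma discrete_subgroup_uniform_discrete:
  assumes "discrete_subgroup \<Lambda>"
  shows "uniform_discrete \<Lambda>"
proof -
  obtain \<epsilon> where \<epsilon>: "0 < \<epsilon>" "\<And>l. l \<in> \<Lambda> \<Longrightarrow> norm l < \<epsilon> \<Longrightarrow> l = 0"
    by (rule discrete_subgroup_separated[OF assms]) blast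
  show ?thesis
    unfolding uniform_discrete_def
  proof (intro exI[of _ \<epsilon>] conjI ballI impI)
    fix x y assume "x \<in> \<Lambda>" "y \<in> \<Lambda>" "dist x y < \<epsilon>"
    then show "x = y"
      using \<epsilon>(2)[of "x - y"] assms by (simp add: dist_norm discrete_subgroup_def)
  qed (rule \<epsilon>(1))
qed

definition complex_linear :: "(complex^'n \<Rightarrow> complex) \<Rightarrow> bool" where
  "complex_linear \<phi> \<longleftrightarrow> (\<forall>x y. \<phi> (x + y) = \<phi> x + \<phi> y) \<and> (\<forall>c x. \<phi> (c *s x) = c * \<phi> x)"

lemma complex_linear_add: "complex_linear \<phi> \<Longrightarrow> \<phi> (x + y) = \<phi> x + \<phi> y"
  and complex_linear_scale: "complex_linear \<phi> \<Longrightarrow> \<phi> (c *s x) = c * \<phi> x"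
  by (simp_all add: complex_linear_def)

lemma scaleR_eq_scale_of_real: "r *\<^sub>R x = complex_of_real r *s (x :: complex^'n)"
  by (simp add: Finite_Cartesian_Product.vec_eq_iff scaleR_conv_of_real[where 'a = complex])

lemma complex_linear_linear:
  assumes "complex_linear \<phi>"
  shows "linear \<phi>"
  by (rule linearI) (use assms in \<open>simp_all add: complex_linear_def scaleR_eq_scale_of_real scaleR_conv_of_real[where 'a = complex]\<close>)

lemma complex_linear_simps:
  assumes "complex_linear \<phi>"
  shows "\<phi> 0 = 0" "\<phi> (- x) = - \<phi> x" "\<phi> (x - y) = \<phi> x - \<phi> y" "\<phi> (r *\<^sub>R x) = of_real r * \<phi> x"
    "\<phi> (sum f A) = (\<Sum>i\<in>A. \<phi> (f i))"
proof -
  interpret linear \<phi> by (rule complex_linear_linear[OF assms])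
  show "\<phi> 0 = 0" "\<phi> (- x) = - \<phi> x" "\<phi> (x - y) = \<phi> x - \<phi> y" "\<phi> (r *\<^sub>R x) = of_real r * \<phi> x"
    "\<phi> (sum f A) = (\<Sum>i\<in>A. \<phi> (f i))"
    by (simp_all add: zero neg diff scaleR sum scaleR_conv_of_real[where 'a = complex])
qed

lemma complex_linear_has_derivative:
  assumes "complex_linear \<phi>"
  shows "(\<phi> has_derivative \<phi>) (at z within S)"
  using complex_linear_linear[OF assms]
  by (intro bounded_linear_imp_has_derivative) (simp add: linear_conv_bounded_linear)

lemma has_derivative_exp_complex_linear:
  assumes "complex_linear \<phi>"
  shows "((\<lambda>z. exp (c * \<phi> z)) has_derivative (\<lambda>v. exp (c * \<phi> z) * (c * \<phi> v))) (at z)"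
  using has_derivative_compose[OF has_derivative_mult_right[OF complex_linear_has_derivative[OF assms]],
      of exp "\<lambda>v. exp (c * \<phi> z) * v" c z UNIV] DERIV_exp[of "c * \<phi> z"]
  by (simp add: has_field_derivative_def)

text \<open>If \<open>\<phi>\<close> is integral on \<open>\<Lambda>\<close>, the function \<open>exp (2 \<pi> i \<phi>)\<close> descends to the quotient.\<close>

lemma cousin_integral_functional:
  assumes "cousin \<Lambda>" and \<phi>: "complex_linear \<phi>" and int: "\<And>l. l \<in> \<Lambda> \<Longrightarrow> \<phi> l \<in> \<int>"
  shows "\<phi> z = 0"
proof (rule ccontr)
  assume nz: "\<phi> z \<noteq> 0"
  define E where "E z = exp (2 * of_real pi * \<i> * \<phi> z)" for z
  \<comment> \<open>A function on cosets evaluated at a chosen representative; the choice is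
    immaterial because \<open>\<phi>\<close> is integral on \<open>\<Lambda>\<close>.\<close>
  define f where "f p = E (SOME y. y \<in> p)" for p
  have \<Lambda>: "0 \<in> \<Lambda>" using assms(1) by (simp add: cousin_def discrete_subgroup_def)
  have f: "f (qproj \<Lambda> z) = E z" for z
  proof -
    have "z \<in> qproj \<Lambda> z" using \<Lambda> by (auto simp: qproj_def image_iff intro!: bexI[of _ 0])
    then have "(SOME y. y \<in> qproj \<Lambda> z) \<in> qproj \<Lambda> z" by (rule someI)
    then obtain l where l: "l \<in> \<Lambda>" "(SOME y. y \<in> qproj \<Lambda> z) = z + l" by (auto simp: qproj_def)
    from int[OF l(1)] obtain k where "\<phi> l = of_int k" by (auto elim: Ints_cases)
    then have "E (z + l) = E z * exp (2 * of_real pi * \<i> * of_int k)"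
      by (simp add: E_def complex_linear_add[OF \<phi>] distrib_left exp_add)
    also have "exp (2 * of_real pi * \<i> * of_int k) = (1::complex)"
      using exp_eq_1[of "2 * of_real pi * \<i> * of_int k"] by (auto intro!: exI[of _ k])
    finally show ?thesis by (simp add: f_def l(2))
  qed
  have "holomorphic_Cn E (qproj \<Lambda> -` range (qproj \<Lambda>))"
    unfolding holomorphic_Cn_def E_def
  proof
    fix z
    show "\<exists>f'. ((\<lambda>z. exp (2 * of_real pi * \<i> * \<phi> z)) has_derivative f') (at z) \<and>
        (\<forall>c v. f' (c *s v) = c * f' v)"
      by (rule exI, rule conjI, rule has_derivative_exp_complex_linear[OF \<phi>])
        (simp add: complex_linear_scale[OF \<phi>])
  qed
  moreover have "f \<circ> qproj \<Lambda> = E" using f by auto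
  ultimately have "f \<in> quot_sheaf_O \<Lambda> (range (qproj \<Lambda>))"
    by (simp add: quot_sheaf_O_def)
  then have "f constant_on range (qproj \<Lambda>)"
    using assms(1) by (simp add: cousin_def)
  then have "E y = E 0" for y
    using f[of y] f[of 0] unfolding constant_on_def by (metis rangeI)
  \<comment> \<open>At this point \<open>\<phi>\<close> has the value 1/2, so \<open>E\<close> is
    exp (pi i) = -1 there, whereas \<open>E 0 = 1\<close>.\<close>
  from this[of "(1 / (2 * \<phi> z)) *s z"] show False
    using nz exp_pi_i by (simp add: E_def complex_linear_scale[OF \<phi>] complex_linear_simps[OF \<phi>])
qed

section \<open>Normal forms of Cousin groups\<close>

text \<open>The \<open>p c\<close> are the columns of the matrix \<open>P\<close> of a normal form, the \<open>x i\<close> and \<open>w i\<close> the first \<open>m\<close>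
  and the last \<open>d = n - m\<close> coordinates on \<open>\<complex>\<^sup>n\<close>.\<close>

locale adapted_basis =
  fixes \<Lambda> :: "(complex^'n) set" and m d :: nat and p :: "nat \<Rightarrow> complex^'n"
    and x w :: "nat \<Rightarrow> complex^'n \<Rightarrow> complex"
  assumes m_pos: "1 \<le> m" and dim: "d + m = CARD('n)"
    and lattice: "\<Lambda> = range (\<lambda>k. \<Sum>c<CARD('n) + m. of_int (k c) *\<^sub>R p c)"
    and x_linear: "i < m \<Longrightarrow> complex_linear (x i)"
    and w_linear: "i < d \<Longrightarrow> complex_linear (w i)"
    and x_p: "i < m \<Longrightarrow> c < CARD('n) \<Longrightarrow> x i (p c) = (if c = d + i then 1 else 0)"
    and w_p: "i < d \<Longrightarrow> j < d \<Longrightarrow> w i (p j) = (if j = i then 1 else 0)"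
    and Im_w_p: "i < d \<Longrightarrow> c < CARD('n) + m \<Longrightarrow> Im (w i (p c)) = 0"
    and separating: "(\<And>i. i < m \<Longrightarrow> x i z = 0) \<Longrightarrow> (\<And>i. i < d \<Longrightarrow> w i z = 0) \<Longrightarrow> z = 0"
    and independent_p: "(\<Sum>c<CARD('n) + m. t c *\<^sub>R p c) = 0 \<Longrightarrow> c < CARD('n) + m \<Longrightarrow> t c = 0"
    and coordinates: "\<exists>K. \<forall>z. (\<forall>i<d. Im (w i z) = 0) \<longrightarrow>
          (\<exists>t. z = (\<Sum>c<CARD('n) + m. t c *\<^sub>R p c) \<and> (\<forall>c<CARD('n) + m. \<bar>t c\<bar> \<le> K * norm z))"

section \<open>Construction of an adapted basis\<close>

lemma representation_sum_scaleR:
  assumes "independent E" "finite B" "B \<subseteq> E"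
  shows "representation E (\<Sum>b\<in>B. u b *\<^sub>R b) e = (if e \<in> B then u e else 0)"
proof -
  have "b \<in> span E" if "b \<in> B" for b
    using that assms(3) by (auto intro: span_base)
  then have "representation E (\<Sum>b\<in>B. u b *\<^sub>R b) e = (\<Sum>b\<in>B. representation E (u b *\<^sub>R b) e)"
    using assms by (subst representation_sum) (auto intro: span_scale)
  also have "\<dots> = (\<Sum>b\<in>B. u b * (if e = b then 1 else 0))"
    using assms by (intro sum.cong) (auto simp: representation_scale representation_basis span_base subset_iff)
  also have "\<dots> = (if e \<in> B then u e else 0)"
    using assms(2) by (simp add: if_distrib cong: if_cong)
  finally show ?thesis .
qed

lemma ex_complex_linear_coordinate:
  fixes B :: "(complex^'n) set"
  assumes "vec.independent B" "vec.span B = UNIV"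
  shows "complex_linear (\<lambda>z. vec.representation B z b)"
  using assms by (simp add: complex_linear_def vec.representation_add vec.representation_scale)

lemma representation_linear:
  fixes E :: "'a::euclidean_space set"
  assumes "independent E" "span E = UNIV"
  shows "linear (\<lambda>z. representation E z b)"
  using assms by (intro linearI) (simp_all add: representation_add representation_scale)

text \<open>A lattice basis \<open>B\<close> contains a complex basis \<open>B1\<close> of the whole
  space, because non-constant holomorphic functions are absent. Multiples of members of
  \<open>B1\<close> by the imaginary unit complete \<open>B\<close> to a real basis
  \<open>E\<close>. The members of \<open>B1\<close> whose multiples are used become the first
  \<open>d\<close> columns, and the real coordinates along these multiples become the imaginary
  parts of the \<open>w\<close>.\<close>

lemma cousin_adapted_basis:
  fixes \<Lambda> :: "(complex^'n) set"
  assumes "cousin \<Lambda>"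
  obtains m d p x w where "adapted_basis \<Lambda> m d p x w"
proof -
  have ds: "discrete_subgroup \<Lambda>" using assms by (simp add: cousin_def)
  obtain B where B: "finite B" "independent B" "int_span B = \<Lambda>"
    by (rule lattice_basis[OF discrete_subgroup_additive[OF ds] discrete_subgroup_uniform_discrete[OF ds]])
  obtain B1 where B1: "B1 \<subseteq> B" "vec.independent B1" "B \<subseteq> vec.span B1"
    by (rule vec.maximal_independent_subset)
  \<comment> \<open>Integrality on \<open>\<Lambda>\<close> need only be tested on its basis
    \<open>B\<close>.\<close>
  have lin0: "\<phi> z = 0" if "complex_linear \<phi>" "\<And>b. b \<in> B \<Longrightarrow> \<phi> b \<in> \<int>" for \<phi> z
  proof (rule cousin_integral_functional[OF assms that(1)])
    fix l assume "l \<in> \<Lambda>"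
    then have "l \<in> range (\<lambda>k. \<Sum>b\<in>B. of_int (k b) *\<^sub>R b)" by (simp only: B(3)[symmetric] int_span_def)
    then obtain k where "l = (\<Sum>b\<in>B. of_int (k b) *\<^sub>R b)" by (rule rangeE)
    then show "\<phi> l \<in> \<int>"
      using that by (simp add: complex_linear_simps Ints_sum Ints_mult)
  qed
  \<comment> \<open>Otherwise a complex coordinate transverse to \<open>vec.span B1\<close> would
    vanish on \<open>B\<close> without being zero, against \<open>lin0\<close>.\<close>
  have "vec.span B1 = UNIV"
  proof (rule ccontr)
    assume ne: "vec.span B1 \<noteq> UNIV"
    obtain E where E: "B1 \<subseteq> E" "E \<subseteq> UNIV" "vec.independent E" "UNIV \<subseteq> vec.span E"
      by (rule vec.maximal_independent_subset_extend[OF subset_UNIV B1(2)]) (rule that)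
    have "vec.span E = UNIV" using E(4) by (rule top.extremum_uniqueI)
    note E = E(1,3) this
    with ne have "\<not> E \<subseteq> B1" by auto
    then obtain e where e: "e \<in> E" "e \<notin> B1" by blast
    have "vec.representation E e e = 0"
    proof (rule lin0[where \<phi> = "\<lambda>z. vec.representation E z e"])
      show cl: "complex_linear (\<lambda>z. vec.representation E z e)"
        using E by (intro ex_complex_linear_coordinate)
      fix b assume "b \<in> B"
      then have "b \<in> vec.span B1" using B1(3) by blast
      then have "vec.representation E b e = 0"
      proof (induction rule: vec.span_induct_alt)
        case base show ?case using complex_linear_simps(1)[OF cl] .
      next
        case (step c y z)
        then show ?case
          using E e by (simp add: complex_linear_add[OF cl] complex_linear_scale[OF cl])
            (auto simp: vec.representation_basis subset_iff)
      qed
      then show "vec.representation E b e \<in> \<int>" by simp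
    qed
    then show False using E e by (simp add: vec.representation_basis)
  qed
  note B1 = B1(1,2) this
  have finB1: "finite B1" using B(1) B1(1) by (rule rev_finite_subset)
  have cardB1: "card B1 = CARD('n)"
    using vec.dim_eq_card[of B1 UNIV] B1 card_cart_basis[where 'a = complex and 'i = 'n]
    by (simp add: vec.span_UNIV)
  define coord where "coord b z = vec.representation B1 z b" for b z
  have coord_linear: "complex_linear (coord b)" for b
    unfolding coord_def[abs_def] using B1 by (intro ex_complex_linear_coordinate)
  have coord_base: "coord b b' = (if b = b' then 1 else 0)" if "b' \<in> B1" for b b'
    unfolding coord_def using that B1 by (simp add: vec.representation_basis)
  have coord_sum: "z = (\<Sum>b\<in>B1. coord b z *s b)" for z
    unfolding coord_def using vec.sum_representation_eq[of B1 z B1] B1 finB1 by simp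
  define i where "i z = \<i> *s (z :: complex^'n)" for z
  have i_inj: "inj i" unfolding i_def inj_def by simp
  have i_add: "i (y + z) = i y + i z" and i_scaleR: "i (r *\<^sub>R z) = r *\<^sub>R i z" for y z r
    unfolding i_def by (simp_all add: vec.scale_right_distrib scaleR_eq_scale_of_real mult.commute)
  have i_i: "i (i z) = - z" for z unfolding i_def by (simp add: vec.scale_minus_left)
  have scale_eq: "c *s z = Re c *\<^sub>R z + Im c *\<^sub>R i z" for c z
  proof -
    have c: "c = of_real (Re c) + of_real (Im c) * \<i>" by (simp add: complex_eq_iff)
    show ?thesis
      by (subst c) (simp add: i_def scaleR_eq_scale_of_real vec.scale_left_distrib)
  qed
  obtain E where E: "B \<subseteq> E" "E \<subseteq> B \<union> i ` B1" "independent E" "B \<union> i ` B1 \<subseteq> span E"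
    by (rule maximal_independent_subset_extend[OF Un_upper1 B(2), of "i ` B1"]) (rule that)
  have spanE: "span E = UNIV"
  proof -
    have "z \<in> span E" for z
    proof -
      have "coord b z *s b \<in> span E" if "b \<in> B1" for b
      proof -
        have "b \<in> span E" "i b \<in> span E" using that B1(1) E(4) by blast+
        then show ?thesis unfolding scale_eq[of "coord b z" b] by (intro span_add span_scale)
      qed
      then have "(\<Sum>b\<in>B1. coord b z *s b) \<in> span E" by (rule span_sum)
      then show ?thesis by (simp only: coord_sum[symmetric])
    qed
    then show ?thesis by (intro equalityI subsetI UNIV_I)
  qed
  have finE: "finite E" using E(3) by (rule finiteI_independent)
  have cardE: "card E = 2 * CARD('n)"
    using dim_eq_card[of E UNIV] E(3) spanE by (simp add: span_UNIV)
  \<comment> \<open>The \<open>b\<close> in \<open>B1\<close> for which \<open>i b\<close> had to be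
    added to \<open>B\<close>. Counting \<open>E\<close>, which has \<open>2 * CARD('n)\<close>
    members, then gives \<open>d + m = CARD('n)\<close>.\<close>
  define L where "L = {b \<in> B1. i b \<in> E - B}"
  define m where "m = card (B - B1)"
  define d where "d = card L"
  have iL: "i ` L = E - B" using E(2) by (auto simp: L_def)
  have "card (E - B) = d" unfolding iL[symmetric] d_def
    using i_inj by (intro card_image) (auto intro: inj_on_subset)
  moreover have "card B = CARD('n) + m"
    unfolding m_def using card_Diff_subset[OF finB1 B1(1)] card_mono[OF B(1) B1(1)] cardB1 by simp
  ultimately have dim: "d + m = CARD('n)"
    using card_Diff_subset[OF B(1) E(1)] card_mono[OF finE E(1)] cardE by simp
  \<comment> \<open>If \<open>m\<close> were 0, \<open>B\<close> would be the complex basis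
    \<open>B1\<close> itself, and its coordinates, being integral on \<open>\<Lambda>\<close>, would
    vanish.\<close>
  have "1 \<le> m"
  proof (rule ccontr)
    assume "\<not> 1 \<le> m"
    then have "card (B - B1) = 0" by (simp add: m_def)
    then have "B \<subseteq> B1" using B(1) by simp
    have "card B1 \<noteq> 0" using cardB1 by simp
    then have "B1 \<noteq> {}" by auto
    then obtain b where b: "b \<in> B1" by blast
    have "coord b b = 0"
      by (rule lin0[OF coord_linear]) (use \<open>B \<subseteq> B1\<close> coord_base in auto)
    then show False using coord_base[OF b] by simp
  qed
  have finL: "finite L" "L \<subseteq> B1" using finB1 by (auto simp: L_def)
  have cardQ: "card (B1 - L) = m"
    using card_Diff_subset[OF finL] cardB1 dim by (simp add: d_def)
  obtain l where l: "bij_betw l {..<d} L"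
    using ex_bij_betw_nat_finite[OF finL(1)] by (auto simp: d_def atLeast0LessThan)
  obtain q where q: "bij_betw q {..<m} (B1 - L)"
    using ex_bij_betw_nat_finite[of "B1 - L"] finB1 cardQ by (auto simp: atLeast0LessThan)
  obtain t where t: "bij_betw t {..<m} (B - B1)"
    using ex_bij_betw_nat_finite[of "B - B1"] B(1) by (auto simp: m_def atLeast0LessThan)
  \<comment> \<open>The order of the columns follows the normal form: \<open>L\<close> for the lower
    identity block, \<open>B1 - L\<close> for the upper one, then the remaining lattice
    generators.\<close>
  define p where "p c = (if c < d then l c else if c < CARD('n) then q (c - d) else t (c - CARD('n)))" for c
  have p: "bij_betw p {..<CARD('n) + m} B"
  proof -
    have 1: "bij_betw p {..<d} L"
      using l by (rule bij_betw_cong[THEN iffD1, rotated]) (simp add: p_def)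
    have "bij_betw (\<lambda>c. c - d) {d..<CARD('n)} {..<m}"
      by (rule bij_betwI[where g = "\<lambda>c. c + d"]) (use dim in auto)
    from bij_betw_trans[OF this q] have 2: "bij_betw p {d..<CARD('n)} (B1 - L)"
      by (rule bij_betw_cong[THEN iffD1, rotated]) (simp add: p_def)
    have "bij_betw (\<lambda>c. c - CARD('n)) {CARD('n)..<CARD('n)+m} {..<m}"
      by (rule bij_betwI[where g = "\<lambda>c. c + CARD('n)"]) auto
    from bij_betw_trans[OF this t] have 3: "bij_betw p {CARD('n)..<CARD('n)+m} (B - B1)"
      by (rule bij_betw_cong[THEN iffD1, rotated]) (use dim in \<open>simp add: p_def\<close>)
    have disj: "L \<inter> (B1 - L) = {}" "(L \<union> (B1 - L)) \<inter> (B - B1) = {}" using finL(2) by auto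
    have "bij_betw p ({..<d} \<union> {d..<CARD('n)} \<union> {CARD('n)..<CARD('n)+m}) (L \<union> (B1 - L) \<union> (B - B1))"
      by (rule bij_betw_combine[OF bij_betw_combine[OF 1 2 disj(1)] 3 disj(2)])
    moreover have "{..<d} \<union> {d..<CARD('n)} \<union> {CARD('n)..<CARD('n)+m} = {..<CARD('n)+m}" using dim by auto
    moreover have "L \<union> (B1 - L) \<union> (B - B1) = B" using finL B1 by auto
    ultimately show ?thesis by simp
  qed
  have p_B1: "p c \<in> B1" if "c < CARD('n)" for c
  proof (cases "c < d")
    case True
    then show ?thesis using bij_betwE[OF l] finL(2) by (auto simp: p_def)
  next
    case False
    then have "c - d < m" using that dim by simp
    then show ?thesis using False that bij_betwE[OF q] by (auto simp: p_def)
  qed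
  have p_inj: "p c = p c' \<longleftrightarrow> c = c'" if "c < CARD('n) + m" "c' < CARD('n) + m" for c c'
    using that inj_on_eq_iff[OF bij_betw_imp_inj_on[OF p]] by simp
  have sum_p: "(\<Sum>c<CARD('n)+m. u (p c) *\<^sub>R p c) = (\<Sum>b\<in>B. u b *\<^sub>R b)" for u
    using sum.reindex_bij_betw[OF p, of "\<lambda>b. u b *\<^sub>R b"] by simp
  define r where "r = the_inv_into {..<CARD('n) + m} p"
  have r: "r (p c) = c" if "c < CARD('n) + m" for c
    unfolding r_def using that p by (intro the_inv_into_f_f) (auto simp: bij_betw_def)
  have sum_p': "(\<Sum>c<CARD('n)+m. u c *\<^sub>R p c) = (\<Sum>b\<in>B. u (r b) *\<^sub>R b)" for u
    using sum_p[of "\<lambda>b. u (r b)"] r by simp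
  define y where "y j z = representation E z (i (p j))" for j z
  have y_linear: "linear (y j)" for j
    unfolding y_def[abs_def] using E(3) spanE by (rule representation_linear)
  have y_E: "y j e = (if e = i (p j) then 1 else 0)" if "e \<in> E" for j e
    unfolding y_def using that E(3) by (simp add: representation_basis)
  have ip: "i (p j) \<in> E - B" if "j < d" for j
    using that bij_betwE[OF l] by (auto simp: p_def L_def)
  have y_B: "y j b = 0" if "b \<in> B" "j < d" for j b
    using y_E[of b j] that E(1) ip[of j] by auto
  \<comment> \<open>A complex linear form with imaginary part v has the value v(i z) + i v(z) at z;
    here v is \<open>y j\<close>, the real coordinate along \<open>i (p j)\<close>.\<close>
  define w where "w j z = complex_of_real (y j (i z)) + \<i> * complex_of_real (y j z)" for j z
  have Im_w: "Im (w j z) = y j z" for j z by (simp add: w_def)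
  have w_linear: "complex_linear (w j)" for j
    unfolding complex_linear_def
  proof (intro conjI allI)
    fix a b show "w j (a + b) = w j a + w j b"
      by (simp add: w_def i_add linear_add[OF y_linear] algebra_simps)
  next
    fix c z
    have "w j (c *s z) = of_real (Re c * y j (i z) - Im c * y j z) + \<i> * of_real (Re c * y j z + Im c * y j (i z))"
      unfolding scale_eq[of c z] w_def i_add i_scaleR i_i
      by (simp add: linear_add[OF y_linear] linear_scale[OF y_linear] linear_neg[OF y_linear] linear_diff[OF y_linear])
    also have "\<dots> = c * w j z"
      by (simp add: w_def complex_eq_iff)
    finally show "w j (c *s z) = c * w j z" .
  qed
  have w_p: "w j (p j') = (if j' = j then 1 else 0)" if "j < d" "j' < d" for j j'
  proof -
    have "p j' \<in> B" using p_B1[of j'] that dim B1(1) by auto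
    moreover have "i (p j') = i (p j) \<longleftrightarrow> j' = j"
      using inj_eq[OF i_inj] p_inj[of j' j] that dim by simp
    ultimately show ?thesis
      using y_B[of "p j'" j] y_E[of "i (p j')" j] ip[of j'] that by (simp add: w_def)
  qed
  \<comment> \<open>Where all \<open>Im (w j z)\<close> vanish, the coordinates along
    \<open>E - B\<close> vanish, so \<open>z\<close> lies in the real span of the lattice.\<close>
  have reconstruct: "z = (\<Sum>c<CARD('n)+m. representation E z (p c) *\<^sub>R p c)" if "\<And>j. j < d \<Longrightarrow> Im (w j z) = 0" for z
  proof -
    have "representation E z e = 0" if "e \<in> E - B" for e
    proof -
      have "e \<in> i ` L" using that by (simp only: iL)
      then obtain b where b: "e = i b" "b \<in> L" by (rule imageE)
      from b(2) have "b \<in> l ` {..<d}" by (simp only: bij_betw_imp_surj_on[OF l])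
      then obtain j where "b = l j" "j \<in> {..<d}" by (rule imageE)
      then show ?thesis using \<open>\<And>j. j < d \<Longrightarrow> Im (w j z) = 0\<close>[of j] b(1) by (simp add: Im_w y_def p_def)
    qed
    then have "(\<Sum>b\<in>B. representation E z b *\<^sub>R b) = (\<Sum>b\<in>E. representation E z b *\<^sub>R b)"
      using finE E(1) by (intro sum.mono_neutral_left) auto
    also have "\<dots> = z" using E(3) spanE finE by (intro sum_representation_eq) auto
    finally show ?thesis using sum_p[of "representation E z"] by simp
  qed
  \<comment> \<open>The complex coordinate along \<open>p (d + k)\<close>, a member of
    \<open>B1 - L\<close>; it vanishes on the other members of \<open>B1\<close>.\<close>
  define x where "x k = coord (p (d + k))" for k
  have "adapted_basis \<Lambda> m d p x w"
  proof
    show "1 \<le> m" "d + m = CARD('n)" by fact+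
    show "\<Lambda> = range (\<lambda>k. \<Sum>c<CARD('n) + m. of_int (k c) *\<^sub>R p c)"
    proof (intro equalityI subsetI)
      fix z assume "z \<in> \<Lambda>"
      then have "z \<in> range (\<lambda>k. \<Sum>b\<in>B. of_int (k b) *\<^sub>R b)" by (simp only: B(3)[symmetric] int_span_def)
      then obtain k where "z = (\<Sum>b\<in>B. of_int (k b) *\<^sub>R b)" by (rule rangeE)
      then have "z = (\<Sum>c<CARD('n)+m. of_int (k (p c)) *\<^sub>R p c)" using sum_p[of "\<lambda>b. of_int (k b)"] by simp
      then show "z \<in> range (\<lambda>k. \<Sum>c<CARD('n) + m. of_int (k c) *\<^sub>R p c)"
        by (intro range_eqI[of _ _ "\<lambda>c. k (p c)"])
    next
      fix z assume "z \<in> range (\<lambda>k. \<Sum>c<CARD('n) + m. of_int (k c) *\<^sub>R p c)"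
      then obtain k where "z = (\<Sum>c<CARD('n) + m. of_int (k c) *\<^sub>R p c)" by (rule rangeE)
      then have "z = (\<Sum>b\<in>B. of_int (k (r b)) *\<^sub>R b)" using sum_p'[of "\<lambda>c. of_int (k c)"] by simp
      then show "z \<in> \<Lambda>" unfolding B(3)[symmetric] int_span_def by (intro range_eqI[of _ _ "\<lambda>b. k (r b)"])
    qed
    show "complex_linear (x k)" for k by (simp add: x_def coord_linear)
    show "complex_linear (w j)" for j by (rule w_linear)
    show "x k (p c) = (if c = d + k then 1 else 0)" if "k < m" "c < CARD('n)" for k c
      using that dim p_inj[of "d + k" c] coord_base[OF p_B1, of c "p (d + k)"] by (auto simp: x_def)
    show "w j (p j') = (if j' = j then 1 else 0)" if "j < d" "j' < d" for j j'
      using that by (rule w_p)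
    show "Im (w j (p c)) = 0" if "j < d" "c < CARD('n) + m" for j c
      using that bij_betwE[OF p] by (simp add: Im_w y_B)
    show "z = 0" if xz: "\<And>k. k < m \<Longrightarrow> x k z = 0" and wz: "\<And>j. j < d \<Longrightarrow> w j z = 0" for z
    proof -
      \<comment> \<open>Vanishing of the \<open>x k\<close> leaves a complex combination of
        \<open>L\<close>, whose coefficients are read off by the \<open>w j\<close>.\<close>
      have coordQ: "coord b z = 0" if "b \<in> B1 - L" for b
      proof -
        from that have "b \<in> q ` {..<m}" by (simp only: bij_betw_imp_surj_on[OF q])
        then obtain k where "b = q k" "k \<in> {..<m}" by (rule imageE)
        then show ?thesis using xz[of k] dim by (simp add: x_def p_def)
      qed
      have "(\<Sum>b\<in>B1. coord b z *s b) = (\<Sum>b\<in>L. coord b z *s b)"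
        using coordQ by (intro sum.mono_neutral_right finB1 finL) simp
      then have "z = (\<Sum>b\<in>L. coord b z *s b)"
        using coord_sum[of z] by (rule trans[rotated])
      also have "\<dots> = (\<Sum>j<d. coord (p j) z *s p j)"
        using sum.reindex_bij_betw[OF l, of "\<lambda>b. coord b z *s b"] by (simp add: p_def)
      finally have z: "z = (\<Sum>j<d. coord (p j) z *s p j)" .
      have "coord (p j) z = 0" if "j < d" for j
      proof -
        have "w j z = (\<Sum>j'<d. coord (p j') z * w j (p j'))"
          by (subst z) (simp add: complex_linear_simps(5)[OF w_linear] complex_linear_scale[OF w_linear])
        also have "\<dots> = (\<Sum>j'<d. if j' = j then coord (p j') z else 0)"
          using that by (intro sum.cong) (simp_all add: w_p)
        also have "\<dots> = coord (p j) z" using that by simp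
        finally show ?thesis using wz[OF that] by simp
      qed
      then show "z = 0" by (subst z) simp
    qed
    show "u c = 0" if "(\<Sum>c<CARD('n) + m. u c *\<^sub>R p c) = 0" "c < CARD('n) + m" for u c
    proof -
      have "p c \<in> B" using that(2) bij_betwE[OF p] by simp
      then have "representation E (\<Sum>b\<in>B. u (r b) *\<^sub>R b) (p c) = u (r (p c))"
        using representation_sum_scaleR[OF E(3) B(1) E(1), of "\<lambda>b. u (r b)" "p c"] by simp
      moreover have "(\<Sum>b\<in>B. u (r b) *\<^sub>R b) = 0" using that(1) by (simp only: sum_p')
      ultimately show "u c = 0" using r[OF that(2)] by (simp add: representation_zero)
    qed
    show "\<exists>K. \<forall>z. (\<forall>j<d. Im (w j z) = 0) \<longrightarrow>
       (\<exists>u. z = (\<Sum>c<CARD('n) + m. u c *\<^sub>R p c) \<and> (\<forall>c<CARD('n) + m. \<bar>u c\<bar> \<le> K * norm z))"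
    proof -
      define g where "g e z = representation E z e" for e z
      have g: "linear (g e)" for e
        unfolding g_def[abs_def] using E(3) spanE by (rule representation_linear)
      \<comment> \<open>Each real coordinate is bounded by its operator norm; the sum over
        \<open>E\<close> is a common constant.\<close>
      define K where "K = (\<Sum>e\<in>E. onorm (g e))"
      have bl: "bounded_linear (g e)" for e using g by (simp add: linear_conv_bounded_linear)
      have K: "\<bar>g (p c) z\<bar> \<le> K * norm z" if "c < CARD('n) + m" for c z
      proof -
        have "\<bar>g (p c) z\<bar> \<le> onorm (g (p c)) * norm z"
          using onorm[OF bl, of "p c" z] by simp
        also have "onorm (g (p c)) \<le> K" unfolding K_def
          using that bij_betwE[OF p] E(1) finE onorm_pos_le[OF bl] by (intro member_le_sum) auto
        finally show ?thesis by (simp add: mult_right_mono)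
      qed
      show ?thesis
      proof (intro exI[of _ K] allI impI)
        fix z assume "\<forall>j<d. Im (w j z) = 0"
        then have "z = (\<Sum>c<CARD('n) + m. g (p c) z *\<^sub>R p c)" unfolding g_def by (intro reconstruct) auto
        then show "\<exists>u. z = (\<Sum>c<CARD('n) + m. u c *\<^sub>R p c) \<and> (\<forall>c<CARD('n) + m. \<bar>u c\<bar> \<le> K * norm z)"
          using K by (intro exI[of _ "\<lambda>c. g (p c) z"]) auto
      qed
    qed
  qed
  then show ?thesis by (rule that)
qed

lemma sum_lessThan_add:
  fixes f :: "nat \<Rightarrow> 'a::comm_monoid_add"
  shows "(\<Sum>c<a + b. f c) = (\<Sum>c<a. f c) + (\<Sum>c<b. f (a + c))"
  by (induction b) (simp_all add: add.assoc)

section \<open>The normal form matrix of an adapted basis\<close>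

context adapted_basis
begin

definition "M_mat = Matrix.mat m m (\<lambda>(i, k). Re (x i (p (CARD('n) + k))))"
definition "N_mat = Matrix.mat m m (\<lambda>(i, k). Im (x i (p (CARD('n) + k))))"
definition "R1_mat = Matrix.mat d m (\<lambda>(i, k). Re (w i (p (d + k))))"
definition "R2_mat = Matrix.mat d m (\<lambda>(i, k). Re (w i (p (CARD('n) + k))))"

lemma w_p_real: "i < d \<Longrightarrow> c < CARD('n) + m \<Longrightarrow> w i (p c) = of_real (Re (w i (p c)))"
  using Im_w_p by (simp add: complex_eq_iff)

lemma n_diff_m: "CARD('n) - m = d"
  using dim by simp

lemma index_hcat:
  assumes "A \<in> carrier_mat r s" "B \<in> carrier_mat r t" "i < r" "k < s + t"
  shows "hcat A B $$ (i, k) = (if k < s then A $$ (i, k) else B $$ (i, k - s))"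
  using assms unfolding hcat_def by (subst index_mat_four_block) auto

lemma hcat_carrier:
  "A \<in> carrier_mat r s \<Longrightarrow> B \<in> carrier_mat r t \<Longrightarrow> hcat A B \<in> carrier_mat r (s + t)"
  unfolding hcat_def using four_block_carrier_mat[of A r s "0\<^sub>m 0 t" 0 t B "0\<^sub>m 0 s"] by auto

lemma mat_carriers:
  "M_mat \<in> carrier_mat m m" "N_mat \<in> carrier_mat m m" "R1_mat \<in> carrier_mat d m" "R2_mat \<in> carrier_mat d m"
  by (simp_all add: M_mat_def N_mat_def R1_mat_def R2_mat_def)

lemma index_R:
  assumes "i < d" "k < 2 * m"
  shows "hcat R1_mat R2_mat $$ (i, k) = Re (w i (p (d + k)))"
proof -
  have "d + k = CARD('n) + (k - m)" if "\<not> k < m" using that dim by simp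
  then show ?thesis
    using assms by (subst index_hcat[OF mat_carriers(3,4)]) (auto simp: R1_mat_def R2_mat_def)
qed

text \<open>The coordinates in the row order of \<open>P\<close>: first the rows containing M + iN,
  then those containing R.\<close>

definition X :: "nat \<Rightarrow> complex^'n \<Rightarrow> complex" where
  "X i = (if i < m then x i else w (i - m))"

lemma X_linear: "i < CARD('n) \<Longrightarrow> complex_linear (X i)"
  using dim by (auto simp: X_def intro: x_linear w_linear)

abbreviation "P \<equiv> normal_form_mat CARD('n) m M_mat N_mat R1_mat R2_mat"

lemma P_carrier: "P \<in> carrier_mat CARD('n) (CARD('n) + m)"
proof -
  have "hcat (1\<^sub>m m) (map_mat complex_of_real M_mat + \<i> \<cdot>\<^sub>m map_mat complex_of_real N_mat) \<in> carrier_mat m (m + m)"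
    using mat_carriers by (intro hcat_carrier) auto
  moreover have "map_mat complex_of_real (hcat R1_mat R2_mat) \<in> carrier_mat d (m + m)"
    using hcat_carrier[OF mat_carriers(3,4)] by simp
  ultimately have "P \<in> carrier_mat (m + d) (d + (m + m))"
    unfolding normal_form_mat_def n_diff_m by (intro four_block_carrier_mat) auto
  moreover have "m + d = CARD('n)" "d + (m + m) = CARD('n) + m" using dim by simp_all
  ultimately show ?thesis by (simp only:)
qed

text \<open>Each block is one of the defining relations: \<open>x_p\<close> gives the zero block and
  the upper identity, \<open>w_p\<close> the lower identity, and since the \<open>w\<close> are real
  on the columns, the entries of R may be stored as real parts.\<close>

lemma index_P:
  assumes i: "i < CARD('n)" and c: "c < CARD('n) + m"
  shows "P $$ (i, c) = X i (p c)"
proof -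
  let ?MN = "map_mat complex_of_real M_mat + \<i> \<cdot>\<^sub>m map_mat complex_of_real N_mat"
  have car: "hcat (1\<^sub>m m) ?MN \<in> carrier_mat m (m + m)"
    using mat_carriers by (intro hcat_carrier) auto
  have carR: "hcat R1_mat R2_mat \<in> carrier_mat d (m + m)"
    using hcat_carrier[OF mat_carriers(3,4)] .
  have MN: "?MN \<in> carrier_mat m m" using mat_carriers by auto
  have P: "P $$ (i, c) = (if i < m
      then if c < d then 0 else hcat (1\<^sub>m m) ?MN $$ (i, c - d)
      else if c < d then 1\<^sub>m d $$ (i - m, c) else of_real (hcat R1_mat R2_mat $$ (i - m, c - d)))"
    unfolding normal_form_mat_def n_diff_m using i c dim car carR
    by (subst index_mat_four_block) auto
  show ?thesis
  proof (cases "i < m")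
    case True
    show ?thesis
    proof (cases "c < d")
      case False
      have c': "c - d < m + m" using c dim False by simp
      show ?thesis
      proof (cases "c - d < m")
        case True
        then show ?thesis
          using \<open>i < m\<close> False dim c' x_p[OF \<open>i < m\<close>, of c]
          by (auto simp: P X_def index_hcat[OF one_carrier_mat MN])
      next
        case False
        then have "CARD('n) + (c - d - m) = c" "c - d - m < m" using dim \<open>\<not> c < d\<close> c' by simp_all
        then have entries: "M_mat $$ (i, c - d - m) = Re (x i (p c))" "N_mat $$ (i, c - d - m) = Im (x i (p c))"
          using \<open>i < m\<close> by (simp_all add: M_mat_def N_mat_def)
        show ?thesis
          using \<open>i < m\<close> \<open>\<not> c < d\<close> False c' mat_carriers entries
          by (simp add: P X_def index_hcat[OF one_carrier_mat MN] complex_eq_iff)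
      qed
    qed (use True dim x_p[OF True, of c] in \<open>simp add: P X_def\<close>)
  next
    case False
    then have i': "i - m < d" using i dim by simp
    show ?thesis
    proof (cases "c < d")
      case True
      then show ?thesis using False i' w_p[OF i' True] by (auto simp: P X_def)
    next
      case c: False
      then have "c - d < 2 * m" "d + (c - d) = c" using \<open>c < CARD('n) + m\<close> dim by simp_all
      then show ?thesis using False c i' index_R[OF i', of "c - d"] w_p_real[OF i' \<open>c < CARD('n) + m\<close>]
        by (simp add: P X_def)
    qed
  qed
qed

lemma P_mult:
  assumes "k \<in> carrier_vec (CARD('n) + m)" "i < CARD('n)"
  shows "vec_index (P *\<^sub>v map_vec of_int k) i = X i (\<Sum>c<CARD('n) + m. of_int (vec_index k c) *\<^sub>R p c)"
proof -
  have "vec_index (P *\<^sub>v map_vec of_int k) i = (\<Sum>c<CARD('n) + m. P $$ (i, c) * of_int (vec_index k c))"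
    using assms P_carrier by (simp add: scalar_prod_def atLeast0LessThan)
  also have "\<dots> = (\<Sum>c<CARD('n) + m. of_int (vec_index k c) * X i (p c))"
    using assms by (intro sum.cong) (simp_all add: index_P)
  also have "\<dots> = X i (\<Sum>c<CARD('n) + m. of_int (vec_index k c) *\<^sub>R p c)"
    by (simp add: complex_linear_simps[OF X_linear[OF assms(2)]])
  finally show ?thesis .
qed

text \<open>A kernel vector of \<open>N_mat\<close> would give a real combination of the last
  \<open>m\<close> columns with real \<open>x\<close> coordinates. Its \<open>w\<close> coordinates
  are real anyway, so it would also be a real combination of the other columns, against the real
  independence of all columns.\<close>

lemma invertible_N: "invertible_mat N_mat"
proof -
  have "det N_mat \<noteq> 0"
  proof
    assume "det N_mat = 0"
    then obtain b where b: "b \<in> carrier_vec m" "b \<noteq> 0\<^sub>v m" "N_mat *\<^sub>v b = 0\<^sub>v m"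
      using det_0_iff_vec_prod_zero_field[OF mat_carriers(2)] by auto
    define s where "s = (\<Sum>k<m. (vec_index b k) *\<^sub>R p (CARD('n) + k))"
    have Im_x: "Im (x i s) = 0" if "i < m" for i
    proof -
      have "x i s = (\<Sum>k<m. of_real (vec_index b k) * x i (p (CARD('n) + k)))"
        unfolding s_def by (simp add: complex_linear_simps[OF x_linear[OF that]])
      then have "Im (x i s) = (\<Sum>k<m. (vec_index b k) * Im (x i (p (CARD('n) + k))))"
        by (simp add: Im_sum)
      also have "\<dots> = vec_index (N_mat *\<^sub>v b) i"
        using that b(1) by (simp add: N_mat_def scalar_prod_def atLeast0LessThan mult.commute)
      finally show ?thesis using b(3) that by simp
    qed
    have Im_w: "Im (w i s) = 0" if "i < d" for i
      using Im_w_p[OF that] unfolding s_def by (simp add: complex_linear_simps[OF w_linear[OF that]] Im_sum)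
    \<comment> \<open>First the \<open>x\<close> coordinates are cleared with the columns
      \<open>p (d + k)\<close>, then the \<open>w\<close> coordinates with the \<open>p j\<close>;
      the second step leaves the \<open>x\<close> coordinates at zero because they vanish on the
      \<open>p j\<close>.\<close>
    define s' where "s' = s - (\<Sum>k<m. Re (x k s) *\<^sub>R p (d + k))"
    define s'' where "s'' = s' - (\<Sum>j<d. Re (w j s') *\<^sub>R p j)"
    have Im_w': "Im (w i s') = 0" if "i < d" for i
      using Im_w_p[OF that] Im_w[OF that] dim unfolding s'_def
      by (simp add: complex_linear_simps[OF w_linear[OF that]] Im_sum)
    have "s'' = 0"
    proof (rule separating)
      fix i assume i: "i < m"
      have "x i s' = x i s - (\<Sum>k<m. of_real (Re (x k s)) * (if k = i then 1 else 0))"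
        unfolding s'_def complex_linear_simps[OF x_linear[OF i]] using i dim x_p[OF i]
        by (intro arg_cong2[where f = minus] refl sum.cong) auto
      also have "\<dots> = 0" using i Im_x[OF i] by (simp add: complex_eq_iff if_distrib cong: if_cong)
      finally have "x i s' = 0" .
      then show "x i s'' = 0"
        unfolding s''_def complex_linear_simps[OF x_linear[OF i]] using i dim x_p[OF i]
        by (simp add: sum.neutral)
    next
      fix i assume i: "i < d"
      have "w i s'' = w i s' - (\<Sum>j<d. of_real (Re (w j s')) * (if j = i then 1 else 0))"
        unfolding s''_def complex_linear_simps[OF w_linear[OF i]] using i w_p[OF i]
        by (intro arg_cong2[where f = minus] refl sum.cong) auto
      also have "\<dots> = 0" using i Im_w'[OF i] by (simp add: complex_eq_iff if_distrib cong: if_cong)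
      finally show "w i s'' = 0" .
    qed
    \<comment> \<open>The coefficients of \<open>s''\<close> with respect to all columns; the last
      \<open>m\<close> of them are the entries of \<open>b\<close>.\<close>
    define t where "t c = (if c < d then - Re (w c s') else if c < CARD('n) then - Re (x (c - d) s) else vec_index b (c - CARD('n)))" for c
    have split: "(\<Sum>c<CARD('n) + m. f c) = (\<Sum>c<d. f c) + (\<Sum>c<m. f (d + c)) + (\<Sum>c<m. f (CARD('n) + c))" for f :: "nat \<Rightarrow> complex^'n"
      unfolding dim[symmetric] sum_lessThan_add ..
    have "(\<Sum>c<CARD('n) + m. t c *\<^sub>R p c) = s''"
      unfolding split using dim by (simp add: t_def s''_def s'_def s_def sum_negf)
    with \<open>s'' = 0\<close> have t0: "(\<Sum>c<CARD('n) + m. t c *\<^sub>R p c) = 0" by simp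
    have "vec_index b k = 0" if "k < m" for k
      using independent_p[OF t0, of "CARD('n) + k"] that dim by (simp add: t_def)
    then have "b = 0\<^sub>v m" using b(1) by (intro eq_vecI) auto
    with b(2) show False by simp
  qed
  from det_non_zero_imp_unit[OF mat_carriers(2) this, of "()"]
  obtain B where "B \<in> carrier_mat m m" "B * N_mat = 1\<^sub>m m" "N_mat * B = 1\<^sub>m m"
    by (auto simp: Units_def ring_mat_def)
  then show ?thesis
    using mat_carriers(2) unfolding invertible_mat_def inverts_mat_def by auto
qed

text \<open>The change of coordinates is the matrix \<open>A\<close> of the forms \<open>X\<close>:
  it is injective by \<open>separating\<close>, and it carries the vector \<open>p c\<close> to
  column \<open>c\<close> of \<open>P\<close>.\<close>

lemma normal_form: "normal_form \<Lambda> m M_mat N_mat R1_mat R2_mat"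
proof -
  obtain e :: "nat \<Rightarrow> 'n" where e: "bij_betw e {..<CARD('n)} UNIV"
    using ex_bij_betw_nat_finite[OF finite_class.finite_UNIV[where 'a = 'n]] by (auto simp: atLeast0LessThan)
  define f where "f z = (\<chi> r. X (the_inv_into {..<CARD('n)} e r) z)" for z
  have inv_less: "the_inv_into {..<CARD('n)} e r < CARD('n)" for r
    using the_inv_into_into[of e "{..<CARD('n)}" r "{..<CARD('n)}"] e by (auto simp: bij_betw_def)
  have inv_e: "the_inv_into {..<CARD('n)} e (e i) = i" if "i < CARD('n)" for i
    using that e by (intro the_inv_into_f_f) (auto simp: bij_betw_def)
  have lin: "Vector_Spaces.linear (*s) (*s) f"
    by unfold_locales (auto simp: f_def Finite_Cartesian_Product.vec_eq_iff
        complex_linear_add[OF X_linear[OF inv_less]] complex_linear_scale[OF X_linear[OF inv_less]]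
        vec.scale_right_distrib vec.scale_left_distrib)
  define A where "A = matrix f"
  have A: "A *v z = f z" for z unfolding A_def using lin by (rule matrix_works)
  have A_e: "vec_nth (A *v z) (e i) = X i z" if "i < CARD('n)" for z i
    using that by (simp add: A f_def inv_e)
  have sep: "z = 0" if "\<And>i. i < CARD('n) \<Longrightarrow> X i z = 0" for z
  proof (rule separating)
    fix i assume "i < m" then show "x i z = 0" using that[of i] dim by (simp add: X_def)
  next
    fix i assume "i < d" then show "w i z = 0" using that[of "m + i"] dim by (simp add: X_def)
  qed
  have "invertible A"
    unfolding invertible_left_inverse matrix_left_invertible_ker
  proof (intro allI impI)
    fix z assume "A *v z = 0"
    then show "z = 0" using A_e[of _ z] by (intro sep) simp
  qed
  moreover have "z \<in> \<Lambda> \<longleftrightarrow> (\<exists>k \<in> carrier_vec (CARD('n) + m).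
           Matrix.vec CARD('n) (\<lambda>i. vec_nth (A *v z) (e i)) = P *\<^sub>v map_vec of_int k)" (is "_ \<longleftrightarrow> ?R") for z
  proof
    assume "z \<in> \<Lambda>"
    then obtain k where k: "z = (\<Sum>c<CARD('n) + m. of_int (k c) *\<^sub>R p c)"
      unfolding lattice by (rule rangeE)
    define v where "v = Matrix.vec (CARD('n) + m) k"
    have v: "v \<in> carrier_vec (CARD('n) + m)" by (simp add: v_def)
    have "(\<Sum>c<CARD('n) + m. of_int (vec_index v c) *\<^sub>R p c) = z"
      unfolding k by (intro sum.cong) (simp_all add: v_def)
    then have "Matrix.vec CARD('n) (\<lambda>i. vec_nth (A *v z) (e i)) = P *\<^sub>v map_vec of_int v"
      using P_mult[OF v] P_carrier by (intro eq_vecI) (simp_all add: A_e del: index_mult_mat_vec)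
    then show ?R using v by (rule bexI)
  next
    assume ?R
    then obtain k where k: "k \<in> carrier_vec (CARD('n) + m)"
      and eq: "Matrix.vec CARD('n) (\<lambda>i. vec_nth (A *v z) (e i)) = P *\<^sub>v map_vec of_int k" by (rule bexE)
    have "z - (\<Sum>c<CARD('n) + m. of_int (vec_index k c) *\<^sub>R p c) = 0"
    proof (rule sep)
      fix i assume i: "i < CARD('n)"
      have "X i z = vec_index (P *\<^sub>v map_vec of_int k) i"
        using arg_cong[OF eq, of "\<lambda>v. vec_index v i"] i by (simp add: A_e del: index_mult_mat_vec)
      then show "X i (z - (\<Sum>c<CARD('n) + m. of_int (vec_index k c) *\<^sub>R p c)) = 0"
        using P_mult[OF k i] complex_linear_simps(3)[OF X_linear[OF i]] by simp
    qed
    then have "z = (\<Sum>c<CARD('n) + m. of_int (vec_index k c) *\<^sub>R p c)" by simp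
    then show "z \<in> \<Lambda>" unfolding lattice by (rule range_eqI[of _ _ "\<lambda>c. vec_index k c"])
  qed
  ultimately have "\<exists>(A :: complex^'n^'n) e. invertible A \<and> bij_betw e {..<CARD('n)} UNIV \<and>
        (\<forall>z. z \<in> \<Lambda> \<longleftrightarrow> (\<exists>k \<in> carrier_vec (CARD('n) + m).
           Matrix.vec CARD('n) (\<lambda>i. vec_nth (A *v z) (e i)) = P *\<^sub>v map_vec of_int k))"
    using e by (intro exI[of _ A] exI[of _ e] conjI allI)
  then show ?thesis
    using m_pos dim mat_carriers invertible_N unfolding normal_form_def Let_def n_diff_m by simp
qed

end

section \<open>Cech classes of additive cocycles on the lattice\<close>

lemma holomorphic_Cn_translate:
  assumes "holomorphic_Cn f S" "\<And>z. z \<in> T \<Longrightarrow> z + c \<in> S"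
  shows "holomorphic_Cn (\<lambda>z. f (z + c)) T"
  unfolding holomorphic_Cn_def
proof
  fix z assume "z \<in> T"
  then obtain f' where f': "(f has_derivative f') (at (z + c))" "\<forall>c v. f' (c *s v) = c * f' v"
    using assms unfolding holomorphic_Cn_def by blast
  have "((\<lambda>z. z + c) has_derivative (\<lambda>h. h)) (at z)"
    by (auto intro!: derivative_eq_intros)
  from has_derivative_compose[OF this f'(1)] have "((\<lambda>z. f (z + c)) has_derivative f') (at z)" .
  with f'(2) show "\<exists>f'. ((\<lambda>z. f (z + c)) has_derivative f') (at z) \<and> (\<forall>c v. f' (c *s v) = c * f' v)"
    by blast
qed

lemma holomorphic_Cn_add:
  assumes "holomorphic_Cn f S" "holomorphic_Cn g S"
  shows "holomorphic_Cn (\<lambda>z. f z + g z) S"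
  unfolding holomorphic_Cn_def
proof
  fix z assume "z \<in> S"
  then obtain f' g' where "(f has_derivative f') (at z)" "\<forall>c v. f' (c *s v) = c * f' v"
    "(g has_derivative g') (at z)" "\<forall>c v. g' (c *s v) = c * g' v"
    using assms unfolding holomorphic_Cn_def by meson
  then show "\<exists>h. ((\<lambda>z. f z + g z) has_derivative h) (at z) \<and> (\<forall>c v. h (c *s v) = c * h v)"
    by (intro exI[of _ "\<lambda>v. f' v + g' v"]) (auto intro!: has_derivative_add simp: algebra_simps)
qed

lemma holomorphic_Cn_mult_left:
  assumes "holomorphic_Cn f S"
  shows "holomorphic_Cn (\<lambda>z. a * f z) S"
  unfolding holomorphic_Cn_def
proof
  fix z assume "z \<in> S"
  then obtain f' where "(f has_derivative f') (at z)" "\<forall>c v. f' (c *s v) = c * f' v"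
    using assms unfolding holomorphic_Cn_def by meson
  then show "\<exists>h. ((\<lambda>z. a * f z) has_derivative h) (at z) \<and> (\<forall>c v. h (c *s v) = c * h v)"
    by (intro exI[of _ "\<lambda>v. a * f' v"]) (auto intro!: has_derivative_mult_right)
qed

lemma holomorphic_Cn_sum:
  assumes "\<And>r. r \<in> R \<Longrightarrow> holomorphic_Cn (f r) S"
  shows "holomorphic_Cn (\<lambda>z. \<Sum>r\<in>R. f r z) S"
proof -
  have zero: "holomorphic_Cn (\<lambda>z. 0) S"
    unfolding holomorphic_Cn_def by (auto intro!: exI[of _ "\<lambda>v. 0"])
  show ?thesis
    using assms by (induction R rule: infinite_finite_induct) (auto simp: zero intro: holomorphic_Cn_add)
qed

lemma holomorphic_Cn_subset: "holomorphic_Cn f S \<Longrightarrow> T \<subseteq> S \<Longrightarrow> holomorphic_Cn f T"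
  unfolding holomorphic_Cn_def by blast

text \<open>Holomorphy is defined by differentiability at points, so the local model
  \<open>g\<close> is only asked to be differentiable at the one point \<open>z\<close>, while
  agreeing with \<open>f\<close> near it.\<close>

lemma holomorphic_Cn_local:
  assumes "\<And>z. z \<in> S \<Longrightarrow> \<exists>N g. open N \<and> z \<in> N \<and> holomorphic_Cn g {z} \<and> (\<forall>z'\<in>N. f z' = g z')"
  shows "holomorphic_Cn f S"
  unfolding holomorphic_Cn_def
proof
  fix z assume "z \<in> S"
  then obtain N g where N: "open N" "z \<in> N" "holomorphic_Cn g {z}" "\<forall>z'\<in>N. f z' = g z'"
    using assms by blast
  then obtain g' where "(g has_derivative g') (at z)" "\<forall>c v. g' (c *s v) = c * g' v"
    unfolding holomorphic_Cn_def by blast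
  moreover have "(f has_derivative g') (at z)"
    using calculation(1) N(1,2) by (rule has_derivative_transform_within_open) (use N(4) in auto)
  ultimately show "\<exists>f'. (f has_derivative f') (at z) \<and> (\<forall>c v. f' (c *s v) = c * f' v)"
    by blast
qed

text \<open>Two points of a ball of radius \<open>\<epsilon>\<close> are less than
  \<open>2 * \<epsilon>\<close> apart, so the projection is injective on such balls. Invariance
  makes \<open>\<Omega>\<close> the full inverse image of its projection.\<close>

locale lattice_domain =
  fixes \<Lambda> \<Omega> :: "(complex^'n) set" and \<epsilon> :: real
  assumes zero_mem: "0 \<in> \<Lambda>"
    and diff_mem: "x \<in> \<Lambda> \<Longrightarrow> y \<in> \<Lambda> \<Longrightarrow> x - y \<in> \<Lambda>"
    and eps_pos: "0 < \<epsilon>"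
    and separated: "l \<in> \<Lambda> \<Longrightarrow> norm l < 2 * \<epsilon> \<Longrightarrow> l = 0"
    and open_domain: "open \<Omega>"
    and invariant: "z \<in> \<Omega> \<Longrightarrow> l \<in> \<Lambda> \<Longrightarrow> z + l \<in> \<Omega>"
begin

section \<open>Local sections of the projection over an invariant domain\<close>

abbreviation "\<pi> \<equiv> qproj \<Lambda>"

abbreviation "U \<equiv> \<pi> ` \<Omega>"

lemma uminus_mem: "x \<in> \<Lambda> \<Longrightarrow> - x \<in> \<Lambda>"
  using diff_mem[OF zero_mem] by simp

lemma add_mem: "x \<in> \<Lambda> \<Longrightarrow> y \<in> \<Lambda> \<Longrightarrow> x + y \<in> \<Lambda>"
  using diff_mem[of x "- y"] uminus_mem by simp

lemma mem_qproj: "y \<in> \<pi> z \<longleftrightarrow> y - z \<in> \<Lambda>"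
  unfolding qproj_def by (auto simp: image_iff intro!: bexI[of _ "y - z"])

lemma qproj_eq: "\<pi> z = \<pi> y \<longleftrightarrow> y - z \<in> \<Lambda>"
proof
  assume "\<pi> z = \<pi> y"
  then show "y - z \<in> \<Lambda>" using mem_qproj[of y y] mem_qproj[of y z] zero_mem by simp
next
  assume *: "y - z \<in> \<Lambda>"
  have "x - z \<in> \<Lambda> \<longleftrightarrow> x - y \<in> \<Lambda>" for x
    using add_mem[OF _ *, of "x - y"] diff_mem[OF _ *, of "x - z"] by auto
  then show "\<pi> z = \<pi> y" by (auto simp: mem_qproj set_eq_iff)
qed

lemma qproj_add [simp]: "l \<in> \<Lambda> \<Longrightarrow> \<pi> (z + l) = \<pi> z"
  using qproj_eq[of z "z + l"] by simp

lemma invariant_iff: "y - z \<in> \<Lambda> \<Longrightarrow> z \<in> \<Omega> \<longleftrightarrow> y \<in> \<Omega>"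
  using invariant[of z "y - z"] invariant[of y "z - y"] uminus_mem[of "y - z"] by auto

lemma vimage_domain: "\<pi> -` U = \<Omega>"
proof (intro equalityI subsetI)
  fix z assume "z \<in> \<pi> -` U"
  then obtain y where "y \<in> \<Omega>" "\<pi> z = \<pi> y" by auto
  then show "z \<in> \<Omega>" using invariant_iff[of y z] by (simp add: qproj_eq)
qed auto

lemma openin_domain: "openin (quot_topology \<Lambda>) U"
  by (auto simp: openin_quot_topology vimage_domain open_domain)

definition rep :: "(complex^'n) set \<Rightarrow> complex^'n" where
  "rep x = (SOME y. y \<in> x)"

text \<open>A local section of the projection over \<open>cov x\<close>, with values near the
  representative of \<open>x\<close>. Two points of one coset within \<open>\<epsilon>\<close> of
  \<open>rep x\<close> coincide, so the description determines the point there.\<close>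

definition sec :: "(complex^'n) set \<Rightarrow> (complex^'n) set \<Rightarrow> complex^'n" where
  "sec x p = (THE z. z \<in> p \<and> dist z (rep x) < \<epsilon>)"

definition cov :: "(complex^'n) set \<Rightarrow> (complex^'n) set set" where
  "cov x = \<pi> ` (\<Omega> \<inter> ball (rep x) \<epsilon>)"

lemma sec_eq:
  assumes "l \<in> \<Lambda>" "dist (z + l) (rep x) < \<epsilon>"
  shows "sec x (\<pi> z) = z + l"
  unfolding sec_def
proof (rule the_equality)
  show "z + l \<in> \<pi> z \<and> dist (z + l) (rep x) < \<epsilon>"
    using assms by (simp add: mem_qproj)
next
  fix y assume y: "y \<in> \<pi> z \<and> dist y (rep x) < \<epsilon>"
  then have "y - (z + l) \<in> \<Lambda>"
    using diff_mem[of "y - z" l] assms by (simp add: mem_qproj algebra_simps)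
  moreover have "norm (y - (z + l)) < 2 * \<epsilon>"
    using y assms(2) dist_triangle2[of y "z + l" "rep x"] by (simp add: dist_norm)
  ultimately show "y = z + l"
    using separated by fastforce
qed

text \<open>The translation that carries \<open>z\<close> into the ball about \<open>rep x\<close>
  also carries nearby points there, so the lattice vector \<open>l\<close> can be kept fixed on a
  neighbourhood.\<close>

lemma sec_local:
  assumes "\<pi> z \<in> cov x"
  obtains l N where "l \<in> \<Lambda>" "open N" "z \<in> N" "N \<subseteq> \<Omega>" "\<And>z'. z' \<in> N \<Longrightarrow> sec x (\<pi> z') = z' + l"
    "\<And>z'. z' \<in> N \<Longrightarrow> \<pi> z' \<in> cov x"
proof -
  from assms obtain y where y: "y \<in> \<Omega>" "y \<in> ball (rep x) \<epsilon>" "\<pi> z = \<pi> y"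
    by (auto simp: cov_def)
  define l where "l = y - z"
  have l: "l \<in> \<Lambda>" using y(3) by (simp add: l_def qproj_eq)
  define N where "N = (\<lambda>z. z + l) -` (\<Omega> \<inter> ball (rep x) \<epsilon>)"
  have "open N"
    unfolding N_def by (rule open_vimage) (auto intro!: open_domain continuous_intros)
  moreover have "z \<in> N"
    using y by (simp add: N_def l_def)
  moreover have "N \<subseteq> \<Omega>"
  proof
    fix z' assume "z' \<in> N"
    then show "z' \<in> \<Omega>" using invariant_iff[of "z' + l" z'] l by (simp add: N_def)
  qed
  moreover have "sec x (\<pi> z') = z' + l" if "z' \<in> N" for z'
    using that sec_eq[OF l] by (simp add: N_def dist_commute)
  moreover have "\<pi> z' \<in> cov x" if "z' \<in> N" for z'
    using that qproj_add[OF l, of z'] imageI[of "z' + l" "\<Omega> \<inter> ball (rep x) \<epsilon>" \<pi>]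
    by (simp add: N_def cov_def)
  ultimately show ?thesis using that l by blast
qed

lemma sec_mem:
  assumes "\<pi> z \<in> cov x"
  shows "sec x (\<pi> z) \<in> \<Omega>" "sec x (\<pi> z) - z \<in> \<Lambda>"
proof -
  obtain l N where "l \<in> \<Lambda>" "z \<in> N" "N \<subseteq> \<Omega>" "sec x (\<pi> z) = z + l"
    by (rule sec_local[OF assms]) blast
  then show "sec x (\<pi> z) \<in> \<Omega>" "sec x (\<pi> z) - z \<in> \<Lambda>"
    using invariant by auto
qed

lemma pointed_cover_cov: "pointed_cover (quot_topology \<Lambda>) U cov"
  unfolding pointed_cover_def
proof (intro ballI conjI)
  fix x assume "x \<in> U"
  then obtain z where z: "z \<in> \<Omega>" "x = \<pi> z" by auto
  have "z \<in> \<pi> z" using zero_mem by (simp add: mem_qproj)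
  then have "rep x \<in> \<pi> z" unfolding rep_def z by (rule someI)
  then have "rep x - z \<in> \<Lambda>" by (simp add: mem_qproj)
  then have "rep x \<in> \<Omega>" "\<pi> z = \<pi> (rep x)" using z invariant_iff[of "rep x" z] by (simp_all add: qproj_eq)
  moreover have "rep x \<in> ball (rep x) \<epsilon>" using eps_pos by simp
  ultimately show "x \<in> cov x"
    unfolding cov_def z(2)[symmetric] by (metis IntI imageI z(2))
  show "cov x \<subseteq> U" unfolding cov_def by blast
  show "openin (quot_topology \<Lambda>) (cov x)"
    unfolding openin_quot_topology
  proof
    show "cov x \<subseteq> range \<pi>" unfolding cov_def by blast
    show "open (\<pi> -` cov x)"
      unfolding open_subopen[of "\<pi> -` cov x"]
    proof
      fix z assume "z \<in> \<pi> -` cov x"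
      then have "\<pi> z \<in> cov x" by simp
      then obtain N where "open N" "z \<in> N" "\<And>z'. z' \<in> N \<Longrightarrow> \<pi> z' \<in> cov x"
        by (rule sec_local) blast
      then show "\<exists>T. open T \<and> z \<in> T \<and> T \<subseteq> \<pi> -` cov x"
        by (intro exI[of _ N]) auto
    qed
  qed
qed

section \<open>Cocycles of the lattice acting on holomorphic functions by translation\<close>

definition group_cocycle :: "(complex^'n \<Rightarrow> complex^'n \<Rightarrow> complex) \<Rightarrow> bool" where
  "group_cocycle a \<longleftrightarrow> (\<forall>l\<in>\<Lambda>. holomorphic_Cn (a l) \<Omega>) \<and>
     (\<forall>k\<in>\<Lambda>. \<forall>l\<in>\<Lambda>. \<forall>z\<in>\<Omega>. a (k + l) z = a k z + a l (z + k))"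

text \<open>The comparison from group cohomology to Cech cohomology: on an overlap two local
  sections differ by a lattice vector, at which the group cocycle is evaluated.\<close>

definition cech :: "(complex^'n \<Rightarrow> complex^'n \<Rightarrow> complex) \<Rightarrow> (complex^'n) set cech_cochain" where
  "cech a = (cov, \<lambda>x y p. a (sec y p - sec x p) (sec x p))"

lemma group_cocycle_holomorphic: "group_cocycle a \<Longrightarrow> l \<in> \<Lambda> \<Longrightarrow> holomorphic_Cn (a l) \<Omega>"
  by (simp add: group_cocycle_def)

lemma group_cocycle_add:
  "group_cocycle a \<Longrightarrow> k \<in> \<Lambda> \<Longrightarrow> l \<in> \<Lambda> \<Longrightarrow> z \<in> \<Omega> \<Longrightarrow> a (k + l) z = a k z + a l (z + k)"
  by (simp add: group_cocycle_def)

lemma group_cocycle_sum: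
  assumes "\<And>r. r \<in> R \<Longrightarrow> group_cocycle (a r)"
  shows "group_cocycle (\<lambda>l z. \<Sum>r\<in>R. \<beta> r * a r l z)"
  unfolding group_cocycle_def
proof (intro conjI ballI)
  fix l assume "l \<in> \<Lambda>"
  with assms show "holomorphic_Cn (\<lambda>z. \<Sum>r\<in>R. \<beta> r * a r l z) \<Omega>"
    by (intro holomorphic_Cn_sum holomorphic_Cn_mult_left group_cocycle_holomorphic)
next
  fix k l z assume "k \<in> \<Lambda>" "l \<in> \<Lambda>" "z \<in> \<Omega>"
  with assms have "(\<Sum>r\<in>R. \<beta> r * a r (k + l) z) = (\<Sum>r\<in>R. \<beta> r * a r k z + \<beta> r * a r l (z + k))"
    by (intro sum.cong) (simp_all add: group_cocycle_add distrib_left)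
  then show "(\<Sum>r\<in>R. \<beta> r * a r (k + l) z) = (\<Sum>r\<in>R. \<beta> r * a r k z) + (\<Sum>r\<in>R. \<beta> r * a r l (z + k))"
    by (simp add: sum.distrib)
qed

text \<open>Differences of sections are locally constant, so the cochain is locally a translate of a
  single holomorphic function. The Cech identity is the group identity for the consecutive
  differences of three sections.\<close>

lemma cech_cocycle:
  assumes a: "group_cocycle a"
  shows "cech a \<in> cech_cocycles (quot_topology \<Lambda>) (quot_sheaf_O \<Lambda>) U"
  unfolding cech_def cech_cocycles_def
proof (clarsimp simp: pointed_cover_cov, intro conjI ballI)
  fix u v assume "u \<in> \<Omega>" "v \<in> \<Omega>"
  let ?x = "\<pi> u" and ?y = "\<pi> v"
  show "(\<lambda>p. a (sec ?y p - sec ?x p) (sec ?x p)) \<in> quot_sheaf_O \<Lambda> (cov ?x \<inter> cov ?y)"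
    unfolding quot_sheaf_O_def mem_Collect_eq
  proof (rule holomorphic_Cn_local)
    fix z assume "z \<in> \<pi> -` (cov ?x \<inter> cov ?y)"
    then have z: "\<pi> z \<in> cov ?x" "\<pi> z \<in> cov ?y" by auto
    obtain k M where k: "k \<in> \<Lambda>" "open M" "z \<in> M" "M \<subseteq> \<Omega>" "\<And>z'. z' \<in> M \<Longrightarrow> sec ?x (\<pi> z') = z' + k"
      by (rule sec_local[OF z(1)]) blast
    obtain l N where l: "l \<in> \<Lambda>" "open N" "z \<in> N" "\<And>z'. z' \<in> N \<Longrightarrow> sec ?y (\<pi> z') = z' + l"
      by (rule sec_local[OF z(2)]) blast
    have "holomorphic_Cn (\<lambda>z. a (l - k) (z + k)) {z}"
    proof (rule holomorphic_Cn_translate)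
      show "holomorphic_Cn (a (l - k)) \<Omega>"
        using a diff_mem[OF l(1) k(1)] by (rule group_cocycle_holomorphic)
    qed (use k invariant in auto)
    then show "\<exists>N g. open N \<and> z \<in> N \<and> holomorphic_Cn g {z} \<and>
        (\<forall>z'\<in>N. ((\<lambda>p. a (sec ?y p - sec ?x p) (sec ?x p)) \<circ> \<pi>) z' = g z')"
      using k l by (intro exI[of _ "M \<inter> N"] exI[of _ "\<lambda>z. a (l - k) (z + k)"]) auto
  qed
next
  fix u v w p assume "u \<in> \<Omega>" "v \<in> \<Omega>" "w \<in> \<Omega>" and p: "p \<in> cov (\<pi> u) \<inter> cov (\<pi> v) \<inter> cov (\<pi> w)"
  let ?x = "\<pi> u" and ?y = "\<pi> v" and ?z = "\<pi> w"
  obtain q where q: "p = \<pi> q" using p by (auto simp: cov_def)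
  have *: "sec ?x p \<in> \<Omega>" "sec ?x p - q \<in> \<Lambda>" "sec ?y p - q \<in> \<Lambda>" "sec ?z p - q \<in> \<Lambda>"
    using p sec_mem unfolding q by auto
  have k: "sec ?y p - sec ?x p \<in> \<Lambda>" using diff_mem[OF *(3,2)] by simp
  have l: "sec ?z p - sec ?y p \<in> \<Lambda>" using diff_mem[OF *(4,3)] by simp
  have "a ((sec ?y p - sec ?x p) + (sec ?z p - sec ?y p)) (sec ?x p)
      = a (sec ?y p - sec ?x p) (sec ?x p) + a (sec ?z p - sec ?y p) (sec ?x p + (sec ?y p - sec ?x p))"
    using a *(1) k l by (intro group_cocycle_add)
  then show "a (sec ?z p - sec ?y p) (sec ?y p) - a (sec ?z p - sec ?x p) (sec ?x p) +
      a (sec ?y p - sec ?x p) (sec ?x p) = 0"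
    by (simp add: algebra_simps)
qed

sublocale sheaf: linear_presheaf "quot_topology \<Lambda>" "quot_sheaf_O \<Lambda>"
  by (rule linear_presheaf_quot_sheaf_O)

abbreviation "H1 \<equiv> cech_H1 (quot_topology \<Lambda>) (quot_sheaf_O \<Lambda>) U"

text \<open>A trivialization of the Cech cocycle is a family of local functions on the quotient.
  Adding the group cocycle along the lattice vector from \<open>sec x\<close> to \<open>z\<close>
  makes their pullbacks agree on overlaps, and they glue to a primitive on
  \<open>\<Omega>\<close>.\<close>

lemma cech_class_zero:
  assumes a: "group_cocycle a" and zero: "sheaf.cls U (cech a) = \<zero>\<^bsub>H1\<^esub>"
  obtains f where "holomorphic_Cn f \<Omega>" "\<And>l z. l \<in> \<Lambda> \<Longrightarrow> z \<in> \<Omega> \<Longrightarrow> f (z + l) - f z = a l z"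
proof -
  have "(cech a, (\<lambda>x. U, \<lambda>x y p. 0)) \<in> cech_rel (quot_topology \<Lambda>) (quot_sheaf_O \<Lambda>) U"
    using zero sheaf.cls_eq[OF cech_cocycle[OF a] sheaf.zero_cocycles[OF openin_domain]]
    by (simp add: sheaf.zero_cech_H1)
  then obtain W g where W: "pointed_cover (quot_topology \<Lambda>) U W" "\<And>x. x \<in> U \<Longrightarrow> W x \<subseteq> cov x"
     "\<And>x. x \<in> U \<Longrightarrow> g x \<in> quot_sheaf_O \<Lambda> (W x)"
     "\<And>x y p. x \<in> U \<Longrightarrow> y \<in> U \<Longrightarrow> p \<in> W x \<Longrightarrow> p \<in> W y \<Longrightarrow>
        a (sec y p - sec x p) (sec x p) - 0 = g y p - g x p"
    unfolding cech_def by (rule sheaf.cech_relE) (rule that)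
  \<comment> \<open>The first term depends only on the coset of \<open>z\<close>, so the second
    accounts for all changes under lattice translations.\<close>
  define F where "F x z = g x (\<pi> z) + a (z - sec x (\<pi> z)) (sec x (\<pi> z))" for x z
  define f where "f z = F (\<pi> z) z" for z
  have add: "a (k + l) z = a k z + a l (z + k)" if "k \<in> \<Lambda>" "l \<in> \<Lambda>" "z \<in> \<Omega>" for k l z
    using group_cocycle_add[OF a that] .
  have f_eq: "f z = F x z" if z: "z \<in> \<Omega>" "x \<in> U" "\<pi> z \<in> W x" for x z
  proof -
    define y where "y = \<pi> z"
    have y: "y \<in> U" "\<pi> z \<in> W y" using z W(1) by (auto simp: y_def pointed_cover_def)
    define s where "s = sec x (\<pi> z)"
    define t where "t = sec y (\<pi> z)"
    have s: "s \<in> \<Omega>" "s - z \<in> \<Lambda>" using sec_mem[of z x] W(2)[of x] z by (auto simp: s_def)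
    have t: "t \<in> \<Omega>" "t - z \<in> \<Lambda>" using sec_mem[of z y] W(2)[of y] y by (auto simp: t_def)
    have 1: "a (t - s) s = g y (\<pi> z) - g x (\<pi> z)"
      using W(4)[OF z(2) y(1) z(3) y(2)] by (simp add: s_def t_def)
    have "t - s \<in> \<Lambda>" using diff_mem[OF t(2) s(2)] by simp
    moreover have "z - t \<in> \<Lambda>" using uminus_mem[OF t(2)] by simp
    \<comment> \<open>Going from \<open>s\<close> to \<open>z\<close> by way of \<open>t\<close>:
      the extra term \<open>a (t - s) s\<close> is compensated by the difference of the values of
      \<open>g\<close>.\<close>
    ultimately have "a (z - s) s = a (t - s) s + a (z - t) t"
      using add[of "t - s" "z - t" s] s by simp
    moreover have "f z = g y (\<pi> z) + a (z - t) t"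
      by (simp add: f_def F_def y_def t_def)
    moreover have "F x z = g x (\<pi> z) + a (z - s) s"
      by (simp add: F_def s_def)
    ultimately show ?thesis
      using 1 by simp
  qed
  show ?thesis
  proof (rule that[of f])
    show "holomorphic_Cn f \<Omega>"
    proof (rule holomorphic_Cn_local)
      fix z assume z: "z \<in> \<Omega>"
      define x where "x = \<pi> z"
      have x: "x \<in> U" "\<pi> z \<in> W x" using z W(1) by (auto simp: x_def pointed_cover_def)
      then have "\<pi> z \<in> cov x" using W(2) by blast
      then obtain l N where N: "l \<in> \<Lambda>" "open N" "z \<in> N" "N \<subseteq> \<Omega>"
        "\<And>z'. z' \<in> N \<Longrightarrow> sec x (\<pi> z') = z' + l"
        by (rule sec_local) blast
      have "open (\<pi> -` W x)"
        using W(1) x unfolding pointed_cover_def openin_quot_topology by blast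
      then have M: "open (N \<inter> \<pi> -` W x)" "z \<in> N \<inter> \<pi> -` W x"
        using N x by auto
      have g: "holomorphic_Cn (g x \<circ> \<pi>) (\<pi> -` W x)"
        using W(3)[OF x(1)] by (simp add: quot_sheaf_O_def)
      have "holomorphic_Cn (\<lambda>z. (g x \<circ> \<pi>) z + a (- l) (z + l)) {z}"
        using N(1) z x(2) uminus_mem invariant
        by (intro holomorphic_Cn_add holomorphic_Cn_subset[OF g] holomorphic_Cn_translate[of _ \<Omega>]
            group_cocycle_holomorphic[OF a]) auto
      moreover have "f z' = (g x \<circ> \<pi>) z' + a (- l) (z' + l)" if "z' \<in> N \<inter> \<pi> -` W x" for z'
        using that f_eq[of z' x] x N(4) N(5)[of z'] by (auto simp: F_def)
      ultimately show "\<exists>N g. open N \<and> z \<in> N \<and> holomorphic_Cn g {z} \<and> (\<forall>z'\<in>N. f z' = g z')"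
        using M by meson
    qed
  next
    fix l z assume l: "l \<in> \<Lambda>" and z: "z \<in> \<Omega>"
    define s where "s = sec (\<pi> z) (\<pi> z)"
    have "\<pi> z \<in> W (\<pi> z)" using z W(1) by (auto simp: pointed_cover_def)
    then have s: "s \<in> \<Omega>" "s - z \<in> \<Lambda>" using sec_mem[of z "\<pi> z"] W(2)[of "\<pi> z"] z by (auto simp: s_def)
    have "a ((z - s) + l) s = a (z - s) s + a l z"
      using add[of "z - s" l s] s l uminus_mem[OF s(2)] by simp
    moreover have "f (z + l) = g (\<pi> z) (\<pi> z) + a (z + l - s) s" "f z = g (\<pi> z) (\<pi> z) + a (z - s) s"
      using l by (simp_all add: f_def F_def s_def)
    moreover have "z + l - s = (z - s) + l" by simp
    ultimately show "f (z + l) - f z = a l z" by simp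
  qed
qed

text \<open>All these classes are represented on the one covering \<open>cov\<close>, so a
  combination of classes is represented there by the combined cocycle; the intersected coverings
  produced by \<open>cadd\<close> do not change the class.\<close>

lemma cech_class_sum:
  assumes "finite R" "\<And>r. r \<in> R \<Longrightarrow> group_cocycle (a r)"
  shows "(\<Oplus>\<^bsub>H1\<^esub>r\<in>R. \<beta> r \<odot>\<^bsub>H1\<^esub> sheaf.cls U (cech (a r)))
    = sheaf.cls U (cech (\<lambda>l z. \<Sum>r\<in>R. \<beta> r * a r l z))"
  using assms
proof (induction R rule: finite_induct)
  case empty
  interpret V: vectorspace class_ring H1
    by (rule sheaf.vectorspace_cech_H1[OF openin_domain])
  have "group_cocycle (\<lambda>l z. 0)" using group_cocycle_sum[of "{}"] by simp
  then have "sheaf.cls U (cech (\<lambda>l z. 0)) = sheaf.cls U (\<lambda>x. U, \<lambda>x y p. 0)"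
    by (intro sheaf.cls_eqI cech_cocycle sheaf.zero_cocycles openin_domain) (auto simp: cech_def)
  then show ?case by (simp add: sheaf.zero_cech_H1)
next
  case (insert r R)
  interpret V: vectorspace class_ring H1
    by (rule sheaf.vectorspace_cech_H1[OF openin_domain])
  let ?S = "\<lambda>l z. \<Sum>r\<in>R. \<beta> r * a r l z"
  have mem: "sheaf.cls U (cech (a i)) \<in> carrier H1" if "i \<in> insert r R" for i
    using insert.prems that by (auto simp: sheaf.carrier_cech_H1 intro: cech_cocycle)
  have S: "group_cocycle ?S" by (rule group_cocycle_sum) (use insert.prems in auto)
  have C: "cech (a r) \<in> cech_cocycles (quot_topology \<Lambda>) (quot_sheaf_O \<Lambda>) U"
    "cech ?S \<in> cech_cocycles (quot_topology \<Lambda>) (quot_sheaf_O \<Lambda>) U"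
    using S insert.prems by (auto intro: cech_cocycle)
  have "(\<Oplus>\<^bsub>H1\<^esub>r\<in>insert r R. \<beta> r \<odot>\<^bsub>H1\<^esub> sheaf.cls U (cech (a r)))
      = \<beta> r \<odot>\<^bsub>H1\<^esub> sheaf.cls U (cech (a r)) \<oplus>\<^bsub>H1\<^esub> (\<Oplus>\<^bsub>H1\<^esub>r\<in>R. \<beta> r \<odot>\<^bsub>H1\<^esub> sheaf.cls U (cech (a r)))"
    using insert.hyps mem by (intro V.finsum_insert) (auto simp: class_ring_simps)
  also have "\<dots> = sheaf.cls U (sheaf.cadd (sheaf.cscale (\<beta> r) (cech (a r))) (cech ?S))"
    using insert.IH insert.prems C
    by (simp add: sheaf.smult_cech_H1 sheaf.add_cech_H1 sheaf.cscale_cocycles)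
  also have "\<dots> = sheaf.cls U (cech (\<lambda>l z. \<Sum>r\<in>insert r R. \<beta> r * a r l z))"
    using insert C by (intro sheaf.cls_eqI sheaf.cadd_cocycles sheaf.cscale_cocycles cech_cocycle group_cocycle_sum)
       (auto simp: sheaf.snd_cadd sheaf.snd_cscale cech_def)
  finally show ?case .
qed

text \<open>Infinitely many vectors in a finite dimensional space satisfy a non-trivial relation; it
  says that a combined cocycle has class zero and thus a primitive.\<close>

lemma fin_dim_H1_imp_coboundary:
  assumes fd: "vectorspace.fin_dim class_ring H1" and a: "\<And>r::nat. group_cocycle (a r)"
  obtains R \<beta> f r where "finite R" "r \<in> R" "\<beta> r \<noteq> 0" "holomorphic_Cn f \<Omega>"
    "\<And>l z. l \<in> \<Lambda> \<Longrightarrow> z \<in> \<Omega> \<Longrightarrow> f (z + l) - f z = (\<Sum>r\<in>R. \<beta> r * a r l z)"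
proof -
  interpret V: vectorspace class_ring H1
    by (rule sheaf.vectorspace_cech_H1[OF openin_domain])
  define v where "v r = sheaf.cls U (cech (a r))" for r
  have v: "v r \<in> carrier H1" for r
    using a by (auto simp: v_def sheaf.carrier_cech_H1 intro: cech_cocycle)
  have "\<exists>R \<beta> r. finite R \<and> r \<in> R \<and> \<beta> r \<noteq> 0 \<and> (\<Oplus>\<^bsub>H1\<^esub>r\<in>R. \<beta> r \<odot>\<^bsub>H1\<^esub> v r) = \<zero>\<^bsub>H1\<^esub>"
  \<comment> \<open>Linear dependence concerns sets, so repeated values of \<open>v\<close> are
    treated apart: without repetition \<open>dim + 1\<close> vectors are dependent, and otherwise
    the difference of two equal vectors is a relation.\<close>
  proof (cases "inj_on v {..V.dim}")
    case True
    have "\<not> V.lin_indpt (v ` {..V.dim})"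
    proof
      assume "V.lin_indpt (v ` {..V.dim})"
      then have "card (v ` {..V.dim}) \<le> V.dim"
        using V.li_le_dim(2)[OF fd] v by blast
      then show False by (simp add: card_image True)
    qed
    then obtain A c u where A: "finite A" "A \<subseteq> v ` {..V.dim}" "V.lincomb c A = \<zero>\<^bsub>H1\<^esub>" "u \<in> A" "c u \<noteq> 0"
      unfolding V.lin_dep_def by (auto simp: class_ring_simps)
    define R where "R = {r. r \<le> V.dim \<and> v r \<in> A}"
    have R: "finite R" "A = v ` R" "inj_on v R"
      using A(2) True by (auto simp: R_def inj_on_def)
    have "(\<Oplus>\<^bsub>H1\<^esub>r\<in>R. c (v r) \<odot>\<^bsub>H1\<^esub> v r) = V.lincomb c A"
      unfolding V.lincomb_def R(2) using R(3) v
      by (subst V.finsum_reindex) (auto simp: class_ring_simps)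
    then show ?thesis
      using A R by (intro exI[of _ R] exI[of _ "\<lambda>r. c (v r)"]) auto
  next
    case False
    then obtain r s where rs: "r \<noteq> s" "v r = v s" by (auto simp: inj_on_def)
    define \<beta> where "\<beta> i = (if i = r then 1 else - 1 :: complex)" for i
    have 1: "\<beta> i \<odot>\<^bsub>H1\<^esub> v i \<in> carrier H1" for i
      using v by (intro V.smult_closed) (simp_all add: class_ring_simps)
    have 2: "(\<Oplus>\<^bsub>H1\<^esub>i\<in>{s}. \<beta> i \<odot>\<^bsub>H1\<^esub> v i) = \<beta> s \<odot>\<^bsub>H1\<^esub> v s"
      using 1 by (subst V.finsum_insert) (auto intro!: V.r_zero)
    have 3: "(\<Oplus>\<^bsub>H1\<^esub>i\<in>{r,s}. \<beta> i \<odot>\<^bsub>H1\<^esub> v i) = \<beta> r \<odot>\<^bsub>H1\<^esub> v r \<oplus>\<^bsub>H1\<^esub> \<beta> s \<odot>\<^bsub>H1\<^esub> v s"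
      unfolding 2[symmetric] using 1 rs(1) by (subst V.finsum_insert) auto
    have 4: "(\<beta> r \<oplus>\<^bsub>class_ring\<^esub> \<beta> s) \<odot>\<^bsub>H1\<^esub> v s = \<beta> r \<odot>\<^bsub>H1\<^esub> v s \<oplus>\<^bsub>H1\<^esub> \<beta> s \<odot>\<^bsub>H1\<^esub> v s"
      using v by (intro V.smult_l_distr) (simp_all add: class_ring_simps)
    have 5: "\<beta> r \<oplus>\<^bsub>class_ring\<^esub> \<beta> s = \<zero>\<^bsub>class_ring\<^esub>"
      using rs(1) by (simp add: \<beta>_def class_ring_simps)
    have 6: "\<zero>\<^bsub>class_ring\<^esub> \<odot>\<^bsub>H1\<^esub> v s = \<zero>\<^bsub>H1\<^esub>"
      using v by (rule V.lmult_0)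
    have "(\<Oplus>\<^bsub>H1\<^esub>i\<in>{r,s}. \<beta> i \<odot>\<^bsub>H1\<^esub> v i) = \<zero>\<^bsub>H1\<^esub>"
      unfolding 3 rs(2) 4[symmetric] 5 6 by (rule refl)
    moreover have "finite {r, s}" "r \<in> {r, s}" "\<beta> r \<noteq> 0" by (simp_all add: \<beta>_def)
    ultimately show ?thesis by (intro exI conjI)
  qed
  then obtain R \<beta> r where R: "finite R" "r \<in> R" "\<beta> r \<noteq> 0" "(\<Oplus>\<^bsub>H1\<^esub>r\<in>R. \<beta> r \<odot>\<^bsub>H1\<^esub> v r) = \<zero>\<^bsub>H1\<^esub>"
    by (elim exE conjE) (rule that)
  have "sheaf.cls U (cech (\<lambda>l z. \<Sum>r\<in>R. \<beta> r * a r l z)) = \<zero>\<^bsub>H1\<^esub>"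
    using R(4) cech_class_sum[OF R(1), of a \<beta>] a by (simp add: v_def)
  then obtain f where "holomorphic_Cn f \<Omega>"
    "\<And>l z. l \<in> \<Lambda> \<Longrightarrow> z \<in> \<Omega> \<Longrightarrow> f (z + l) - f z = (\<Sum>r\<in>R. \<beta> r * a r l z)"
    using cech_class_zero[OF group_cocycle_sum[of R a \<beta>]] a by blast
  with R(1-3) show ?thesis by (rule that)
qed

end

section \<open>Resonant series\<close>

text \<open>A summable bound makes the series of derivatives converge uniformly, which permits
  termwise differentiation on a convex set; complex homogeneity passes to the sum.\<close>

lemma holomorphic_Cn_suminf:
  fixes f :: "nat \<Rightarrow> complex^'n \<Rightarrow> complex"
  assumes S: "open S" "convex S"
    and deriv: "\<And>j z. z \<in> S \<Longrightarrow> (f j has_derivative f' j z) (at z)"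
    and lin: "\<And>j z c v. z \<in> S \<Longrightarrow> f' j z (c *s v) = c * f' j z v"
    and bound: "\<And>j z v. z \<in> S \<Longrightarrow> norm (f' j z v) \<le> M j * norm v" and M: "summable M"
    and conv: "\<And>z. z \<in> S \<Longrightarrow> summable (\<lambda>j. f j z)"
  shows "holomorphic_Cn (\<lambda>z. \<Sum>j. f j z) S"
  unfolding holomorphic_Cn_def
proof
  fix z assume z: "z \<in> S"
  define g' where "g' z v = (\<Sum>j. f' j z v)" for z v
  have summ: "summable (\<lambda>j. f' j z v)" if "z \<in> S" for z v
    by (rule summable_comparison_test'[where N = 0, OF summable_mult2[OF M, of "norm v"]])
      (use bound[OF that] in auto)
  have "\<exists>g. \<forall>x\<in>S. (\<lambda>n. f n x) sums g x \<and> (g has_derivative g' x) (at x within S)"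
  proof (rule has_derivative_series[OF S(2) _ _ z])
    show "(f n has_derivative f' n x) (at x within S)" if "x \<in> S" for n x
      using deriv[OF that] by (rule has_derivative_at_withinI)
    show "(\<lambda>n. f n z) sums (\<Sum>j. f j z)" using conv[OF z] by (rule summable_sums)
    fix e :: real assume "e > 0"
    have M0: "(\<lambda>n. \<Sum>j. M (j + n)) \<longlonglongrightarrow> 0"
      using suminf_exist_split2[OF M] .
    have "\<forall>\<^sub>F n in sequentially. (\<Sum>j. M (j + n)) < e"
      using order_tendstoD(2)[OF M0 \<open>e > 0\<close>] .
    then show "\<forall>\<^sub>F n in sequentially. \<forall>x\<in>S. \<forall>h. norm (sum (\<lambda>i. f' i x h) {..<n} - g' x h) \<le> e * norm h"
    proof eventually_elim
      case (elim n)
      show ?case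
      proof (intro ballI allI)
        fix x h assume x: "x \<in> S"
        have "g' x h = (\<Sum>j. f' (j + n) x h) + (\<Sum>i<n. f' i x h)"
          unfolding g'_def by (rule suminf_split_initial_segment[OF summ[OF x]])
        then have "norm (sum (\<lambda>i. f' i x h) {..<n} - g' x h) = norm (\<Sum>j. f' (j + n) x h)"
          by simp
        also have "\<dots> \<le> (\<Sum>j. M (j + n) * norm h)"
          using bound[OF x] summable_ignore_initial_segment[OF summable_mult2[OF M, of "norm h"], of n]
          by (intro norm_suminf_le) auto
        also have "\<dots> = (\<Sum>j. M (j + n)) * norm h"
          by (rule suminf_mult2[symmetric]) (rule summable_ignore_initial_segment[OF M])
        also have "\<dots> \<le> e * norm h"
          using elim by (intro mult_right_mono) auto
        finally show "norm (sum (\<lambda>i. f' i x h) {..<n} - g' x h) \<le> e * norm h" .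
      qed
    qed
  qed
  then obtain g where g: "\<And>x. x \<in> S \<Longrightarrow> (\<lambda>n. f n x) sums g x"
    "\<And>x. x \<in> S \<Longrightarrow> (g has_derivative g' x) (at x within S)"
    by auto
  have "(g has_derivative g' z) (at z)"
    using g(2)[OF z] at_within_open[OF z S(1)] by simp
  then have "((\<lambda>z. \<Sum>j. f j z) has_derivative g' z) (at z)"
    by (rule has_derivative_transform_within_open[OF _ S(1) z]) (use g(1) in \<open>simp add: sums_iff\<close>)
  moreover have "g' z (c *s v) = c * g' z v" for c v
    unfolding g'_def lin[OF z] by (rule suminf_mult[OF summ[OF z]])
  ultimately show "\<exists>f'. ((\<lambda>z. \<Sum>j. f j z) has_derivative f') (at z) \<and> (\<forall>c v. f' (c *s v) = c * f' v)"
    by (intro exI[of _ "g' z"]) simp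
qed

lemma norm_exp_2pi_i_minus_1: "norm (exp (2 * of_real pi * \<i> * of_real t) - 1) = 2 * \<bar>sin (pi * t)\<bar>"
  using dist_exp_i_1[of "2 * pi * t"] by (simp add: dist_norm mult.commute mult.left_commute)

lemma norm_exp_2pi_i_minus_1_le: "norm (exp (2 * of_real pi * \<i> * of_real t) - 1) \<le> 2 * pi * \<bar>t\<bar>"
  unfolding norm_exp_2pi_i_minus_1 using abs_sin_x_le_abs_x[of "pi * t"] by (simp add: abs_mult)

text \<open>\<open>\<eta> j\<close> is the maximum norm of \<open>\<^sup>t\<sigma>\<^sub>j R + \<^sup>t\<tau>\<^sub>j\<close>, and \<open>a = exp (- 2 \<pi> \<rho>)\<close>.\<close>

locale resonant_sequence = adapted_basis \<Lambda> m d p x w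
  for \<Lambda> :: "(complex^'n) set" and m d p x w +
  fixes \<sigma> \<tau> :: "nat \<Rightarrow> nat \<Rightarrow> int" and \<eta> :: "nat \<Rightarrow> real" and \<rho> :: real
  assumes rho_pos: "0 < \<rho>" and eta_pos: "0 < \<eta> j"
    and eta_bound: "k < 2 * m \<Longrightarrow> \<bar>(\<Sum>i<d. of_int (\<sigma> j i) * Re (w i (p (d + k)))) + of_int (\<tau> j k)\<bar> \<le> \<eta> j"
    and eta_attained: "\<exists>k<2 * m. \<bar>(\<Sum>i<d. of_int (\<sigma> j i) * Re (w i (p (d + k)))) + of_int (\<tau> j k)\<bar> = \<eta> j"
    and eta_0: "\<eta> 0 \<le> exp (- 2 * pi * \<rho> * (\<Sum>i<d. \<bar>of_int (\<sigma> 0 i)\<bar>)) / 100"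
    and eta_Suc: "\<eta> (Suc j) \<le> \<eta> j / 100 * exp (- 2 * pi * \<rho> * (\<Sum>i<d. \<bar>of_int (\<sigma> (Suc j) i)\<bar>))"
begin

section \<open>Terms of the resonant series and their convergence\<close>

definition size_\<sigma> :: "nat \<Rightarrow> real" where
  "size_\<sigma> j = (\<Sum>i<d. \<bar>of_int (\<sigma> j i)\<bar>)"

text \<open>The value of \<open>freq j\<close> at the column \<open>p (d + k)\<close>, shifted by
  the integer \<open>\<tau> j k\<close> and thereby made small.\<close>

definition \<delta> :: "nat \<Rightarrow> nat \<Rightarrow> real" where
  "\<delta> j k = (\<Sum>i<d. of_int (\<sigma> j i) * Re (w i (p (d + k)))) + of_int (\<tau> j k)"

definition freq :: "nat \<Rightarrow> complex^'n \<Rightarrow> complex" where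
  "freq j z = (\<Sum>i<d. of_int (\<sigma> j i) * w i z)"

definition e :: "nat \<Rightarrow> complex^'n \<Rightarrow> complex" where
  "e j z = exp (2 * of_real pi * \<i> * freq j z)"

definition \<Omega> :: "(complex^'n) set" where
  "\<Omega> = {z. \<forall>i<d. \<bar>Im (w i z)\<bar> < \<rho>}"

text \<open>The real span of \<open>\<Lambda>\<close>, on which every \<open>e j\<close> has modulus
  one.\<close>

definition W :: "(complex^'n) set" where
  "W = {z. \<forall>i<d. Im (w i z) = 0}"

text \<open>The difference under translation by \<open>l\<close> of the formal series with terms
  \<open>\<theta> j * 10 ^ j * e j z\<close>, taken term by term so that the series itself need not
  converge.\<close>

definition summand :: "(nat \<Rightarrow> complex) \<Rightarrow> complex^'n \<Rightarrow> complex^'n \<Rightarrow> complex" where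
  "summand \<theta> l z = (\<Sum>j. \<theta> j * 10 ^ j * (e j l - 1) * e j z)"

lemma size_nonneg: "0 \<le> size_\<sigma> j"
  unfolding size_\<sigma>_def by (intro sum_nonneg) simp

lemma eta_decay: "j \<le> i \<Longrightarrow> \<eta> i \<le> \<eta> j * (1/100) ^ (i - j)"
proof (induction i rule: dec_induct)
  case (step i)
  have "exp (- 2 * pi * \<rho> * size_\<sigma> (Suc i)) \<le> 1"
    using rho_pos size_nonneg by simp
  then have "\<eta> i / 100 * exp (- 2 * pi * \<rho> * size_\<sigma> (Suc i)) \<le> \<eta> i / 100 * 1"
    using eta_pos[of i] by (intro mult_left_mono) auto
  then have "\<eta> (Suc i) \<le> \<eta> i / 100"
    using eta_Suc[of i, folded size_\<sigma>_def] by linarith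
  moreover have "\<eta> j * (1/100) ^ (Suc i - j) = \<eta> j * (1/100) ^ (i - j) / 100"
    using step.hyps by (simp add: Suc_diff_le)
  ultimately show ?case using step.IH by linarith
qed simp

text \<open>The geometric factor will absorb the coefficients \<open>10 ^ j\<close>, the exponential
  one the growth of \<open>e j\<close> on \<open>\<Omega>\<close>.\<close>

lemma eta_le: "\<eta> j \<le> (1/100) ^ Suc j * exp (- 2 * pi * \<rho> * size_\<sigma> j)"
proof (cases j)
  case 0
  then show ?thesis using eta_0 by (simp add: size_\<sigma>_def)
next
  case (Suc i)
  have "exp (- 2 * pi * \<rho> * size_\<sigma> 0) \<le> 1" using rho_pos size_nonneg by simp
  then have "\<eta> 0 \<le> 1 / 100" using eta_0[folded size_\<sigma>_def] by linarith
  then have "\<eta> 0 * (1/100) ^ i \<le> 1 / 100 * (1/100) ^ i"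
    by (intro mult_right_mono) auto
  moreover have "\<eta> i \<le> \<eta> 0 * (1/100) ^ i" using eta_decay[of 0 i] by simp
  ultimately have "\<eta> i \<le> (1/100) ^ Suc i" unfolding power_Suc by linarith
  then have "\<eta> i / 100 * exp (- 2 * pi * \<rho> * size_\<sigma> j) \<le> (1/100) ^ Suc i / 100 * exp (- 2 * pi * \<rho> * size_\<sigma> j)"
    by (intro mult_right_mono) auto
  then show ?thesis
    using eta_Suc[of i, folded size_\<sigma>_def Suc] unfolding Suc power_Suc by linarith
qed

lemma eta_le_100: "\<eta> j \<le> (1/100) ^ Suc j"
proof -
  have "exp (- 2 * pi * \<rho> * size_\<sigma> j) \<le> 1" using rho_pos size_nonneg by simp
  then have "(1/100) ^ Suc j * exp (- 2 * pi * \<rho> * size_\<sigma> j) \<le> (1/100) ^ Suc j * 1"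
    by (intro mult_left_mono) auto
  with eta_le[of j] show ?thesis by linarith
qed

lemma freq_linear: "complex_linear (freq j)"
  unfolding complex_linear_def
proof (intro conjI allI)
  show "freq j (y + z) = freq j y + freq j z" for y z
    by (simp add: freq_def complex_linear_add[OF w_linear] distrib_left sum.distrib)
  show "freq j (c *s z) = c * freq j z" for c z
    by (simp add: freq_def complex_linear_scale[OF w_linear] sum_distrib_left mult.left_commute)
qed

lemma e_add: "e j (y + z) = e j y * e j z"
  by (simp add: e_def complex_linear_add[OF freq_linear] distrib_left exp_add)

lemma e_0 [simp]: "e j 0 = 1"
  by (simp add: e_def complex_linear_simps[OF freq_linear])

lemma norm_e: "norm (e j z) = exp (- 2 * pi * Im (freq j z))"
  by (simp add: e_def)

lemma Im_freq: "Im (freq j z) = (\<Sum>i<d. of_int (\<sigma> j i) * Im (w i z))"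
  by (simp add: freq_def Im_sum)

lemma norm_e_W: "z \<in> W \<Longrightarrow> norm (e j z) = 1"
  by (simp add: norm_e Im_freq W_def)

lemma norm_e_le:
  assumes "\<And>i. i < d \<Longrightarrow> \<bar>Im (w i z)\<bar> \<le> r"
  shows "norm (e j z) \<le> exp (2 * pi * size_\<sigma> j * r)"
proof -
  have "\<bar>Im (freq j z)\<bar> \<le> (\<Sum>i<d. \<bar>of_int (\<sigma> j i) * Im (w i z)\<bar>)"
    unfolding Im_freq by (rule sum_abs)
  also have "\<dots> \<le> (\<Sum>i<d. \<bar>of_int (\<sigma> j i)\<bar> * r)"
    using assms by (intro sum_mono) (simp add: abs_mult mult_left_mono)
  also have "\<dots> = size_\<sigma> j * r" by (simp add: size_\<sigma>_def sum_distrib_right)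
  finally have "- Im (freq j z) \<le> size_\<sigma> j * r" by linarith
  then have "2 * pi * (- Im (freq j z)) \<le> 2 * pi * (size_\<sigma> j * r)"
    by (intro mult_left_mono) auto
  moreover have "- 2 * pi * Im (freq j z) = 2 * pi * (- Im (freq j z))" by simp
  ultimately show ?thesis
    unfolding norm_e exp_le_cancel_iff mult.assoc[of "2 * pi" "size_\<sigma> j"] by linarith
qed

lemma d_le_card: "d + 2 * m = CARD('n) + m"
  using dim by simp

lemma freq_p_lt:
  assumes "c < d"
  shows "freq j (p c) = of_int (\<sigma> j c)"
proof -
  have "freq j (p c) = (\<Sum>i<d. of_int (\<sigma> j i) * (if i = c then 1 else 0))"
    unfolding freq_def using assms by (intro sum.cong) (auto simp: w_p)
  also have "\<dots> = of_int (\<sigma> j c)" using assms by (simp add: if_distrib cong: if_cong)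
  finally show ?thesis .
qed

lemma exp_2pi_i_int [simp]: "exp (2 * of_real pi * \<i> * of_int N) = (1::complex)"
  using exp_eq_1[of "2 * of_real pi * \<i> * of_int N"] by (auto intro!: exI[of _ N])

text \<open>Modulo integers, \<open>freq j\<close> is of order \<open>\<eta> j\<close> on the lattice.\<close>

lemma norm_e_lattice:
  assumes l: "l = (\<Sum>c<CARD('n) + m. of_int (k c) *\<^sub>R p c)"
  shows "norm (e j l - 1) \<le> 2 * pi * \<eta> j * (\<Sum>c<CARD('n) + m. \<bar>of_int (k c)\<bar>)"
proof -
  have freq_p: "freq j (p c) = of_real (\<Sum>i<d. of_int (\<sigma> j i) * Re (w i (p c)))" if "c < CARD('n) + m" for c
    unfolding freq_def of_real_sum
  proof (intro sum.cong refl)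
    fix i assume "i \<in> {..<d}"
    then have "i < d" by simp
    then have "w i (p c) = of_real (Re (w i (p c)))" using that by (rule w_p_real)
    from arg_cong[OF this, of "(*) (of_int (\<sigma> j i))"]
    show "of_int (\<sigma> j i) * w i (p c) = of_real (of_int (\<sigma> j i) * Re (w i (p c)))"
      unfolding of_real_mult of_real_of_int_eq .
  qed
  \<comment> \<open>The frequency at \<open>l\<close> is the integer \<open>N\<close> plus a real
    number \<open>r\<close> of order \<open>\<eta> j\<close>; the exponential sees only
    \<open>r\<close>.\<close>
  define r where "r = (\<Sum>k'<2 * m. of_int (k (d + k')) * \<delta> j k')"
  define N where "N = (\<Sum>c<d. k c * \<sigma> j c) - (\<Sum>k'<2 * m. k (d + k') * \<tau> j k')"
  have "freq j l = (\<Sum>c<d + 2 * m. of_int (k c) * freq j (p c))"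
    unfolding l d_le_card by (simp add: complex_linear_simps[OF freq_linear])
  also have "\<dots> = (\<Sum>c<d. of_int (k c) * freq j (p c)) + (\<Sum>k'<2 * m. of_int (k (d + k')) * freq j (p (d + k')))"
    by (rule sum_lessThan_add)
  also have "(\<Sum>c<d. of_int (k c) * freq j (p c)) = (\<Sum>c<d. of_int (k c * \<sigma> j c))"
    by (intro sum.cong) (simp_all add: freq_p_lt)
  also have "(\<Sum>k'<2 * m. of_int (k (d + k')) * freq j (p (d + k')))
      = (\<Sum>k'<2 * m. of_real (of_int (k (d + k')) * \<delta> j k') - of_int (k (d + k') * \<tau> j k'))"
    by (intro sum.cong refl) (use dim in \<open>simp add: freq_p \<delta>_def algebra_simps\<close>)
  finally have "freq j l = of_real r + of_int N"
    by (simp add: r_def N_def sum_subtractf)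
  then have "e j l = exp (2 * of_real pi * \<i> * of_real r) * exp (2 * of_real pi * \<i> * of_int N)"
    by (simp add: e_def distrib_left exp_add)
  also have "exp (2 * of_real pi * \<i> * of_int N) = (1::complex)"
    by (rule exp_2pi_i_int)
  finally have "norm (e j l - 1) \<le> 2 * pi * \<bar>r\<bar>"
    using norm_exp_2pi_i_minus_1_le[of r] by simp
  also have "\<bar>r\<bar> \<le> (\<Sum>k'<2 * m. \<bar>of_int (k (d + k'))\<bar> * \<eta> j)"
    unfolding r_def using eta_bound[of _ j]
    by (intro order_trans[OF sum_abs] sum_mono) (simp add: abs_mult \<delta>_def mult_left_mono)
  also have "\<dots> \<le> (\<Sum>c<d. \<bar>of_int (k c)\<bar> * \<eta> j) + (\<Sum>k'<2 * m. \<bar>of_int (k (d + k'))\<bar> * \<eta> j)"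
    using eta_pos[of j] by (simp add: sum_nonneg)
  also have "\<dots> = (\<Sum>c<CARD('n) + m. \<bar>of_int (k c)\<bar> * \<eta> j)"
    unfolding d_le_card[symmetric] by (rule sum_lessThan_add[symmetric])
  also have "\<dots> = \<eta> j * (\<Sum>c<CARD('n) + m. \<bar>of_int (k c)\<bar>)"
    by (simp add: sum_distrib_left mult.commute)
  finally show ?thesis by (simp add: mult_left_mono mult.assoc)
qed

text \<open>The constant depends on \<open>l\<close> but not on \<open>j\<close>: for fixed
  \<open>l\<close> the small factors decay like \<open>\<eta>\<close>.\<close>

lemma lattice_coefficients:
  assumes "l \<in> \<Lambda>"
  obtains K where "0 \<le> K" "\<And>j. norm (e j l - 1) \<le> K * \<eta> j"
proof -
  obtain k where k: "l = (\<Sum>c<CARD('n) + m. of_int (k c) *\<^sub>R p c)"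
    using assms unfolding lattice by (rule rangeE)
  show ?thesis
  proof (rule that[of "2 * pi * (\<Sum>c<CARD('n) + m. \<bar>of_int (k c)\<bar>)"])
    show "norm (e j l - 1) \<le> 2 * pi * (\<Sum>c<CARD('n) + m. \<bar>of_int (k c)\<bar>) * \<eta> j" for j
      using norm_e_lattice[OF k, of j] by (simp only: mult_ac)
  qed (auto intro: sum_nonneg)
qed

lemma geometric_10: "(10::real) ^ j * (1/100) ^ j = (1/10) ^ j"
  by (simp add: power_mult_distrib[symmetric])

text \<open>The powers of 10 and 1/100 leave geometric decay. On the tube of half-width
  \<open>r\<close> the smallness of \<open>\<eta> j\<close> beats the growth of \<open>e j\<close>
  by a factor exponential in \<open>(\<rho> - r) * size_\<sigma> j\<close>; for
  \<open>r < \<rho>\<close> this surplus pays for a derivative.\<close>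

lemma term_bound:
  assumes \<theta>: "\<And>j. norm (\<theta> j) \<le> \<Theta>" and K: "norm (e j l - 1) \<le> K * \<eta> j" "0 \<le> K"
    and z: "\<And>i. i < d \<Longrightarrow> \<bar>Im (w i z)\<bar> \<le> r"
  shows "norm (\<theta> j * 10 ^ j * (e j l - 1) * e j z)
    \<le> \<Theta> * K * (1/10) ^ j * exp (- 2 * pi * (\<rho> - r) * size_\<sigma> j)"
proof -
  have \<Theta>: "0 \<le> \<Theta>" using \<theta>[of j] norm_ge_zero order_trans by blast
  have "norm (\<theta> j * 10 ^ j * (e j l - 1) * e j z) = norm (\<theta> j) * (10 ^ j * (norm (e j l - 1) * norm (e j z)))"
    by (simp add: norm_mult norm_power)
  also have "\<dots> \<le> \<Theta> * (10 ^ j * ((K * ((1/100) ^ Suc j * exp (- 2 * pi * \<rho> * size_\<sigma> j))) * exp (2 * pi * size_\<sigma> j * r)))"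
  proof (intro mult_mono)
    show "norm (e j l - 1) \<le> K * ((1/100) ^ Suc j * exp (- 2 * pi * \<rho> * size_\<sigma> j))"
      by (rule order_trans[OF K(1)]) (intro mult_left_mono eta_le K(2))
  qed (use \<theta> \<Theta> K(2) norm_e_le[OF z] in auto)
  also have "\<dots> = \<Theta> * K * (10 ^ j * (1/100) ^ Suc j) * (exp (- 2 * pi * \<rho> * size_\<sigma> j) * exp (2 * pi * size_\<sigma> j * r))"
    by (simp only: mult_ac)
  also have "exp (- 2 * pi * \<rho> * size_\<sigma> j) * exp (2 * pi * size_\<sigma> j * r) = exp (- 2 * pi * (\<rho> - r) * size_\<sigma> j)"
    by (simp add: exp_add[symmetric] algebra_simps)
  also have "\<Theta> * K * (10 ^ j * (1/100) ^ Suc j) \<le> \<Theta> * K * (1/10) ^ j"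
    using \<Theta> K(2) geometric_10[of j] by (intro mult_left_mono) auto
  finally show ?thesis by (simp add: mult_right_mono)
qed

lemma Omega_margin:
  assumes "z \<in> \<Omega>"
  obtains r where "r < \<rho>" "0 < r" "\<And>i. i < d \<Longrightarrow> \<bar>Im (w i z)\<bar> < r"
proof -
  \<comment> \<open>Including 0 keeps the set non-empty when \<open>d = 0\<close>; the radius
    supplied is the midpoint between \<open>M\<close> and \<open>\<rho>\<close>.\<close>
  define M where "M = Max (insert 0 ((\<lambda>i. \<bar>Im (w i z)\<bar>) ` {..<d}))"
  have "M < \<rho>" using assms rho_pos unfolding M_def \<Omega>_def by (subst Max_less_iff) auto
  moreover have M: "0 \<le> M" "\<And>i. i < d \<Longrightarrow> \<bar>Im (w i z)\<bar> \<le> M"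
    unfolding M_def by (auto intro!: Max_ge)
  ultimately show ?thesis
    using rho_pos by (intro that[of "(M + \<rho>) / 2"]) (use M(2) in fastforce)+
qed

text \<open>\<open>term_bound\<close> applies with \<open>r = \<rho>\<close>, where its exponential
  factor is 1 and the geometric factor remains.\<close>

lemma summable_summand:
  assumes \<theta>: "\<And>j. norm (\<theta> j) \<le> \<Theta>" and l: "l \<in> \<Lambda>" and z: "z \<in> \<Omega>"
  shows "summable (\<lambda>j. \<theta> j * 10 ^ j * (e j l - 1) * e j z)"
proof -
  obtain K where K: "0 \<le> K" "\<And>j. norm (e j l - 1) \<le> K * \<eta> j" by (rule lattice_coefficients[OF l]) (rule that)
  have \<Theta>: "0 \<le> \<Theta>" using \<theta>[of 0] norm_ge_zero order_trans by blast
  have z: "\<And>i. i < d \<Longrightarrow> \<bar>Im (w i z)\<bar> \<le> \<rho>" using z by (auto simp: \<Omega>_def)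
  show ?thesis
  proof (rule summable_comparison_test'[where N = 0])
    show "summable (\<lambda>j. \<Theta> * K * (1/10) ^ j)" by (intro summable_mult summable_geometric) simp
    show "norm (\<theta> j * 10 ^ j * (e j l - 1) * e j z) \<le> \<Theta> * K * (1/10) ^ j" for j
      using term_bound[OF \<theta> K(2)[of j] K(1) z] by simp
  qed
qed

lemma exists_w_bound: "\<exists>C. 0 < C \<and> (\<forall>i<d. \<forall>z. norm (w i z) \<le> C * norm z)"
proof -
  have bl: "bounded_linear (w i)" if "i < d" for i
    using complex_linear_linear[OF w_linear[OF that]] by (simp add: linear_conv_bounded_linear)
  define C where "C = (\<Sum>i<d. onorm (w i)) + 1"
  have pos: "0 \<le> onorm (w i)" if "i < d" for i using onorm_pos_le[OF bl[OF that]] .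
  have "0 \<le> (\<Sum>i<d. onorm (w i))" using pos by (intro sum_nonneg) simp
  moreover have "norm (w i z) \<le> C * norm z" if "i < d" for i z
  proof -
    have "onorm (w i) \<le> (\<Sum>i<d. onorm (w i))" using that pos by (intro member_le_sum) auto
    then have "onorm (w i) * norm z \<le> C * norm z" unfolding C_def by (intro mult_right_mono) auto
    with onorm[OF bl[OF that], of z] show ?thesis by simp
  qed
  ultimately show ?thesis by (intro exI[of _ C]) (auto simp: C_def)
qed

lemma continuous_w: "i < d \<Longrightarrow> continuous_on A (w i)"
  using complex_linear_linear[OF w_linear] by (intro linear_continuous_on) (simp add: linear_conv_bounded_linear)

definition strip :: "real \<Rightarrow> (complex^'n) set" where
  "strip r = {z. \<forall>i<d. \<bar>Im (w i z)\<bar> < r}"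

lemma open_strip: "open (strip r)"
proof -
  have eq: "strip r = (\<Inter>i\<in>{..<d}. {z. \<bar>Im (w i z)\<bar> < r})" by (auto simp: strip_def)
  show ?thesis unfolding eq
    by (intro open_INT finite_lessThan ballI open_Collect_less continuous_intros continuous_w) auto
qed

lemma convex_strip: "convex (strip r)"
  unfolding convex_alt
proof (intro ballI allI impI)
  fix y z and u :: real assume yz: "y \<in> strip r" "z \<in> strip r" and u: "0 \<le> u \<and> u \<le> 1"
  show "(1 - u) *\<^sub>R y + u *\<^sub>R z \<in> strip r"
    unfolding strip_def
  proof (intro CollectI allI impI)
    fix i assume i: "i < d"
    have "Im (w i ((1 - u) *\<^sub>R y + u *\<^sub>R z)) = (1 - u) * Im (w i y) + u * Im (w i z)"
      by (simp add: complex_linear_simps[OF w_linear[OF i]] complex_linear_add[OF w_linear[OF i]])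
    moreover have "(1 - u) * Im (w i y) + u * Im (w i z) \<in> {-r<..<r}"
      using yz i u convex_alt[of "{-r<..<r}"] convex_real_interval(8)[of "-r" r]
      by (force simp: strip_def abs_less_iff)
    ultimately show "\<bar>Im (w i ((1 - u) *\<^sub>R y + u *\<^sub>R z))\<bar> < r" by auto
  qed
qed

lemma Omega_strip: "\<Omega> = strip \<rho>"
  by (simp add: \<Omega>_def strip_def)

text \<open>Differentiating \<open>e j\<close> costs a factor \<open>size_\<sigma> j\<close>, for
  which \<open>term_bound\<close> leaves no room at \<open>r = \<rho>\<close>. Near a given point
  there is a margin \<open>\<rho> - r\<close>, and the surplus exponential decay absorbs the
  factor.\<close>

lemma holomorphic_summand:
  assumes \<theta>: "\<And>j. norm (\<theta> j) \<le> \<Theta>" and l: "l \<in> \<Lambda>"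
  shows "holomorphic_Cn (summand \<theta> l) \<Omega>"
proof (rule holomorphic_Cn_local)
  fix z assume z: "z \<in> \<Omega>"
  obtain r where r: "r < \<rho>" "0 < r" "\<And>i. i < d \<Longrightarrow> \<bar>Im (w i z)\<bar> < r" by (rule Omega_margin[OF z]) (rule that)
  obtain K where K: "0 \<le> K" "\<And>j. norm (e j l - 1) \<le> K * \<eta> j" by (rule lattice_coefficients[OF l]) (rule that)
  obtain C where C: "0 < C" "\<And>i z. i < d \<Longrightarrow> norm (w i z) \<le> C * norm z" using exists_w_bound by auto
  have \<Theta>: "0 \<le> \<Theta>" using \<theta>[of 0] norm_ge_zero order_trans by blast
  have freq_bound: "norm (freq j v) \<le> size_\<sigma> j * C * norm v" for j v
  proof -
    have "norm (freq j v) \<le> (\<Sum>i<d. \<bar>of_int (\<sigma> j i)\<bar> * (C * norm v))"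
      unfolding freq_def using C(2) by (intro order_trans[OF norm_sum] sum_mono) (simp add: norm_mult mult_left_mono)
    then show ?thesis by (simp add: size_\<sigma>_def sum_distrib_right[symmetric] mult.assoc)
  qed
  define b where "b j = \<theta> j * 10 ^ j * (e j l - 1)" for j
  define f' where "f' j z v = b j * e j z * (2 * of_real pi * \<i> * freq j v)" for j z v
  \<comment> \<open>The denominator comes from \<open>exp (- s) * s \<le> 1\<close> with
    \<open>s = 2 * pi * (\<rho> - r) * size_\<sigma> j\<close>.\<close>
  define M where "M j = \<Theta> * K * C / (\<rho> - r) * (1/10) ^ j" for j
  have "holomorphic_Cn (\<lambda>z. \<Sum>j. b j * e j z) (strip r)"
  proof (rule holomorphic_Cn_suminf[OF open_strip convex_strip, where f' = f' and M = M])
    show "summable M" unfolding M_def by (intro summable_mult summable_geometric) simp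
    fix j and y :: "complex^'n" assume y: "y \<in> strip r"
    have "((\<lambda>z. b j * e j z) has_derivative (\<lambda>v. b j * (e j y * (2 * of_real pi * \<i> * freq j v)))) (at y)"
      unfolding e_def by (intro has_derivative_mult_right has_derivative_exp_complex_linear freq_linear)
    then show "((\<lambda>z. b j * e j z) has_derivative f' j y) (at y)"
      by (simp add: f'_def[abs_def] mult.assoc)
    show "f' j y (c *s v) = c * f' j y v" for c v
      by (simp add: f'_def complex_linear_scale[OF freq_linear])
    show "norm (f' j y v) \<le> M j * norm v" for v
    proof -
      define s where "s = 2 * pi * (\<rho> - r) * size_\<sigma> j"
      have 1: "norm (b j * e j y) \<le> \<Theta> * K * (1/10) ^ j * exp (- s)"
        using term_bound[OF \<theta> K(2)[of j] K(1), of y r] y by (simp add: b_def strip_def s_def less_imp_le)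
      have "s \<le> exp s" using exp_ge_add_one_self[of s] by linarith
      then have 2: "exp (- s) * s \<le> 1" by (simp add: exp_minus field_simps)
      have "norm (f' j y v) = norm (b j * e j y) * (2 * pi * norm (freq j v))"
        by (simp add: f'_def norm_mult)
      also have "\<dots> \<le> (\<Theta> * K * (1/10) ^ j * exp (- s)) * (2 * pi * (size_\<sigma> j * C * norm v))"
        using 1 freq_bound[of j v] \<Theta> K(1) by (intro mult_mono) auto
      also have "\<dots> = (\<Theta> * K * C / (\<rho> - r) * (1/10) ^ j * norm v) * (exp (- s) * s)"
        using r(1) by (simp add: s_def)
      also have "\<dots> \<le> (\<Theta> * K * C / (\<rho> - r) * (1/10) ^ j * norm v) * 1"
        using 2 \<Theta> K(1) C(1) r(1) by (intro mult_left_mono) auto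
      finally show ?thesis by (simp add: M_def)
    qed
    show "summable (\<lambda>j. b j * e j y)"
      unfolding b_def
      by (rule summable_summand[OF \<theta> l]) (use y r(1) in \<open>force simp: strip_def \<Omega>_def\<close>)
  qed
  moreover have "z \<in> strip r" using r(3) by (simp add: strip_def)
  ultimately show "\<exists>N g. open N \<and> z \<in> N \<and> holomorphic_Cn g {z} \<and> (\<forall>z'\<in>N. summand \<theta> l z' = g z')"
    by (intro exI[of _ "strip r"] exI[of _ "\<lambda>z. \<Sum>j. b j * e j z"] conjI open_strip)
      (auto simp: summand_def b_def elim: holomorphic_Cn_subset)
qed

lemma w_lattice: "l \<in> \<Lambda> \<Longrightarrow> i < d \<Longrightarrow> Im (w i l) = 0"
  unfolding lattice using Im_w_p by (auto simp: complex_linear_simps[OF w_linear] Im_sum)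

lemma strip_invariant: "z \<in> strip r \<Longrightarrow> l \<in> \<Lambda> \<Longrightarrow> z + l \<in> strip r"
  by (simp add: strip_def complex_linear_add[OF w_linear] w_lattice)

text \<open>The cocycle identity holds term by term because \<open>e j\<close> is multiplicative;
  convergence allows the terms to be summed.\<close>

lemma summand_add:
  assumes \<theta>: "\<And>j. norm (\<theta> j) \<le> \<Theta>" and kl: "k \<in> \<Lambda>" "l \<in> \<Lambda>" "z \<in> \<Omega>"
  shows "summand \<theta> (k + l) z = summand \<theta> k z + summand \<theta> l (z + k)"
proof -
  have "z + k \<in> \<Omega>" using kl strip_invariant by (simp add: Omega_strip)
  then have "summand \<theta> k z + summand \<theta> l (z + k)
      = (\<Sum>j. \<theta> j * 10 ^ j * (e j k - 1) * e j z + \<theta> j * 10 ^ j * (e j l - 1) * e j (z + k))"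
    unfolding summand_def using kl by (intro suminf_add summable_summand[OF \<theta>])
  also have "\<dots> = summand \<theta> (k + l) z"
    unfolding summand_def e_add by (rule arg_cong[where f = suminf]) (simp add: fun_eq_iff algebra_simps)
  finally show ?thesis by simp
qed

text \<open>The series is linear in its coefficients, so a finite combination of such cocycles is
  again a resonant series.\<close>

lemma summand_sum:
  assumes "finite R" and \<theta>: "\<And>r j. r \<in> R \<Longrightarrow> norm (\<theta> r j) \<le> \<Theta>" and l: "l \<in> \<Lambda>" and z: "z \<in> \<Omega>"
  shows "(\<Sum>r\<in>R. \<beta> r * summand (\<theta> r) l z) = summand (\<lambda>j. \<Sum>r\<in>R. \<beta> r * \<theta> r j) l z"
proof -
  have s: "summable (\<lambda>j. \<theta> r j * 10 ^ j * (e j l - 1) * e j z)" if "r \<in> R" for r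
    using \<theta>[OF that] l z by (rule summable_summand)
  have "(\<Sum>r\<in>R. \<beta> r * summand (\<theta> r) l z) = (\<Sum>r\<in>R. \<Sum>j. \<beta> r * (\<theta> r j * 10 ^ j * (e j l - 1) * e j z))"
    unfolding summand_def using s by (intro sum.cong refl suminf_mult[symmetric])
  also have "\<dots> = (\<Sum>j. \<Sum>r\<in>R. \<beta> r * (\<theta> r j * 10 ^ j * (e j l - 1) * e j z))"
    using s by (intro suminf_sum[symmetric] summable_mult)
  also have "\<dots> = summand (\<lambda>j. \<Sum>r\<in>R. \<beta> r * \<theta> r j) l z"
    unfolding summand_def sum_distrib_right mult.assoc by (rule refl)
  finally show ?thesis .
qed

end

section \<open>Growth of a holomorphic primitive on the real span of the lattice\<close>

context resonant_sequence
begin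

lemma W_subset_Omega: "W \<subseteq> \<Omega>"
  using rho_pos by (auto simp: W_def \<Omega>_def)

lemma closed_W: "closed W"
proof -
  have eq: "W = (\<Inter>i\<in>{..<d}. {z. Im (w i z) = 0})" by (auto simp: W_def)
  show ?thesis unfolding eq
    by (intro closed_INT ballI closed_Collect_eq continuous_intros continuous_w) auto
qed

lemma W_sum_p: "C \<subseteq> {..<CARD('n) + m} \<Longrightarrow> (\<Sum>c\<in>C. t c *\<^sub>R p c) \<in> W"
  using Im_w_p by (auto simp: W_def complex_linear_simps[OF w_linear] Im_sum intro!: sum.neutral)

lemma lattice_sum_p:
  assumes "C \<subseteq> {..<CARD('n) + m}"
  shows "(\<Sum>c\<in>C. of_int (k c) *\<^sub>R p c) \<in> \<Lambda>"
proof -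
  have "(\<Sum>c\<in>C. of_int (k c) *\<^sub>R p c) = (\<Sum>c<CARD('n) + m. of_int (if c \<in> C then k c else 0) *\<^sub>R p c)"
    using assms by (intro sum.mono_neutral_cong_left) auto
  then show ?thesis unfolding lattice
    by (rule range_eqI[of _ _ "\<lambda>c. if c \<in> C then k c else 0"])
qed

text \<open>A bound for the norm on the fundamental parallelotope spanned by the columns.\<close>

definition R :: real where
  "R = (\<Sum>c<CARD('n) + m. norm (p c))"

lemma frac_sum_p:
  assumes "C \<subseteq> {..<CARD('n) + m}"
  shows "norm (\<Sum>c\<in>C. frac (t c) *\<^sub>R p c) \<le> R"
proof -
  have "norm (\<Sum>c\<in>C. frac (t c) *\<^sub>R p c) \<le> (\<Sum>c\<in>C. norm (p c))"
    by (rule order_trans[OF norm_sum sum_mono]) (auto intro!: mult_left_le_one_le simp: frac_lt_1 less_imp_le)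
  also have "\<dots> \<le> R" unfolding R_def using assms by (intro sum_mono2) auto
  finally show ?thesis .
qed

lemma split_frac: "(\<Sum>c\<in>C. t c *\<^sub>R p c) = (\<Sum>c\<in>C. frac (t c) *\<^sub>R p c) + (\<Sum>c\<in>C. of_int \<lfloor>t c\<rfloor> *\<^sub>R p c)"
  by (simp add: sum.distrib[symmetric] frac_def scaleR_left_diff_distrib)

text \<open>The column \<open>p (d + k)\<close> with its \<open>w\<close> coordinates removed by a
  real combination of the \<open>p i\<close>. Complex multiples of \<open>V k\<close> preserve
  \<open>W\<close>, and all \<open>e j\<close> are constant along them, so Liouville's theorem can
  be used in this direction.\<close>

definition V :: "nat \<Rightarrow> complex^'n" where
  "V k = p (d + k) - (\<Sum>i<d. Re (w i (p (d + k))) *\<^sub>R p i)"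

lemma w_V:
  assumes "i < d" "k < 2 * m"
  shows "w i (V k) = 0"
proof -
  have "w i (V k) = w i (p (d + k)) - (\<Sum>j<d. of_real (Re (w j (p (d + k)))) * (if j = i then 1 else 0))"
    unfolding V_def complex_linear_simps[OF w_linear[OF assms(1)]] using assms
    by (intro arg_cong2[where f = minus] sum.cong refl) (simp add: w_p)
  also have "\<dots> = w i (p (d + k)) - of_real (Re (w i (p (d + k))))"
    using assms(1) by (simp add: if_distrib cong: if_cong)
  also have "w i (p (d + k)) = of_real (Re (w i (p (d + k))))"
    using assms dim by (intro w_p_real) auto
  finally show ?thesis by (simp only: Re_complex_of_real diff_self)
qed

lemma W_shift: "z \<in> W \<Longrightarrow> k < 2 * m \<Longrightarrow> z + s *s V k \<in> W"
  by (simp add: W_def complex_linear_add[OF w_linear] complex_linear_scale[OF w_linear] w_V)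

lemma e_shift: "k < 2 * m \<Longrightarrow> e j (z + s *s V k) = e j z"
  unfolding e_def freq_def
  by (simp add: complex_linear_add[OF w_linear] complex_linear_scale[OF w_linear] w_V)

lemma bounded_linear_scale_right: "bounded_linear (\<lambda>s. s *s (v :: complex^'n))"
  unfolding linear_conv_bounded_linear[symmetric]
  by (rule linearI) (simp_all add: vec.scale_left_distrib scaleR_eq_scale_of_real scaleR_conv_of_real[where 'a = complex])

text \<open>On \<open>W\<close> the \<open>e j\<close> have modulus one, so
  \<open>norm_e_lattice\<close> and a geometric series give a bound linear in the coefficients of
  the lattice vector and uniform in \<open>z\<close>.\<close>

lemma summand_bound_W:
  assumes \<theta>: "\<And>j. norm (\<theta> j) \<le> \<Theta>" and z: "z \<in> W"
  shows "norm (summand \<theta> (\<Sum>c<CARD('n) + m. of_int (k c) *\<^sub>R p c) z)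
    \<le> \<Theta> * (4 * pi) * (\<Sum>c<CARD('n) + m. \<bar>of_int (k c)\<bar>)"
proof -
  define l where "l = (\<Sum>c<CARD('n) + m. of_int (k c) *\<^sub>R p c)"
  define \<kappa> :: real where "\<kappa> = (\<Sum>c<CARD('n) + m. \<bar>of_int (k c)\<bar>)"
  have \<kappa>: "0 \<le> \<kappa>" unfolding \<kappa>_def by (intro sum_nonneg) simp
  have \<Theta>: "0 \<le> \<Theta>" using \<theta>[of 0] norm_ge_zero order_trans by blast
  have bound: "norm (\<theta> j * 10 ^ j * (e j l - 1) * e j z) \<le> (\<Theta> * (2 * pi) * \<kappa>) * (1/10) ^ j" for j
  proof -
    have 1: "norm (e j l - 1) \<le> 2 * pi * \<kappa> * (1/100) ^ j"
    proof -
      have "norm (e j l - 1) \<le> 2 * pi * \<kappa> * \<eta> j"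
        using norm_e_lattice[OF l_def, of j] by (simp add: \<kappa>_def mult_ac)
      also have "\<eta> j \<le> (1/100) ^ j"
        using eta_le_100[of j] power_decreasing[of j "Suc j" "1/100 :: real"] by linarith
      finally show ?thesis using \<kappa> by (simp add: mult_left_mono)
    qed
    have "norm (\<theta> j * 10 ^ j * (e j l - 1) * e j z) = norm (\<theta> j) * (10 ^ j * norm (e j l - 1))"
      using norm_e_W[OF z] by (simp add: norm_mult norm_power)
    also have "\<dots> \<le> \<Theta> * (10 ^ j * (2 * pi * \<kappa> * (1/100) ^ j))"
      using \<theta>[of j] 1 \<Theta> by (intro mult_mono) auto
    also have "\<dots> = (\<Theta> * (2 * pi) * \<kappa>) * (10 ^ j * (1/100) ^ j)" by (simp only: mult_ac)
    finally show ?thesis unfolding geometric_10 .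
  qed
  have "norm (summand \<theta> l z) \<le> (\<Sum>j. (\<Theta> * (2 * pi) * \<kappa>) * (1/10) ^ j)"
    unfolding summand_def using bound by (intro norm_suminf_le summable_mult summable_geometric) auto
  also have "\<dots> = (\<Theta> * (2 * pi) * \<kappa>) * (10 / 9)"
    by (subst suminf_mult) (simp_all add: suminf_geometric summable_geometric)
  also have "\<dots> \<le> (\<Theta> * (2 * pi) * \<kappa>) * 2"
    using \<Theta> \<kappa> by (intro mult_left_mono) auto
  finally show ?thesis by (simp add: l_def \<kappa>_def)
qed

text \<open>The value of \<open>freq j\<close> at the column is \<open>\<delta> j k\<close> minus an
  integer, which the exponential does not see. An equality is needed, as it has to yield a lower
  bound later.\<close>

lemma e_p:
  assumes "k < 2 * m"
  shows "e j (of_nat N *\<^sub>R p (d + k)) = exp (2 * of_real pi * \<i> * of_real (of_nat N * \<delta> j k))"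
proof -
  have c: "d + k < CARD('n) + m" using assms dim by simp
  have "freq j (p (d + k)) = (\<Sum>i<d. of_int (\<sigma> j i) * of_real (Re (w i (p (d + k)))))"
    unfolding freq_def using w_p_real[OF _ c] by (intro sum.cong) auto
  also have "\<dots> = of_real (\<delta> j k) - of_int (\<tau> j k)"
    by (simp add: \<delta>_def)
  finally have freq_eq: "freq j (p (d + k)) = of_real (\<delta> j k) - of_int (\<tau> j k)" .
  have "e j (of_nat N *\<^sub>R p (d + k)) = exp (2 * of_real pi * \<i> * of_real (of_nat N * \<delta> j k)
      + - (2 * of_real pi * \<i> * of_int (int N * \<tau> j k)))"
    unfolding e_def complex_linear_simps[OF freq_linear] freq_eq by (simp add: algebra_simps)
  then show ?thesis unfolding exp_add exp_minus exp_2pi_i_int by simp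
qed

text \<open>\<open>f\<close> is the primitive of \<open>summand \<theta>\<close> that would exist if
  the class vanished.\<close>

context
  fixes f :: "complex^'n \<Rightarrow> complex" and \<theta> :: "nat \<Rightarrow> complex" and \<Theta> :: real
  assumes f: "holomorphic_Cn f \<Omega>"
    and cob: "\<And>l z. l \<in> \<Lambda> \<Longrightarrow> z \<in> \<Omega> \<Longrightarrow> f (z + l) - f z = summand \<theta> l z"
    and \<theta>: "\<And>j. norm (\<theta> j) \<le> \<Theta>"
begin

lemma Theta_nonneg: "0 \<le> \<Theta>"
  using \<theta>[of 0] norm_ge_zero order_trans by blast

lemma bounded_near_0: "\<exists>A\<ge>0. \<forall>z\<in>W. norm z \<le> R \<longrightarrow> norm (f z) \<le> A"
proof -
  have "continuous_on (W \<inter> cball 0 R) f"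
  proof (rule continuous_at_imp_continuous_on, rule ballI)
    fix z assume "z \<in> W \<inter> cball 0 R"
    then have "z \<in> \<Omega>" using W_subset_Omega by auto
    then obtain f' where "(f has_derivative f') (at z)" using f unfolding holomorphic_Cn_def by meson
    then show "isCont f z" by (rule has_derivative_continuous)
  qed
  moreover have "compact (W \<inter> cball 0 R)" using closed_W by (rule closed_Int_compact) simp
  ultimately have "bounded (f ` (W \<inter> cball 0 R))" by (intro compact_imp_bounded compact_continuous_image)
  then obtain A where "\<forall>x\<in>f ` (W \<inter> cball 0 R). norm x \<le> A" unfolding bounded_iff by (rule exE)
  then show ?thesis by (intro exI[of _ "max A 0"]) force
qed

text \<open>A point of \<open>W\<close> is the sum of a point of the fundamental parallelotope,
  where \<open>f\<close> is bounded by compactness, and a lattice vector with coefficients of order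
  \<open>norm z\<close>, whose effect on \<open>f\<close> is controlled by
  \<open>summand_bound_W\<close>.\<close>

lemma linear_growth: "\<exists>A B. 0 \<le> A \<and> 0 \<le> B \<and> (\<forall>z\<in>W. norm (f z) \<le> A + B * norm z)"
proof -
  obtain A0 where A0: "0 \<le> A0" "\<And>z. z \<in> W \<Longrightarrow> norm z \<le> R \<Longrightarrow> norm (f z) \<le> A0"
    using bounded_near_0 by auto
  obtain K where K: "\<And>z. (\<forall>i<d. Im (w i z) = 0) \<Longrightarrow>
          (\<exists>t. z = (\<Sum>c<CARD('n) + m. t c *\<^sub>R p c) \<and> (\<forall>c<CARD('n) + m. \<bar>t c\<bar> \<le> K * norm z))"
    using coordinates by auto
  define D where "D = \<Theta> * (4 * pi)"
  have D: "0 \<le> D" using Theta_nonneg by (simp add: D_def)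
  have "norm (f z) \<le> (A0 + D * real (CARD('n) + m)) + (D * real (CARD('n) + m) * \<bar>K\<bar>) * norm z" if z: "z \<in> W" for z
  proof -
    obtain t where t: "z = (\<Sum>c<CARD('n) + m. t c *\<^sub>R p c)" "\<And>c. c < CARD('n) + m \<Longrightarrow> \<bar>t c\<bar> \<le> K * norm z"
      using K[of z] z unfolding W_def by auto
    define y where "y = (\<Sum>c<CARD('n) + m. frac (t c) *\<^sub>R p c)"
    define l where "l = (\<Sum>c<CARD('n) + m. of_int \<lfloor>t c\<rfloor> *\<^sub>R p c)"
    have zyl: "z = y + l" unfolding t(1) y_def l_def by (rule split_frac)
    have y: "y \<in> W" "norm y \<le> R" unfolding y_def by (rule W_sum_p, simp) (rule frac_sum_p, simp)
    have "l \<in> \<Lambda>" unfolding l_def by (rule lattice_sum_p) simp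
    then have "f z = f y + summand \<theta> l y"
      using cob[of l y] y(1) W_subset_Omega zyl by (auto simp: algebra_simps)
    then have "norm (f z) \<le> norm (f y) + norm (summand \<theta> l y)"
      using norm_triangle_ineq[of "f y" "summand \<theta> l y"] by (simp only:)
    also have "\<dots> \<le> A0 + D * (\<Sum>c<CARD('n) + m. \<bar>of_int \<lfloor>t c\<rfloor>\<bar>)"
      unfolding l_def D_def using A0(2)[OF y] summand_bound_W[OF \<theta> y(1)] by (intro add_mono)
    finally have 1: "norm (f z) \<le> A0 + D * (\<Sum>c<CARD('n) + m. \<bar>of_int \<lfloor>t c\<rfloor>\<bar>)" .
    have "(\<Sum>c<CARD('n) + m. \<bar>real_of_int \<lfloor>t c\<rfloor>\<bar>) \<le> (\<Sum>c<CARD('n) + m. 1 + \<bar>K\<bar> * norm z)"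
    proof (rule sum_mono)
      fix c assume "c \<in> {..<CARD('n) + m}"
      then have "\<bar>t c\<bar> \<le> K * norm z" using t(2) by simp
      also have "\<dots> \<le> \<bar>K\<bar> * norm z" by (intro mult_right_mono) auto
      finally show "\<bar>real_of_int \<lfloor>t c\<rfloor>\<bar> \<le> 1 + \<bar>K\<bar> * norm z" by linarith
    qed
    also have "\<dots> = real (CARD('n) + m) * (1 + \<bar>K\<bar> * norm z)" by simp
    finally have "D * (\<Sum>c<CARD('n) + m. \<bar>of_int \<lfloor>t c\<rfloor>\<bar>) \<le> D * (real (CARD('n) + m) * (1 + \<bar>K\<bar> * norm z))"
      using D by (rule mult_left_mono)
    also have "\<dots> = D * real (CARD('n) + m) + (D * real (CARD('n) + m) * \<bar>K\<bar>) * norm z"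
      by (simp only: distrib_left mult_1_right mult.assoc)
    finally show ?thesis using 1 by linarith
  qed
  moreover have "0 \<le> A0 + D * real (CARD('n) + m)" "0 \<le> D * real (CARD('n) + m) * \<bar>K\<bar>"
    using D A0(1) by auto
  ultimately show ?thesis by blast
qed

text \<open>On the complex line through \<open>z\<close> in direction \<open>V k\<close> the
  function is entire and, by \<open>linear_growth\<close>, a polynomial of degree at most
  one.\<close>

lemma affine_along_V:
  assumes z: "z \<in> W" and k: "k < 2 * m"
  shows "f (z + s *s V k) = f z + s * (f (z + V k) - f z)"
proof -
  obtain A B where AB: "0 \<le> A" "0 \<le> B" "\<And>z. z \<in> W \<Longrightarrow> norm (f z) \<le> A + B * norm z"
    using linear_growth by auto
  define h where "h s = f (z + s *s V k)" for s
  obtain C where C: "\<And>s. norm (s *s V k) \<le> norm s * C" "0 \<le> C"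
    using bounded_linear.nonneg_bounded[OF bounded_linear_scale_right[of "V k"]] by auto
  have "h holomorphic_on UNIV"
    unfolding holomorphic_on_def field_differentiable_def
  proof (intro ballI)
    fix s
    have "z + s *s V k \<in> \<Omega>" using W_shift[OF z k] W_subset_Omega by blast
    then obtain f' where f': "(f has_derivative f') (at (z + s *s V k))" "\<forall>c v. f' (c *s v) = c * f' v"
      using f unfolding holomorphic_Cn_def by meson
    have "((\<lambda>s. z + s *s V k) has_derivative (\<lambda>u. u *s V k)) (at s)"
      by (rule has_derivative_add[OF has_derivative_const bounded_linear_imp_has_derivative[OF bounded_linear_scale_right],
            THEN has_derivative_eq_rhs]) simp
    from has_derivative_compose[OF this f'(1)]
    have "(h has_derivative (\<lambda>u. u * f' (V k))) (at s)"
      unfolding h_def[abs_def] using f'(2) by simp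
    then have "(h has_field_derivative f' (V k)) (at s)"
      unfolding has_field_derivative_def by (simp add: mult.commute[of _ "f' (V k)"])
    then show "\<exists>D. (h has_field_derivative D) (at s within UNIV)" by blast
  qed
  \<comment> \<open>For \<open>1 \<le> norm s\<close> the constant terms are absorbed into a
    multiple of \<open>norm s\<close>, the form of growth that Liouville's theorem takes.\<close>
  moreover have "norm (h s) \<le> (A + B * norm z + B * C) * norm s ^ 1" if "1 \<le> norm s" for s
  proof -
    have "norm (h s) \<le> A + B * norm (z + s *s V k)"
      unfolding h_def by (rule AB(3)[OF W_shift[OF z k]])
    also have "\<dots> \<le> A + B * (norm z + norm s * C)"
      using norm_triangle_ineq[of z "s *s V k"] C(1)[of s] AB(2) by (intro add_mono mult_left_mono order_refl) linarith+
    also have "A + B * (norm z + norm s * C) \<le> A * norm s + B * (norm z * norm s + norm s * C)"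
      using that AB(1,2) by (intro add_mono mult_left_mono) (simp_all add: mult_le_cancel_left1)
    also have "\<dots> = (A + B * norm z + B * C) * norm s ^ 1" by (simp add: algebra_simps)
    finally show ?thesis .
  qed
  ultimately have L: "h \<xi> = (\<Sum>k\<le>1. (deriv ^^ k) h 0 / fact k * \<xi> ^ k)" for \<xi>
    by (rule Liouville_polynomial)
  have "(\<Sum>k\<le>1. (deriv ^^ k) h 0 / fact k * \<xi> ^ k) = h 0 + deriv h 0 * \<xi>" for \<xi> by simp
  note h = trans[OF L this]
  have "h 1 - h 0 = deriv h 0" using h[of 1] by simp
  then have "h s = h 0 + s * (h 1 - h 0)" using h[of s] by (simp only: mult.commute)
  then show ?thesis by (simp add: h_def)
qed

text \<open>The differences of \<open>f\<close> by \<open>l\<close> are series in the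
  \<open>e j\<close>, which are constant along \<open>V k\<close>; shifting by \<open>V k\<close>
  therefore leaves these differences unchanged.\<close>

lemma slope_periodic:
  assumes z: "z \<in> W" and k: "k < 2 * m" and l: "l \<in> \<Lambda>"
  shows "f (z + l + V k) - f (z + l) = f (z + V k) - f z"
proof -
  have "z + V k \<in> W" using W_shift[OF z k, of 1] by simp
  then have "z + V k \<in> \<Omega>" "z \<in> \<Omega>" using z W_subset_Omega by auto
  note * = cob[OF l this(1)] cob[OF l this(2)]
  have "summand \<theta> l (z + V k) = summand \<theta> l z"
    unfolding summand_def using e_shift[OF k, of _ z 1] by (simp only: vec.scale_one)
  then have "f (z + V k + l) - f (z + V k) = f (z + l) - f z" unfolding * .
  moreover have "z + l + V k = z + V k + l" by (simp add: add_ac)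
  ultimately show ?thesis by (simp add: algebra_simps)
qed

text \<open>The \<open>N\<close>-fold column is \<open>y\<close> plus \<open>N\<close> times
  \<open>V k\<close>, with \<open>y\<close> a real combination of the \<open>p i\<close> for
  \<open>i < d\<close>. Along \<open>V k\<close> the function is affine, its value at
  \<open>y\<close> is bounded by periodicity in the \<open>p i\<close>, and its slope at
  \<open>y\<close> equals that at 0; hence the bound is independent of \<open>N\<close>.\<close>

lemma almost_linear:
  "\<exists>A\<ge>0. \<forall>k<2 * m. \<forall>N. norm (f (of_nat N *\<^sub>R p (d + k)) - of_nat N * (f (V k) - f 0)) \<le> A"
proof -
  obtain A where A: "0 \<le> A" "\<And>z. z \<in> W \<Longrightarrow> norm z \<le> R \<Longrightarrow> norm (f z) \<le> A"
    using bounded_near_0 by auto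
  have "norm (f (of_nat N *\<^sub>R p (d + k)) - of_nat N * (f (V k) - f 0)) \<le> A" if k: "k < 2 * m" for k N
  proof -
    define t where "t i = of_nat N * Re (w i (p (d + k)))" for i
    define y where "y = (\<Sum>i<d. t i *\<^sub>R p i)"
    define y' where "y' = (\<Sum>i<d. frac (t i) *\<^sub>R p i)"
    define l where "l = (\<Sum>i<d. of_int \<lfloor>t i\<rfloor> *\<^sub>R p i)"
    have sub: "{..<d} \<subseteq> {..<CARD('n) + m}" using dim by auto
    have y: "y \<in> W" "y' \<in> W" "norm y' \<le> R" "l \<in> \<Lambda>"
      unfolding y_def y'_def l_def
      by (rule W_sum_p[OF sub], rule W_sum_p[OF sub], rule frac_sum_p[OF sub], rule lattice_sum_p[OF sub])
    have yy: "y = y' + l" unfolding y_def y'_def l_def by (rule split_frac)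
    \<comment> \<open>The frequencies are integral at \<open>p i\<close> for \<open>i < d\<close>,
      so \<open>f\<close> is periodic under the sublattice these vectors generate.\<close>
    have "e j l = 1" for j
    proof -
      have "freq j l = (\<Sum>i<d. of_int \<lfloor>t i\<rfloor> * of_int (\<sigma> j i))"
        unfolding l_def by (simp add: complex_linear_simps[OF freq_linear] freq_p_lt)
      also have "\<dots> = of_int (\<Sum>i<d. \<lfloor>t i\<rfloor> * \<sigma> j i)" by simp
      finally show ?thesis unfolding e_def by (simp only: exp_2pi_i_int)
    qed
    then have "summand \<theta> l y' = 0" by (simp add: summand_def)
    then have "f y = f y'" using cob[OF y(4), of y'] y(2) W_subset_Omega yy by auto
    then have fy: "norm (f y) \<le> A" using A(2)[OF y(2,3)] by simp
    have Ng: "of_nat N *\<^sub>R p (d + k) = y + of_nat N *s V k"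
    proof -
      have "of_nat N *s V k = of_nat N *\<^sub>R V k" by (simp add: scaleR_eq_scale_of_real)
      then show ?thesis
        unfolding V_def y_def t_def by (simp add: scaleR_right_diff_distrib scaleR_sum_right)
    qed
    have NL: "of_nat N *\<^sub>R p (d + k) \<in> \<Lambda>"
      using lattice_sum_p[of "{d + k}" "\<lambda>_. int N"] k dim by simp
    \<comment> \<open>The slope at \<open>y\<close> agrees, by affineness, with the slope at the
      lattice point reached after \<open>N\<close> steps, and this one agrees with the slope at 0 by
      \<open>slope_periodic\<close>.\<close>
    have "f (y + of_nat N *s V k + V k) = f (y + (of_nat N + 1) *s V k)"
      by (simp add: vec.scale_left_distrib add.assoc)
    then have "f (y + of_nat N *s V k + V k) - f (y + of_nat N *s V k) = f (y + V k) - f y"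
      unfolding affine_along_V[OF y(1) k] by (simp add: algebra_simps)
    moreover have "f (0 + of_nat N *\<^sub>R p (d + k) + V k) - f (0 + of_nat N *\<^sub>R p (d + k)) = f (0 + V k) - f 0"
    proof (rule slope_periodic[OF _ k NL])
      show "0 \<in> W" using W_sum_p[of "{}"] by simp
    qed
    ultimately have "f (y + V k) - f y = f (V k) - f 0"
      unfolding Ng by simp
    then have "f (of_nat N *\<^sub>R p (d + k)) = f y + of_nat N * (f (V k) - f 0)"
      unfolding Ng affine_along_V[OF y(1) k] by simp
    then show ?thesis using fy by simp
  qed
  then show ?thesis using A(1) by blast
qed

end

end

section \<open>Impossibility of a holomorphic primitive\<close>

lemma sum_power_10_le: "(\<Sum>i<j. (10::real) ^ i) \<le> 10 ^ j / 9"
  by (induction j) auto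

context resonant_sequence
begin

text \<open>By \<open>almost_linear\<close>, second differences of \<open>f\<close> at 0 along a
  column are bounded whatever the step \<open>N\<close>. For a step of order
  \<open>1 / \<eta> j\<close> their \<open>j\<close>-th term has order
  \<open>\<Theta> * 10 ^ j\<close>; earlier terms are smaller by the growth of
  \<open>10 ^ i\<close>, later ones by the decay of \<open>\<eta>\<close>. This fails for large
  \<open>j\<close>.\<close>

lemma no_primitive:
  assumes f: "holomorphic_Cn f \<Omega>"
    and cob: "\<And>l z. l \<in> \<Lambda> \<Longrightarrow> z \<in> \<Omega> \<Longrightarrow> f (z + l) - f z = summand \<theta> l z"
    and \<theta>: "\<And>j. norm (\<theta> j) \<le> \<Theta>" and pos: "0 < \<Theta>"
    and attained: "\<And>n. \<exists>j\<ge>n. norm (\<theta> j) = \<Theta>"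
  shows False
proof -
  obtain A where A: "0 \<le> A"
    "\<And>k N. k < 2 * m \<Longrightarrow> norm (f (of_nat N *\<^sub>R p (d + k)) - of_nat N * (f (V k) - f 0)) \<le> A"
    using almost_linear[OF f cob \<theta>] by auto
  have zero: "0 \<in> \<Omega>" using W_sum_p[of "{}"] W_subset_Omega by auto
  \<comment> \<open>Relative to \<open>\<Theta> * 10 ^ j\<close>, the factor 2/3 is 2 for the
    \<open>j\<close>-th term less 4/9 for the earlier and 8/9 for the later terms;
    \<open>4 * A\<close> is the bound for the whole second difference.\<close>
  have main: "\<Theta> * 10 ^ j * (2/3) \<le> 4 * A" if j: "norm (\<theta> j) = \<Theta>" for j
  proof -
    obtain k where k: "k < 2 * m" "\<bar>\<delta> j k\<bar> = \<eta> j" using eta_attained[of j] unfolding \<delta>_def by auto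
    define g where "g = p (d + k)"
    \<comment> \<open>The least integer with \<open>N * \<eta> j \<ge> 1/4\<close>. As
      \<open>\<eta> j \<le> 1/4\<close>, also \<open>N * \<eta> j \<le> 1/2\<close>, so the angle
      \<open>pi * (N * \<eta> j)\<close> lies between 45 and 90 degrees.\<close>
    define N where "N = nat \<lceil>1 / (4 * \<eta> j)\<rceil>"
    have \<eta>: "0 < \<eta> j" "\<eta> j \<le> 1 / 4"
      using eta_pos[of j] eta_le_100[of j] power_le_one[of "1/100::real" "Suc j"]
        power_decreasing[of 1 "Suc j" "1/100::real"] by auto
    have "1 / (4 * \<eta> j) \<le> N" "N \<le> 1 / (4 * \<eta> j) + 1"
      using \<eta>(1) of_int_ceiling_le_add_one[of "1 / (4 * \<eta> j)"] le_of_int_ceiling[of "1 / (4 * \<eta> j)"]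
      by (simp_all add: N_def)
    then have "1 / (4 * \<eta> j) * \<eta> j \<le> N * \<eta> j" "N * \<eta> j \<le> (1 / (4 * \<eta> j) + 1) * \<eta> j"
      using \<eta>(1) by (intro mult_right_mono; simp)+
    then have N: "1/4 \<le> N * \<eta> j" "N * \<eta> j \<le> 1/2"
      using \<eta> by (simp_all add: distrib_right)
    define u where "u i = e i (of_nat N *\<^sub>R g) - 1" for i
    \<comment> \<open>With \<open>E = e i L1\<close>, the terms of the second difference are (E^2 -
      1) - 2 (E - 1) = (E - 1)^2.\<close>
    define a where "a i = \<theta> i * 10 ^ i * (u i)\<^sup>2" for i
    have gL: "of_nat M *\<^sub>R g \<in> \<Lambda>" for M
      using lattice_sum_p[of "{d + k}" "\<lambda>_. int M"] k(1) dim by (simp add: g_def)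
    have u_le: "norm (u i) \<le> 2 * pi * (N * \<eta> i)" for i
    proof -
      have "of_nat N *\<^sub>R g = (\<Sum>c<CARD('n) + m. of_int (if c = d + k then int N else 0) *\<^sub>R p c)"
        using k(1) dim by (simp add: g_def if_distrib[of "\<lambda>r. r *\<^sub>R _"] if_distrib[of of_int] cong: if_cong)
      from norm_e_lattice[OF this, of i]
      have "norm (u i) \<le> 2 * pi * \<eta> i * (\<Sum>c<CARD('n) + m. \<bar>of_int (if c = d + k then int N else 0)\<bar>)"
        by (simp only: u_def)
      also have "(\<Sum>c<CARD('n) + m. \<bar>of_int (if c = d + k then int N else 0)\<bar>) = real N"
        using k(1) dim by (simp add: if_distrib[of abs] if_distrib[of of_int] cong: if_cong)
      finally show ?thesis by (simp only: mult_ac)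
    qed
    have u_2: "norm (u i) \<le> 2" for i
    proof -
      have "of_nat N *\<^sub>R g \<in> W" using W_sum_p[of "{d + k}" "\<lambda>_. of_nat N"] k(1) dim by (simp add: g_def)
      then show ?thesis
        using norm_triangle_ineq4[of "e i (of_nat N *\<^sub>R g)" 1] norm_e_W[of _ i] by (simp add: u_def)
    qed
    have u_j: "2 \<le> (norm (u j))\<^sup>2"
    proof -
      have "norm (u j) = 2 * \<bar>sin (pi * (N * \<delta> j k))\<bar>"
        unfolding u_def g_def e_p[OF k(1)] by (rule norm_exp_2pi_i_minus_1)
      also have "\<bar>sin (pi * (N * \<delta> j k))\<bar> = \<bar>sin (pi * (N * \<eta> j))\<bar>"
        using k(2) by (cases "0 \<le> \<delta> j k") (simp_all flip: k(2))
      finally have 1: "norm (u j) = 2 * \<bar>sin (pi * (N * \<eta> j))\<bar>" .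
      have "sin (pi / 4) \<le> sin (pi * (N * \<eta> j))"
      proof (rule sin_monotone_2pi_le)
        have "pi * (1/4) \<le> pi * (N * \<eta> j)" "pi * (N * \<eta> j) \<le> pi * (1/2)"
          using N by (intro mult_left_mono; simp)+
        then show "pi / 4 \<le> pi * (N * \<eta> j)" "pi * (N * \<eta> j) \<le> pi / 2" by simp_all
        show "- (pi / 2) \<le> pi / 4" using pi_gt_zero by linarith
      qed
      then have "sqrt 2 \<le> norm (u j)" unfolding 1 sin_45 by linarith
      then have "(sqrt 2)\<^sup>2 \<le> (norm (u j))\<^sup>2" by (intro power_mono) auto
      then show ?thesis by simp
    qed
    have norm_a: "norm (a i) = norm (\<theta> i) * 10 ^ i * (norm (u i))\<^sup>2" for i
      by (simp add: a_def norm_mult norm_power)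
    have summ: "summable (\<lambda>i. \<theta> i * 10 ^ i * (e i l - 1) * e i 0)" if "l \<in> \<Lambda>" for l
      by (rule summable_summand[OF \<theta> that zero])
    have val: "f l - f 0 = summand \<theta> l 0" if "l \<in> \<Lambda>" for l
      using cob[OF that zero] by simp
    define L1 where "L1 = of_nat N *\<^sub>R g"
    define L2 where "L2 = of_nat (2 * N) *\<^sub>R g"
    have L: "L1 \<in> \<Lambda>" "L2 \<in> \<Lambda>" unfolding L1_def L2_def by (rule gL)+
    have "L2 = L1 + L1" unfolding L1_def L2_def scaleR_add_left[symmetric] by simp
    then have e2: "e i L2 = (e i L1)\<^sup>2" for i by (simp only: e_add power2_eq_square)
    have a_eq: "a i = \<theta> i * 10 ^ i * (e i L2 - 1) * e i 0 - 2 * (\<theta> i * 10 ^ i * (e i L1 - 1) * e i 0)" for i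
      unfolding a_def u_def L1_def[symmetric] e2 by (simp add: power2_eq_square algebra_simps)
    have summable_a: "summable a"
      unfolding a_eq[abs_def] by (intro summable_diff summable_mult summ L)
    have "suminf a = summand \<theta> L2 0 - 2 * summand \<theta> L1 0"
      unfolding a_eq[abs_def] summand_def
      using summ[OF L(1)] summ[OF L(2)]
      by (simp only: suminf_diff[symmetric] suminf_mult[symmetric] summable_mult)
    \<comment> \<open>The parts linear in \<open>N\<close>, with slope \<open>f (V k) - f 0\<close>,
      cancel in the second difference.\<close>
    also have "\<dots> = (f L2 - of_nat (2 * N) * (f (V k) - f 0)) - 2 * (f L1 - of_nat N * (f (V k) - f 0)) + f 0"
      unfolding val[OF L(1), symmetric] val[OF L(2), symmetric] by (simp add: algebra_simps)
    finally have "norm (suminf a) \<le> norm (f L2 - of_nat (2 * N) * (f (V k) - f 0))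
        + norm (2 * (f L1 - of_nat N * (f (V k) - f 0))) + norm (f 0)"
      by (simp only: order_trans[OF norm_triangle_ineq add_right_mono[OF norm_triangle_ineq4]])
    also have "\<dots> \<le> A + 2 * A + A"
    proof (intro add_mono)
      show "norm (f L2 - of_nat (2 * N) * (f (V k) - f 0)) \<le> A"
        unfolding L2_def g_def by (rule A(2)[OF k(1)])
      show "norm (2 * (f L1 - of_nat N * (f (V k) - f 0))) \<le> 2 * A"
        unfolding L1_def g_def norm_mult using A(2)[OF k(1), of N] by simp
      show "norm (f 0) \<le> A" using A(2)[OF k(1), of 0] by simp
    qed
    finally have upper: "norm (suminf a) \<le> 4 * A" by simp
    \<comment> \<open>The trivial bound \<open>norm (u i) \<le> 2\<close> is enough, since the sum
      of the \<open>10 ^ i\<close> is at most a ninth of \<open>10 ^ j\<close>.\<close>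
    have low: "norm (\<Sum>i<j. a i) \<le> \<Theta> * 10 ^ j * (4/9)"
    proof -
      have "norm (\<Sum>i<j. a i) \<le> (\<Sum>i<j. \<Theta> * 4 * 10 ^ i)"
      proof (rule order_trans[OF norm_sum sum_mono])
        fix i
        have "(norm (u i))\<^sup>2 \<le> 2\<^sup>2" using u_2 by (intro power_mono) auto
        then have "norm (\<theta> i) * 10 ^ i * (norm (u i))\<^sup>2 \<le> \<Theta> * 10 ^ i * 4"
          using \<theta>[of i] pos by (intro mult_mono) auto
        then show "norm (a i) \<le> \<Theta> * 4 * 10 ^ i" by (simp add: norm_a mult_ac)
      qed
      also have "\<dots> = \<Theta> * 4 * (\<Sum>i<j. 10 ^ i)" by (rule sum_distrib_left[symmetric])
      also have "\<dots> \<le> \<Theta> * 4 * (10 ^ j / 9)" using pos by (intro mult_left_mono sum_power_10_le) auto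
      finally show ?thesis by simp
    qed
    \<comment> \<open>In \<open>v\<^sup>2 \<le> 2 * v\<close> one factor is bounded trivially, while
      the other gains 1/100 per index through \<open>\<eta>\<close>, against a growth by 10.\<close>
    have high: "norm (\<Sum>i. a (i + Suc j)) \<le> \<Theta> * 10 ^ j * (8/9)"
    proof -
      have bound: "norm (a (i + Suc j)) \<le> \<Theta> * 10 ^ j * (4/5) * (1/10) ^ i" for i
      proof -
        define v where "v = norm (u (i + Suc j))"
        have "\<eta> (i + Suc j) \<le> \<eta> j * (1/100) ^ Suc i"
          using eta_decay[of j "i + Suc j"] by simp
        then have "N * \<eta> (i + Suc j) \<le> N * (\<eta> j * (1/100) ^ Suc i)" by (intro mult_left_mono) auto
        also have "\<dots> = (N * \<eta> j) * (1/100) ^ Suc i" by simp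
        also have "\<dots> \<le> 1/2 * (1/100) ^ Suc i" using N(2) by (intro mult_right_mono) auto
        finally have "2 * pi * (N * \<eta> (i + Suc j)) \<le> 2 * pi * (1/2 * (1/100) ^ Suc i)"
          by (intro mult_left_mono) auto
        also have "2 * pi * (1/2 * (1/100) ^ Suc i) = pi * (1/100) ^ Suc i" by simp
        finally have "v \<le> pi * (1/100) ^ Suc i" using u_le[of "i + Suc j"] unfolding v_def by linarith
        also have "\<dots> \<le> 4 * (1/100) ^ Suc i" using pi_less_4 by (intro mult_right_mono) auto
        finally have v: "v \<le> 4 * (1/100) ^ Suc i" .
        have "v\<^sup>2 \<le> 2 * v" using u_2[of "i + Suc j"] unfolding v_def power2_eq_square by (intro mult_right_mono) auto
        then have v2: "v\<^sup>2 \<le> 8 * (1/100) ^ Suc i" using v by linarith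
        have "norm (a (i + Suc j)) \<le> \<Theta> * 10 ^ (i + Suc j) * (8 * (1/100) ^ Suc i)"
          unfolding norm_a using \<theta>[of "i + Suc j"] v2 pos by (intro mult_mono) (auto simp: v_def)
        also have "\<dots> = \<Theta> * 10 ^ j * 8 * (10 ^ Suc i * (1/100) ^ Suc i)"
          by (simp add: power_add)
        also have "10 ^ Suc i * (1/100) ^ Suc i = (1/10 :: real) ^ Suc i" by (rule geometric_10)
        also have "\<Theta> * 10 ^ j * 8 * (1/10) ^ Suc i = \<Theta> * 10 ^ j * (4/5) * (1/10) ^ i" by simp
        finally show ?thesis .
      qed
      have "norm (\<Sum>i. a (i + Suc j)) \<le> (\<Sum>i. \<Theta> * 10 ^ j * (4/5) * (1/10) ^ i)"
        using bound by (intro norm_suminf_le summable_mult summable_geometric) auto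
      also have "\<dots> = \<Theta> * 10 ^ j * (4/5) * (10/9)"
        by (subst suminf_mult) (simp_all add: suminf_geometric summable_geometric)
      finally show ?thesis by simp
    qed
    have "suminf a = (\<Sum>i. a (i + Suc j)) + (\<Sum>i<Suc j. a i)"
      by (rule suminf_split_initial_segment[OF summable_a])
    then have "a j = suminf a - ((\<Sum>i. a (i + Suc j)) + (\<Sum>i<j. a i))" by simp
    then have "norm (a j) = norm (suminf a - ((\<Sum>i. a (i + Suc j)) + (\<Sum>i<j. a i)))" by (rule arg_cong)
    then have "norm (a j) \<le> norm (suminf a) + (norm (\<Sum>i. a (i + Suc j)) + norm (\<Sum>i<j. a i))"
      using norm_triangle_ineq4[of "suminf a" "(\<Sum>i. a (i + Suc j)) + (\<Sum>i<j. a i)"]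
        norm_triangle_ineq[of "\<Sum>i. a (i + Suc j)" "\<Sum>i<j. a i"] by linarith
    moreover have "\<Theta> * 10 ^ j * 2 \<le> norm (a j)"
      unfolding norm_a j using u_j pos by (intro mult_left_mono) auto
    ultimately show ?thesis using upper low high by linarith
  qed
  \<comment> \<open>\<open>main\<close> bounds \<open>\<Theta> * 10 ^ j\<close> by
    \<open>6 * A\<close>; any \<open>j\<close> beyond this \<open>n\<close> with
    \<open>norm (\<theta> j) = \<Theta>\<close> violates it.\<close>
  obtain n where "6 * A / \<Theta> + 1 < 10 ^ n" using real_arch_pow[of 10 "6 * A / \<Theta> + 1"] by auto
  moreover obtain j where j: "n \<le> j" "norm (\<theta> j) = \<Theta>" using attained[of n] by auto
  moreover have "(10::real) ^ n \<le> 10 ^ j" using j(1) by (intro power_increasing) auto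
  ultimately have "6 * A / \<Theta> + 1 < 10 ^ j" by linarith
  then have "\<Theta> * (6 * A / \<Theta> + 1) < \<Theta> * 10 ^ j" using pos by (rule mult_strict_left_mono)
  moreover have "\<Theta> * (6 * A / \<Theta> + 1) = 6 * A + \<Theta>" using pos by (simp add: distrib_left)
  ultimately show False using main[OF j(2)] pos by linarith
qed

end

section \<open>Infinite dimension of the first cohomology\<close>

context resonant_sequence
begin

text \<open>Coefficient sequences with disjoint infinite supports give infinitely many cocycles. A
  relation between their classes would yield a primitive of a combined series whose coefficients
  attain their largest modulus infinitely often, against \<open>no_primitive\<close>.\<close>

lemma H1_not_fin_dim:
  assumes "discrete_subgroup \<Lambda>"
  shows "openin (quot_topology \<Lambda>) (qproj \<Lambda> ` \<Omega>)" (is ?open)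
    and "convex (qproj \<Lambda> -` (qproj \<Lambda> ` \<Omega>))" (is ?convex)
    and "\<not> vectorspace.fin_dim class_ring (cech_H1 (quot_topology \<Lambda>) (quot_sheaf_O \<Lambda>) (qproj \<Lambda> ` \<Omega>))"
      (is "\<not> ?fin")
proof -
  obtain \<epsilon> where \<epsilon>: "0 < \<epsilon>" "\<And>l. l \<in> \<Lambda> \<Longrightarrow> norm l < \<epsilon> \<Longrightarrow> l = 0"
    by (rule discrete_subgroup_separated[OF assms]) blast
  \<comment> \<open>The separation radius is halved because the locale separates lattice points by
    twice its parameter.\<close>
  interpret dom: lattice_domain \<Lambda> \<Omega> "\<epsilon> / 2"
  proof
    show "0 \<in> \<Lambda>" "\<And>x y. x \<in> \<Lambda> \<Longrightarrow> y \<in> \<Lambda> \<Longrightarrow> x - y \<in> \<Lambda>"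
      using assms by (simp_all add: discrete_subgroup_def)
    show "0 < \<epsilon> / 2" using \<epsilon>(1) by simp
    show "l = 0" if "l \<in> \<Lambda>" "norm l < 2 * (\<epsilon> / 2)" for l using \<epsilon>(2)[of l] that by simp
    show "open \<Omega>" unfolding Omega_strip by (rule open_strip)
    show "z + l \<in> \<Omega>" if "z \<in> \<Omega>" "l \<in> \<Lambda>" for z l
      using that unfolding Omega_strip by (rule strip_invariant)
  qed
  show ?open by (rule dom.openin_domain)
  show ?convex unfolding dom.vimage_domain unfolding Omega_strip by (rule convex_strip)
  show "\<not> ?fin"
  proof
    assume fin: ?fin
    \<comment> \<open>Decoding pairs splits the indices into infinitely many infinite classes;
      \<open>\<theta> r\<close> is the indicator of class \<open>r\<close>.\<close>
    define \<theta> where "\<theta> r j = (if fst (prod_decode j) = r then 1 else 0 :: complex)" for r j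
    have \<theta>: "norm (\<theta> r j) \<le> 1" for r j by (simp add: \<theta>_def)
    have cocycle: "dom.group_cocycle (summand (\<theta> r))" for r
      unfolding dom.group_cocycle_def
      by (intro conjI ballI holomorphic_summand[OF \<theta>] summand_add[OF \<theta>])
    obtain R \<beta> f r where R: "finite R" "r \<in> R" "\<beta> r \<noteq> 0" "holomorphic_Cn f \<Omega>"
      "\<And>l z. l \<in> \<Lambda> \<Longrightarrow> z \<in> \<Omega> \<Longrightarrow> f (z + l) - f z = (\<Sum>r\<in>R. \<beta> r * summand (\<theta> r) l z)"
      by (rule dom.fin_dim_H1_imp_coboundary[OF fin cocycle]) (rule that)
    define \<phi> where "\<phi> j = (\<Sum>r\<in>R. \<beta> r * \<theta> r j)" for j
    have \<phi>: "\<phi> j = (if fst (prod_decode j) \<in> R then \<beta> (fst (prod_decode j)) else 0)" for j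
      unfolding \<phi>_def \<theta>_def using R(1) by (simp add: if_distrib cong: if_cong)
    define \<Theta> where "\<Theta> = Max ((\<lambda>r. norm (\<beta> r)) ` R)"
    have le: "norm (\<beta> s) \<le> \<Theta>" if "s \<in> R" for s
      unfolding \<Theta>_def using R(1) that by (intro Max_ge) auto
    have pos: "0 < \<Theta>" using le[OF R(2)] R(3) zero_less_norm_iff[of "\<beta> r"] by linarith
    have "\<Theta> \<in> (\<lambda>r. norm (\<beta> r)) ` R"
      unfolding \<Theta>_def using R(1,2) by (intro Max_in) auto
    \<comment> \<open>The combined coefficients have modulus \<open>\<Theta>\<close> on the whole
      class of this \<open>s\<close>, which contains the code of \<open>(s, n)\<close>, a number not
      below \<open>n\<close>.\<close>
    then obtain s where s: "\<Theta> = norm (\<beta> s)" "s \<in> R" by (rule imageE)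
    show False
    proof (rule no_primitive[OF R(4) _ _ pos])
      show "f (z + l) - f z = summand \<phi> l z" if "l \<in> \<Lambda>" "z \<in> \<Omega>" for l z
        unfolding R(5)[OF that] \<phi>_def[abs_def] by (rule summand_sum[OF R(1) \<theta> that])
      show "norm (\<phi> j) \<le> \<Theta>" for j
        using le[of "fst (prod_decode j)"] pos by (simp add: \<phi>)
      show "\<exists>j\<ge>n. norm (\<phi> j) = \<Theta>" for n
        using le_prod_encode_2[of n s] s by (intro exI[of _ "prod_encode (s, n)"]) (simp add: \<phi>)
    qed
  qed
qed

end

section \<open>From a failing estimate to a resonant sequence\<close>

context adapted_basis
begin

text \<open>An entry of the vector in the definition of strong dispersiveness, for coefficient
  functions instead of vectors; \<open>index_transpose_R\<close> makes the identification.\<close>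

definition pairing :: "(nat \<Rightarrow> int) \<Rightarrow> (nat \<Rightarrow> int) \<Rightarrow> nat \<Rightarrow> real" where
  "pairing s t k = (\<Sum>i<d. of_int (s i) * Re (w i (p (d + k)))) + of_int (t k)"

lemma index_transpose_R:
  assumes "\<sigma> \<in> carrier_vec d" "\<tau> \<in> carrier_vec (2 * m)" "k < 2 * m"
  shows "vec_index (transpose_mat (hcat R1_mat R2_mat) *\<^sub>v map_vec real_of_int \<sigma> + map_vec real_of_int \<tau>) k
    = pairing (vec_index \<sigma>) (vec_index \<tau>) k"
proof -
  have R: "hcat R1_mat R2_mat \<in> carrier_mat d (2 * m)"
    using hcat_carrier[OF mat_carriers(3,4)] by (simp add: mult_2)
  have "vec_index (transpose_mat (hcat R1_mat R2_mat) *\<^sub>v map_vec real_of_int \<sigma>) k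
      = (\<Sum>i<d. hcat R1_mat R2_mat $$ (i, k) * of_int (vec_index \<sigma> i))"
    using assms R by (simp add: scalar_prod_def atLeast0LessThan)
  also have "\<dots> = (\<Sum>i<d. of_int (vec_index \<sigma> i) * Re (w i (p (d + k))))"
    using assms(3) by (intro sum.cong) (simp_all add: index_R)
  finally show ?thesis using assms(2,3) by (simp add: pairing_def)
qed

text \<open>If all entries vanished, the form with coefficients \<open>s\<close> in the
  \<open>w\<close> would be integral on \<open>\<Lambda>\<close> and hence zero, although its value
  at \<open>p i\<close> is \<open>s i\<close>.\<close>

lemma pairing_nonzero:
  assumes "cousin \<Lambda>" and s: "i < d" "s i \<noteq> 0"
  shows "\<exists>k<2 * m. pairing s t k \<noteq> 0"
proof (rule ccontr)
  assume "\<not> (\<exists>k<2 * m. pairing s t k \<noteq> 0)"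
  then have zero: "pairing s t k = 0" if "k < 2 * m" for k using that by auto
  define \<phi> where "\<phi> z = (\<Sum>i<d. of_int (s i) * w i z)" for z
  have \<phi>_linear: "complex_linear \<phi>"
    unfolding complex_linear_def
  proof (intro conjI allI)
    show "\<phi> (y + z) = \<phi> y + \<phi> z" for y z
      by (simp add: \<phi>_def complex_linear_add[OF w_linear] distrib_left sum.distrib)
    show "\<phi> (c *s z) = c * \<phi> z" for c z
      by (simp add: \<phi>_def complex_linear_scale[OF w_linear] sum_distrib_left mult.left_commute)
  qed
  have small: "\<phi> (p c) = of_int (s c)" if "c < d" for c
  proof -
    have "\<phi> (p c) = (\<Sum>i<d. of_int (s i) * (if i = c then 1 else 0))"
      unfolding \<phi>_def using that by (intro sum.cong) (auto simp: w_p)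
    also have "\<dots> = of_int (s c)" using that by (simp add: if_distrib cong: if_cong)
    finally show ?thesis .
  qed
  have "\<phi> (p c) \<in> \<int>" if c: "c < CARD('n) + m" for c
  proof (cases "c < d")
    case True
    then show ?thesis by (simp add: small)
  next
    case False
    then have k: "c - d < 2 * m" "d + (c - d) = c" using c dim by simp_all
    have "\<phi> (p c) = (\<Sum>i<d. of_int (s i) * of_real (Re (w i (p c))))"
      unfolding \<phi>_def using w_p_real[OF _ c] by (intro sum.cong) auto
    also have "\<dots> = of_real (pairing s t (c - d)) - of_int (t (c - d))"
      by (simp add: pairing_def k(2))
    also have "\<dots> = of_int (- t (c - d))" by (simp add: zero[OF k(1)])
    finally show ?thesis by (simp only: Ints_of_int)
  qed
  then have "\<phi> l \<in> \<int>" if "l \<in> \<Lambda>" for l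
    using that unfolding lattice
    by (auto simp: complex_linear_simps[OF \<phi>_linear] intro!: Ints_sum Ints_mult)
  then have "\<phi> (p i) = 0" by (rule cousin_integral_functional[OF assms(1) \<phi>_linear])
  then show False using small[OF s(1)] s(2) by simp
qed

text \<open>The Euclidean norm dominates the maximum norm \<open>\<eta>\<close>, which is positive
  by \<open>pairing_nonzero\<close>. The power of \<open>a\<close> becomes an exponential to match
  the growth of the \<open>e j\<close> on a tube.\<close>

lemma pairing_small:
  assumes "cousin \<Lambda>" and a: "0 < a" "a < 1" and C: "0 < C"
    and \<sigma>: "\<sigma> \<in> carrier_vec d" "\<sigma> \<noteq> 0\<^sub>v d" and \<tau>: "\<tau> \<in> carrier_vec (2 * m)"
    and less: "L2_set (vec_index (transpose_mat (hcat R1_mat R2_mat) *\<^sub>v map_vec real_of_int \<sigma>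
                             + map_vec real_of_int \<tau>)) {..<2 * m}
            < C * a ^ nat (\<Sum>i<d. \<bar>vec_index \<sigma> i\<bar>)"
  shows "\<exists>s t \<eta>. 0 < \<eta> \<and> (\<forall>k<2 * m. \<bar>pairing s t k\<bar> \<le> \<eta>) \<and> (\<exists>k<2 * m. \<bar>pairing s t k\<bar> = \<eta>) \<and>
     \<eta> \<le> C * exp (ln a * (\<Sum>i<d. \<bar>of_int (s i)\<bar>))"
proof -
  define s where "s = vec_index \<sigma>"
  define t where "t = vec_index \<tau>"
  define \<eta> where "\<eta> = Max ((\<lambda>k. \<bar>pairing s t k\<bar>) ` {..<2 * m})"
  have "0 \<in> {..<2 * m}" using m_pos by simp
  then have ne: "{..<2 * m} \<noteq> {}" by (rule ex_in_conv[THEN iffD1, OF exI])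
  have le: "\<bar>pairing s t k\<bar> \<le> \<eta>" if "k < 2 * m" for k
    unfolding \<eta>_def using that by (intro Max_ge) auto
  have "\<eta> \<in> (\<lambda>k. \<bar>pairing s t k\<bar>) ` {..<2 * m}"
    unfolding \<eta>_def using ne by (intro Max_in) auto
  then obtain k where k: "\<eta> = \<bar>pairing s t k\<bar>" "k \<in> {..<2 * m}" by (rule imageE)
  have "\<exists>i<d. s i \<noteq> 0"
  proof (rule ccontr)
    assume "\<not> (\<exists>i<d. s i \<noteq> 0)"
    then have "\<sigma> = 0\<^sub>v d" using \<sigma>(1) by (intro eq_vecI) (auto simp: s_def)
    then show False using \<sigma>(2) by simp
  qed
  then obtain i where "i < d" "s i \<noteq> 0" by (elim exE conjE)
  from pairing_nonzero[OF assms(1), of i s, OF this, of t]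
  obtain k' where "k' < 2 * m" "pairing s t k' \<noteq> 0" by (elim exE conjE)
  then have pos: "0 < \<eta>" using le[of k'] by linarith
  have "\<eta> \<le> L2_set (\<lambda>k. \<bar>pairing s t k\<bar>) {..<2 * m}"
    unfolding k(1) using k(2) by (intro member_le_L2_set) auto
  also have "\<dots> = L2_set (pairing s t) {..<2 * m}" by (simp add: L2_set_def)
  also have "\<dots> = L2_set (vec_index (transpose_mat (hcat R1_mat R2_mat) *\<^sub>v map_vec real_of_int \<sigma>
                             + map_vec real_of_int \<tau>)) {..<2 * m}"
    unfolding s_def t_def by (intro L2_set_cong refl index_transpose_R[symmetric] \<sigma> \<tau>) simp
  also note less
  also have "a ^ nat (\<Sum>i<d. \<bar>vec_index \<sigma> i\<bar>) = exp (ln a * (\<Sum>i<d. \<bar>of_int (s i)\<bar>))"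
  proof -
    have "0 \<le> (\<Sum>i<d. \<bar>vec_index \<sigma> i\<bar>)" by (intro sum_nonneg) simp
    then have "real (nat (\<Sum>i<d. \<bar>vec_index \<sigma> i\<bar>)) = (\<Sum>i<d. \<bar>of_int (s i)\<bar>)"
      by (simp add: s_def)
    then show ?thesis
      using exp_of_nat_mult[of "nat (\<Sum>i<d. \<bar>vec_index \<sigma> i\<bar>)" "ln a"] a(1) by (simp add: mult.commute)
  qed
  finally show ?thesis
    using pos le k(1,2) by (intro exI[of _ s] exI[of _ t] exI[of _ \<eta>]) auto
qed

text \<open>As \<open>C\<close> is arbitrary, the terms can be chosen one after another: the first
  with \<open>C = 1/100\<close>, each further one with \<open>C\<close> a hundredth of the preceding
  \<open>\<eta>\<close>.\<close>

lemma ex_resonant_sequence: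
  assumes rho: "0 < \<rho>"
    and small: "\<And>C. 0 < C \<Longrightarrow> \<exists>s t \<eta>. 0 < \<eta> \<and> (\<forall>k<2 * m. \<bar>pairing s t k\<bar> \<le> \<eta>) \<and>
       (\<exists>k<2 * m. \<bar>pairing s t k\<bar> = \<eta>) \<and> \<eta> \<le> C * exp (- 2 * pi * \<rho> * (\<Sum>i<d. \<bar>of_int (s i)\<bar>))"
  obtains \<sigma> \<tau> \<eta> where "resonant_sequence \<Lambda> m d p x w \<sigma> \<tau> \<eta> \<rho>"
proof -
  \<comment> \<open>The triple \<open>q\<close> holds the data \<open>s\<close>, \<open>t\<close>
    and \<open>\<eta>\<close> of one term.\<close>
  define good where "good q C \<longleftrightarrow> 0 < snd (snd q) \<and> (\<forall>k<2 * m. \<bar>pairing (fst q) (fst (snd q)) k\<bar> \<le> snd (snd q)) \<and>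
       (\<exists>k<2 * m. \<bar>pairing (fst q) (fst (snd q)) k\<bar> = snd (snd q)) \<and>
       snd (snd q) \<le> C * exp (- 2 * pi * \<rho> * (\<Sum>i<d. \<bar>of_int (fst q i)\<bar>))" for q C
  have ex: "\<exists>q. good q C" if C: "0 < C" for C
  proof -
    obtain s t \<eta> where "0 < \<eta> \<and> (\<forall>k<2 * m. \<bar>pairing s t k\<bar> \<le> \<eta>) \<and>
       (\<exists>k<2 * m. \<bar>pairing s t k\<bar> = \<eta>) \<and> \<eta> \<le> C * exp (- 2 * pi * \<rho> * (\<Sum>i<d. \<bar>of_int (s i)\<bar>))"
      using small[OF C] by (elim exE)
    then have "good (s, t, \<eta>) C" unfolding good_def fst_conv snd_conv .
    then show ?thesis by (rule exI)
  qed
  define q0 where "q0 = (SOME q. good q (1 / 100))"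
  define nxt where "nxt q = (SOME q'. good q' (snd (snd q) / 100))" for q :: "(nat \<Rightarrow> int) \<times> (nat \<Rightarrow> int) \<times> real"
  define q where "q = rec_nat q0 (\<lambda>_. nxt)"
  have q: "q 0 = q0" "q (Suc j) = nxt (q j)" for j by (simp_all add: q_def)
  have g0: "good (q 0) (1 / 100)"
    unfolding q(1) q0_def by (rule someI_ex[OF ex]) simp
  have step: "good (q (Suc j)) (snd (snd (q j)) / 100)" if "0 < snd (snd (q j))" for j
    unfolding q(2) nxt_def by (rule someI_ex[OF ex]) (use that in simp)
  have pos: "0 < snd (snd (q j))" for j
  proof (induction j)
    case 0
    show ?case using g0 unfolding good_def by (rule conjunct1)
  next
    case (Suc j)
    show ?case using step[OF Suc] unfolding good_def by (rule conjunct1)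
  qed
  define C where "C j = (case j of 0 \<Rightarrow> 1 / 100 | Suc i \<Rightarrow> snd (snd (q i)) / 100)" for j
  have good: "good (q j) (C j)" for j
  proof (cases j)
    case 0
    show ?thesis using g0 unfolding 0 C_def nat.case .
  next
    case (Suc i)
    show ?thesis using step[OF pos] unfolding Suc C_def nat.case .
  qed
  define \<sigma> where "\<sigma> j = fst (q j)" for j
  define \<tau> where "\<tau> j = fst (snd (q j))" for j
  define \<eta> where "\<eta> j = snd (snd (q j))" for j
  have G: "\<forall>k<2 * m. \<bar>pairing (\<sigma> j) (\<tau> j) k\<bar> \<le> \<eta> j" "\<exists>k<2 * m. \<bar>pairing (\<sigma> j) (\<tau> j) k\<bar> = \<eta> j"
    "\<eta> j \<le> C j * exp (- 2 * pi * \<rho> * (\<Sum>i<d. \<bar>of_int (\<sigma> j i)\<bar>))" for j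
  proof -
    note * = good[of j, unfolded good_def, folded \<sigma>_def \<tau>_def \<eta>_def, THEN conjunct2]
    show "\<forall>k<2 * m. \<bar>pairing (\<sigma> j) (\<tau> j) k\<bar> \<le> \<eta> j" by (rule *[THEN conjunct1])
    show "\<exists>k<2 * m. \<bar>pairing (\<sigma> j) (\<tau> j) k\<bar> = \<eta> j" by (rule *[THEN conjunct2, THEN conjunct1])
    show "\<eta> j \<le> C j * exp (- 2 * pi * \<rho> * (\<Sum>i<d. \<bar>of_int (\<sigma> j i)\<bar>))"
      by (rule *[THEN conjunct2, THEN conjunct2])
  qed
  have "resonant_sequence \<Lambda> m d p x w \<sigma> \<tau> \<eta> \<rho>"
  proof (intro resonant_sequence.intro resonant_sequence_axioms.intro)
    show "adapted_basis \<Lambda> m d p x w" by (rule adapted_basis_axioms)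
    show "0 < \<rho>" by (rule rho)
    show "0 < \<eta> j" for j unfolding \<eta>_def by (rule pos)
    show "\<bar>(\<Sum>i<d. real_of_int (\<sigma> j i) * Re (w i (p (d + k)))) + real_of_int (\<tau> j k)\<bar> \<le> \<eta> j" if "k < 2 * m" for k j
      using G(1)[of j] that unfolding pairing_def by simp
    show "\<exists>k<2 * m. \<bar>(\<Sum>i<d. real_of_int (\<sigma> j i) * Re (w i (p (d + k)))) + real_of_int (\<tau> j k)\<bar> = \<eta> j" for j
      using G(2)[of j] unfolding pairing_def .
    show "\<eta> 0 \<le> exp (- 2 * pi * \<rho> * (\<Sum>i<d. \<bar>real_of_int (\<sigma> 0 i)\<bar>)) / 100"
      using G(3)[of 0] by (simp add: C_def)
    show "\<eta> (Suc j) \<le> \<eta> j / 100 * exp (- 2 * pi * \<rho> * (\<Sum>i<d. \<bar>real_of_int (\<sigma> (Suc j) i)\<bar>))" for j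
      using G(3)[of "Suc j"] by (simp add: C_def \<eta>_def)
  qed
  then show ?thesis by (rule that)
qed

end

theorem theorem3p4:
  fixes \<Lambda> :: "(complex^'n) set"
  assumes "cousin \<Lambda>"
    and "\<And>U. openin (quot_topology \<Lambda>) U \<Longrightarrow> convex (qproj \<Lambda> -` U) \<Longrightarrow>
           vectorspace.fin_dim class_ring (cech_H1 (quot_topology \<Lambda>) (quot_sheaf_O \<Lambda>) U)"
  shows "strongly_dispersive \<Lambda>"
proof -
  obtain m d p x w where "adapted_basis \<Lambda> m d p x w"
    by (rule cousin_adapted_basis[OF assms(1)])
  then interpret adapted_basis \<Lambda> m d p x w .
  \<comment> \<open>The estimate is proved for the normal form of the adapted basis. If it fails for
    some \<open>a\<close>, an open set with convex inverse image has infinite dimensional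
    cohomology.\<close>
  have "\<exists>C>0. \<forall>\<sigma> \<in> carrier_vec d. \<forall>\<tau> \<in> carrier_vec (2 * m). \<sigma> \<noteq> 0\<^sub>v d \<longrightarrow>
      L2_set (vec_index (transpose_mat (hcat R1_mat R2_mat) *\<^sub>v map_vec real_of_int \<sigma>
                             + map_vec real_of_int \<tau>)) {..<2 * m}
        \<ge> C * a ^ nat (\<Sum>i<d. \<bar>vec_index \<sigma> i\<bar>)" if a: "0 < a" "a < 1" for a :: real
  proof (rule ccontr)
    assume neg: "\<not> ?thesis"
    \<comment> \<open>The half-width for which powers of \<open>a\<close> are exactly the decay that
      offsets the growth of the \<open>e j\<close> on the tube.\<close>
    define \<rho> where "\<rho> = - ln a / (2 * pi)"
    have \<rho>: "0 < \<rho>" "ln a = - 2 * pi * \<rho>"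
      using a by (simp_all add: \<rho>_def divide_neg_pos)
    have small: "\<exists>s t \<eta>. 0 < \<eta> \<and> (\<forall>k<2 * m. \<bar>pairing s t k\<bar> \<le> \<eta>) \<and> (\<exists>k<2 * m. \<bar>pairing s t k\<bar> = \<eta>) \<and>
        \<eta> \<le> C * exp (- 2 * pi * \<rho> * (\<Sum>i<d. \<bar>of_int (s i)\<bar>))" if C: "0 < C" for C
    proof -
      obtain \<sigma> \<tau> where "\<sigma> \<in> carrier_vec d" "\<sigma> \<noteq> 0\<^sub>v d" "\<tau> \<in> carrier_vec (2 * m)"
        "L2_set (vec_index (transpose_mat (hcat R1_mat R2_mat) *\<^sub>v map_vec real_of_int \<sigma>
                             + map_vec real_of_int \<tau>)) {..<2 * m} < C * a ^ nat (\<Sum>i<d. \<bar>vec_index \<sigma> i\<bar>)"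
      proof -
        let ?P = "\<lambda>\<sigma> \<tau>. \<sigma> \<noteq> 0\<^sub>v d \<longrightarrow> C * a ^ nat (\<Sum>i<d. \<bar>vec_index \<sigma> i\<bar>) \<le>
          L2_set (vec_index (transpose_mat (hcat R1_mat R2_mat) *\<^sub>v map_vec real_of_int \<sigma>
                             + map_vec real_of_int \<tau>)) {..<2 * m}"
        have "\<not> (\<forall>\<sigma>\<in>carrier_vec d. \<forall>\<tau>\<in>carrier_vec (2 * m). ?P \<sigma> \<tau>)"
        proof
          assume "\<forall>\<sigma>\<in>carrier_vec d. \<forall>\<tau>\<in>carrier_vec (2 * m). ?P \<sigma> \<tau>"
          with C have "\<exists>C>0. \<forall>\<sigma>\<in>carrier_vec d. \<forall>\<tau>\<in>carrier_vec (2 * m). \<sigma> \<noteq> 0\<^sub>v d \<longrightarrow>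
              C * a ^ nat (\<Sum>i<d. \<bar>vec_index \<sigma> i\<bar>) \<le>
              L2_set (vec_index (transpose_mat (hcat R1_mat R2_mat) *\<^sub>v map_vec real_of_int \<sigma>
                             + map_vec real_of_int \<tau>)) {..<2 * m}"
            by (intro exI[of _ C] conjI)
          with neg show False by (rule notE)
        qed
        then show ?thesis
          unfolding ball_simps not_imp not_le bex_simps by (elim bexE conjE) (rule that)
      qed
      from pairing_small[OF assms(1) a C this] show ?thesis unfolding \<rho>(2) .
    qed
    obtain \<sigma> \<tau> \<eta> where "resonant_sequence \<Lambda> m d p x w \<sigma> \<tau> \<eta> \<rho>"
      by (rule ex_resonant_sequence[OF \<rho>(1) small])
    then interpret res: resonant_sequence \<Lambda> m d p x w \<sigma> \<tau> \<eta> \<rho> .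
    have "discrete_subgroup \<Lambda>" using assms(1) by (simp add: cousin_def)
    note H1 = res.H1_not_fin_dim[OF this]
    show False using H1(3) assms(2)[OF H1(1,2)] by (rule notE)
  qed
  note * = this
  show ?thesis
    unfolding strongly_dispersive_def
  proof (rule exI[of _ m], rule exI[of _ M_mat], rule exI[of _ N_mat], rule exI[of _ R1_mat],
      rule exI[of _ R2_mat], intro conjI allI impI)
    show "normal_form \<Lambda> m M_mat N_mat R1_mat R2_mat" by (rule normal_form)
    fix a :: real assume "0 < a \<and> a < 1"
    then show "\<exists>C>0. \<forall>\<sigma>\<in>carrier_vec (CARD('n) - m). \<forall>\<tau>\<in>carrier_vec (2 * m). \<sigma> \<noteq> 0\<^sub>v (CARD('n) - m) \<longrightarrow>
        C * a ^ nat (\<Sum>i<CARD('n) - m. \<bar>vec_index \<sigma> i\<bar>) \<le>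
        L2_set (vec_index (transpose_mat (hcat R1_mat R2_mat) *\<^sub>v map_vec real_of_int \<sigma>
                             + map_vec real_of_int \<tau>)) {..<2 * m}"
      unfolding n_diff_m by (intro *) simp_all
  qed
qed

end
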